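(* Let $p\equiv 1\bmod 8$ be a prime number, let $j\in\mathbb{Z}$ satisfy $j^2\equiv -1\bmod p$, and let $E$ be the elliptic curve $y^2=x^3-x$. Then the $2$-Selmer group of $E$ over $\mathbb{Q}(\sqrt{p})$ satisfies \[ \dim_{\mathbb{F}_2} S^2(E/\mathbb{Q}(\sqrt{p}))= \begin{cases} 4 & \text{if } \left(\frac{1+j}{p}\right)=1,\\ 2 & \text{if } \left(\frac{1+j}{p}\right)=-1. \end{cases} \]
   Context: $\left(\frac{\cdot}{p}\right)$ denotes the Legendre symbol. $S^2(E/K)$, for $K=\mathbb{Q}(\sqrt{p})$, is the usual $2$-Selmer group (attached to multiplication by $2$), described as follows. Let $S$ consist of the two primes of $K$ above $2$ and the two real places of $K$. Let $K(S)=\{x\in K^*/{K^*}^2 : v(x)\equiv 0\bmod 2\text{ for all } v\notin S\}$ and $H=\{(c_1,c_2,c_3)\in K(S)^3 : c_1c_2c_3=1\}$. The Kummer homomorphism $\delta\colon E(K)\to H$ is given (modulo squares) by $\delta(a,b)=(a+1,a,a-1)$ if $b\neq0$, $\delta(-1,0)=(2,-1,-2)$, $\delta(0,0)=(1,-1,-1)$, $\delta(1,0)=(2,1,2)$, and the point at infinity maps to $(1,1,1)$. For each place $v$ of $K$ the same formulas give the local map $\delta_v\colon E(K_v)\to H_v=\{(c_1,c_2,c_3)\in (K_v^*/{K_v^*}^2)^3 : c_1c_2c_3=1\}$, and $\iota_v\colon H\to H_v$ is the natural map. Then $S^2(E/K)=\{c\in H : \iota_v(c)\in\delta_v(E(K_v))\text{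 for all } v\in S\}$, which is an $\mathbb{F}_2$-vector space. *)

theory Defs
  imports
    "HOL-Number_Theory.Number_Theory"
    "HOL-Algebra.Algebraic_Closure_Type"
    "Jordan_Normal_Form.Missing_VectorSpace"
begin

section \<open>Real quadratic fields\<close>

definition quadratic_field :: "nat \<Rightarrow> real ring" where
  "quadratic_field d =
     ring_of_type_algebra \<lparr>carrier := {of_rat a + of_rat b * sqrt (real d) |a b. True}\<rparr>"

section \<open>Places and completions\<close>

text \<open>A finite place (prime) of a number field is represented by its normalised discrete
  valuation. The value at zero is irrelevant and never used.\<close>

definition discrete_valuation :: "'a ring \<Rightarrow> ('a \<Rightarrow> int) \<Rightarrow> bool" where
  "discrete_valuation K v \<longleftrightarrow>
     v ` carrier (mult_of K) = UNIV \<and>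
     (\<forall>x \<in> carrier (mult_of K). \<forall>y \<in> carrier (mult_of K).
        v (x \<otimes>\<^bsub>K\<^esub> y) = v x + v y \<and>
        (x \<oplus>\<^bsub>K\<^esub> y \<noteq> \<zero>\<^bsub>K\<^esub> \<longrightarrow> min (v x) (v y) \<le> v (x \<oplus>\<^bsub>K\<^esub> y)))"

definition real_embedding :: "'a ring \<Rightarrow> ('a \<Rightarrow> real) \<Rightarrow> bool" where
  "real_embedding K \<sigma> \<longleftrightarrow> \<sigma> \<in> ring_hom K ring_of_type_algebra"

datatype 'a place = Finite_Place "'a \<Rightarrow> int" | Real_Place "'a \<Rightarrow> real"

text \<open>The base 2 in the finite case is immaterial for the completion; it is the cardinality of the
  residue field at the primes above 2 of a field in which 2 splits completely.\<close>

fun place_abs :: "'a ring \<Rightarrow> 'a place \<Rightarrow> 'a \<Rightarrow> real" where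
  "place_abs K (Finite_Place v) x = (if x = \<zero>\<^bsub>K\<^esub> then 0 else 2 powi (- v x))"
| "place_abs K (Real_Place \<sigma>) x = \<bar>\<sigma> x\<bar>"

text \<open>The completion is the ring of Cauchy sequences modulo the ideal of null sequences.\<close>

definition cauchy_ring :: "'a ring \<Rightarrow> 'a place \<Rightarrow> (nat \<Rightarrow> 'a) ring" where
  "cauchy_ring K v =
     \<lparr>carrier = {s. (\<forall>n. s n \<in> carrier K) \<and>
        (\<forall>e>0. \<exists>N. \<forall>m\<ge>N. \<forall>n\<ge>N. place_abs K v (s m \<ominus>\<^bsub>K\<^esub> s n) < e)},
      monoid.mult = (\<lambda>s t n. s n \<otimes>\<^bsub>K\<^esub> t n),
      one = (\<lambda>n. \<one>\<^bsub>K\<^esub>),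
      zero = (\<lambda>n. \<zero>\<^bsub>K\<^esub>),
      add = (\<lambda>s t n. s n \<oplus>\<^bsub>K\<^esub> t n)\<rparr>"

definition null_seqs :: "'a ring \<Rightarrow> 'a place \<Rightarrow> (nat \<Rightarrow> 'a) set" where
  "null_seqs K v = {s \<in> carrier (cauchy_ring K v). (\<lambda>n. place_abs K v (s n)) \<longlonglongrightarrow> 0}"

definition completion :: "'a ring \<Rightarrow> 'a place \<Rightarrow> (nat \<Rightarrow> 'a) set ring" where
  "completion K v = cauchy_ring K v Quot null_seqs K v"

definition completion_embed :: "'a ring \<Rightarrow> 'a place \<Rightarrow> 'a \<Rightarrow> (nat \<Rightarrow> 'a) set" where
  "completion_embed K v x = null_seqs K v +>\<^bsub>cauchy_ring K v\<^esub> (\<lambda>n. x)"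

section \<open>Square classes\<close>

definition nonzero_squares :: "'a ring \<Rightarrow> 'a set" where
  "nonzero_squares R = {x \<otimes>\<^bsub>R\<^esub> x |x. x \<in> carrier (mult_of R)}"

definition sq_group :: "'a ring \<Rightarrow> 'a set monoid" where
  "sq_group R = mult_of R Mod nonzero_squares R"

definition sq_class :: "'a ring \<Rightarrow> 'a \<Rightarrow> 'a set" where
  "sq_class R x = nonzero_squares R #>\<^bsub>mult_of R\<^esub> x"

definition prod_one_triples :: "'a ring \<Rightarrow> ('a set \<times> 'a set \<times> 'a set) monoid" where
  "prod_one_triples R =
     (sq_group R \<times>\<times> sq_group R \<times>\<times> sq_group R)
       \<lparr>carrier := {(c1, c2, c3). c1 \<in> carrier (sq_group R) \<and> c2 \<in> carrier (sq_group R) \<and>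
          c3 \<in> carrier (sq_group R) \<and>
          c1 \<otimes>\<^bsub>sq_group R\<^esub> c2 \<otimes>\<^bsub>sq_group R\<^esub> c3 = \<one>\<^bsub>sq_group R\<^esub>}\<rparr>"

text \<open>The map on square classes induced by the embedding of \<open>K\<close> into its completion; the image
  below is a singleton since squares map to squares.\<close>

definition local_class :: "'a ring \<Rightarrow> 'a place \<Rightarrow> 'a set \<Rightarrow> (nat \<Rightarrow> 'a) set set" where
  "local_class K v C =
     the_elem ((\<lambda>x. sq_class (completion K v) (completion_embed K v x)) ` C)"

fun local_triple :: "'a ring \<Rightarrow> 'a place \<Rightarrow> 'a set \<times> 'a set \<times> 'a set \<Rightarrow>
    (nat \<Rightarrow> 'a) set set \<times> (nat \<Rightarrow> 'a) set set \<times> (nat \<Rightarrow> 'a) set set" where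
  "local_triple K v (c1, c2, c3) = (local_class K v c1, local_class K v c2, local_class K v c3)"

section \<open>The curve \<open>y\<^sup>2 = x\<^sup>3 - x\<close> and its Kummer map\<close>

datatype 'a point = Infinity | Affine 'a 'a

definition curve_points :: "'a ring \<Rightarrow> 'a point set" where
  "curve_points R = insert Infinity
     {Affine a b |a b. a \<in> carrier R \<and> b \<in> carrier R \<and>
        b [^]\<^bsub>R\<^esub> (2::nat) = a [^]\<^bsub>R\<^esub> (3::nat) \<ominus>\<^bsub>R\<^esub> a}"

definition two_of :: "'a ring \<Rightarrow> 'a" where
  "two_of R = \<one>\<^bsub>R\<^esub> \<oplus>\<^bsub>R\<^esub> \<one>\<^bsub>R\<^esub>"

definition sq_triple :: "'a ring \<Rightarrow> 'a \<Rightarrow> 'a \<Rightarrow> 'a \<Rightarrow> 'a set \<times> 'a set \<times> 'a set" where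
  "sq_triple R x y z = (sq_class R x, sq_class R y, sq_class R z)"

text \<open>The last alternative is the point \<open>(1, 0)\<close>.\<close>

fun kummer :: "'a ring \<Rightarrow> 'a point \<Rightarrow> 'a set \<times> 'a set \<times> 'a set" where
  "kummer R Infinity = sq_triple R \<one>\<^bsub>R\<^esub> \<one>\<^bsub>R\<^esub> \<one>\<^bsub>R\<^esub>"
| "kummer R (Affine a b) =
     (if b \<noteq> \<zero>\<^bsub>R\<^esub> then sq_triple R (a \<oplus>\<^bsub>R\<^esub> \<one>\<^bsub>R\<^esub>) a (a \<ominus>\<^bsub>R\<^esub> \<one>\<^bsub>R\<^esub>)
      else if a = \<ominus>\<^bsub>R\<^esub> \<one>\<^bsub>R\<^esub> then sq_triple R (two_of R) (\<ominus>\<^bsub>R\<^esub> \<one>\<^bsub>R\<^esub>) (\<ominus>\<^bsub>R\<^esub> two_of R)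
      else if a = \<zero>\<^bsub>R\<^esub> then sq_triple R \<one>\<^bsub>R\<^esub> (\<ominus>\<^bsub>R\<^esub> \<one>\<^bsub>R\<^esub>) (\<ominus>\<^bsub>R\<^esub> \<one>\<^bsub>R\<^esub>)
      else sq_triple R (two_of R) \<one>\<^bsub>R\<^esub> (two_of R))"

section \<open>The 2-Selmer group\<close>

text \<open>The definitions of this section are meant for real quadratic fields \<open>K\<close>, where every
  Archimedean place is real. A finite place lies above 2 iff \<open>v(2) > 0\<close>; there are two
  such places when 2 splits in \<open>K\<close>, as it does in \<open>\<rat>(\<surd>p)\<close> for \<open>p \<equiv> 1 (mod 8)\<close>.\<close>

definition bad_places :: "'a ring \<Rightarrow> 'a place set" where
  "bad_places K =
     {Finite_Place v |v. discrete_valuation K v \<and> v (two_of K) > 0} \<union>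
     {Real_Place \<sigma> |\<sigma>. real_embedding K \<sigma>}"

definition unramified_classes :: "'a ring \<Rightarrow> 'a set set" where
  "unramified_classes K = {C \<in> carrier (sq_group K).
     \<forall>v. discrete_valuation K v \<and> Finite_Place v \<notin> bad_places K \<longrightarrow> (\<forall>x \<in> C. even (v x))}"

definition selmer_ambient :: "'a ring \<Rightarrow> ('a set \<times> 'a set \<times> 'a set) set" where
  "selmer_ambient K = {(c1, c2, c3) \<in> carrier (prod_one_triples K).
     c1 \<in> unramified_classes K \<and> c2 \<in> unramified_classes K \<and> c3 \<in> unramified_classes K}"

definition selmer_set :: "'a ring \<Rightarrow> ('a set \<times> 'a set \<times> 'a set) set" where
  "selmer_set K = {c \<in> selmer_ambient K. \<forall>v \<in> bad_places K.
     local_triple K v c \<in> kummer (completion K v) ` curve_points (completion K v)}"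

definition selmer_group :: "'a ring \<Rightarrow> ('a set \<times> 'a set \<times> 'a set) monoid" where
  "selmer_group K = (prod_one_triples K)\<lparr>carrier := selmer_set K\<rparr>"

text \<open>A group of exponent 2, written multiplicatively, as a module over \<open>\<int>/2 = {0, 1}\<close>.
  The fields \<open>mult\<close> and \<open>one\<close>, which the record type of modules inherits from rings, play no role
  in the module axioms.\<close>

definition F2_module :: "'a monoid \<Rightarrow> (int, 'a) module" where
  "F2_module G = \<lparr>carrier = carrier G, monoid.mult = undefined, one = undefined,
     zero = \<one>\<^bsub>G\<^esub>, add = monoid.mult G, module.smult = (\<lambda>k x. x [^]\<^bsub>G\<^esub> k)\<rparr>"

definition selmer_space :: "'a ring \<Rightarrow> (int, 'a set \<times> 'a set \<times> 'a set) module" where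
  "selmer_space K = F2_module (selmer_group K)"

end

theory Submission
  imports Defs
begin

text \<open>
  Let \<open>K = \<rat>(\<surd>p)\<close>. A triple of classes with product 1 is determined by its first two entries
  \<open>x\<close> and \<open>y\<close>, and the decisive fact is that each local condition constrains \<open>x\<close> and \<open>y\<close>
  separately. At a real place the image of the Kummer map consists of the triples with \<open>x\<close> positive.
  At a place above 2 the completion is \<open>\<rat>\<^sub>2\<close>, where a square class is \<open>2\<^sup>k n\<close> with \<open>k\<close> modulo 2 and \<open>n\<close> odd
  modulo 8; there the image is given by \<open>n \<equiv> 1 (mod 4)\<close> for \<open>x\<close>, together with even \<open>k\<close> and
  \<open>n \<equiv> \<plusminus>1 (mod 8)\<close> for \<open>y\<close> (\<open>local_image_real\<close>, \<open>local_image_two_adic\<close>). So the Selmer group is a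
  product \<open>A \<times> B\<close> of two groups of square classes of \<open>K\<close>, those of the elements satisfying \<open>first_adm\<close> and
  \<open>second_adm\<close> (\<open>selmer_set_eq\<close>), and its dimension is read
  off from the numbers of elements of \<open>A\<close> and \<open>B\<close>.

  Write \<open>p = m\<^sup>2 + n\<^sup>2\<close> with \<open>4\<close> dividing \<open>m\<close>, and \<open>p = u\<^sup>2 - 2 w\<^sup>2\<close> with \<open>u > 0\<close> and \<open>w\<close> even; let
  \<open>\<epsilon> = m + \<surd>p\<close> and \<open>\<eta> = u + \<surd>p\<close> (\<open>eps\<close> and \<open>eta\<close>), of norms \<open>- n\<^sup>2\<close> and \<open>2 w\<^sup>2\<close>. If all valuations of \<open>x\<close> away from 2
  are even, then up to squares the norm of \<open>x\<close> is \<open>\<plusminus>1\<close> or \<open>\<plusminus>2\<close>. If the norm is a square, Hilbert 90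
  shows that \<open>x\<close> is a rational number times a square, and that number is \<open>\<plusminus>1\<close> or \<open>\<plusminus>2\<close> up to squares,
  because \<open>p\<close> is a square in \<open>K\<close>; if the norm is a square times \<open>-1\<close> or 2, one multiplies by \<open>\<epsilon>\<close> or \<open>\<eta>\<close> first.
  Elements of \<open>A\<close> are totally positive, so \<open>A\<close> is \<open>{1, 2}\<close> or \<open>{1, 2, \<eta>, 2 \<eta>}\<close>; elements of \<open>B\<close> have even
  valuation at every finite place, so \<open>B\<close> is \<open>{1, -1}\<close> or \<open>{1, -1, \<epsilon>, -\<epsilon>}\<close>.

  A computation in \<open>\<rat>\<^sub>2\<close> shows that \<open>\<eta>\<close> belongs to \<open>A\<close> iff \<open>u + w \<equiv> 1 (mod 4)\<close>, and \<open>\<epsilon>\<close> to \<open>B\<close> iff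
  \<open>m + n \<equiv> \<plusminus>1 (mod 8)\<close> (\<open>first_adm_eta\<close>, \<open>second_adm_eps\<close>). By quadratic reciprocity, applied to the
  odd divisors of \<open>m + n\<close>, \<open>n\<close>, \<open>u\<close> and \<open>w\<close>, each of these two congruences holds iff \<open>1 + j\<close> is a
  quadratic residue modulo \<open>p\<close>. Hence the Selmer group has 16 elements if it is one, and 4 otherwise.

  Two devices keep the argument inside \<open>K\<close>. Every nonzero element of a completion has the square class
  of an element of \<open>K\<close>, namely of a late term of a Cauchy sequence that represents it, so the local conditions become
  statements about \<open>K\<close> (\<open>local_image_iff\<close>). And the evenness of the norm is obtained by exhibiting enough
  valuations of \<open>K\<close>: over a prime \<open>q\<close> at which \<open>p\<close> has a \<open>q\<close>-adic square root they come from
  substituting that root for \<open>\<surd>p\<close>, over all other primes from the norm (\<open>even_valuations\<close>).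
\<close>

section \<open>Legendre symbols by quadratic reciprocity\<close>

lemma int_mod_eq_iff: "int n mod int k = int c \<longleftrightarrow> n mod k = c"
  by (metis of_nat_eq_iff zmod_int)

lemma Legendre_range: "Legendre a p \<in> {-1, 0, 1}"
  by (simp add: Legendre_def)

lemma Legendre_cong:
  assumes "[a = b] (mod p)"
  shows "Legendre a p = Legendre b p"
proof -
  have "[a = 0] (mod p) \<longleftrightarrow> [b = 0] (mod p)"
    using assms by (simp add: cong_def)
  moreover have "QuadRes p a \<longleftrightarrow> QuadRes p b"
    using assms by (simp add: QuadRes_def cong_def)
  ultimately show ?thesis by (simp add: Legendre_def)
qed

lemma eq_if_cong_unit_interval:
  fixes x y :: int
  assumes "[x = y] (mod p)" "x \<in> {-1, 0, 1}" "y \<in> {-1, 0, 1}" "2 < p"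
  shows "x = y"
proof -
  have "p dvd x - y" using assms(1) by (simp add: cong_iff_dvd_diff)
  moreover have "\<bar>x - y\<bar> < p" using assms(2-4) by auto
  ultimately show ?thesis using zdvd_not_zless[of "\<bar>x - y\<bar>" p] by fastforce
qed

lemma Legendre_mult:
  fixes p :: nat
  assumes "Factorial_Ring.prime p" "2 < p"
  shows "Legendre (a * b) p = Legendre a p * Legendre b p"
proof (rule eq_if_cong_unit_interval)
  have "[Legendre (a * b) p = (a * b) ^ ((p - 1) div 2)] (mod p)"
    by (rule euler_criterion[OF assms])
  also have "(a * b) ^ ((p - 1) div 2) = a ^ ((p - 1) div 2) * b ^ ((p - 1) div 2)"
    by (simp add: power_mult_distrib)
  also have "[\<dots> = Legendre a p * Legendre b p] (mod p)"
    by (intro cong_mult cong_sym[OF euler_criterion[OF assms]])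
  finally show "[Legendre (a * b) p = Legendre a p * Legendre b p] (mod p)" .
  show "Legendre (a * b) p \<in> {-1, 0, 1}" by (rule Legendre_range)
  show "Legendre a p * Legendre b p \<in> {-1, 0, 1}"
    using Legendre_range[of a p] Legendre_range[of b p] by auto
  show "2 < int p" using assms(2) by simp
qed

lemma Legendre_eq_1I:
  assumes "[a = y\<^sup>2] (mod p)" "\<not> p dvd a"
  shows "Legendre a p = 1"
  using assms by (auto simp: Legendre_def QuadRes_def cong_0_iff intro: cong_sym)

lemma Legendre_minus_one:
  fixes p :: nat
  assumes "Factorial_Ring.prime p" "2 < p"
  shows "Legendre (-1) p = (if p mod 4 = 1 then 1 else -1)"
proof (rule eq_if_cong_unit_interval)
  have odd: "odd p" using assms prime_odd_nat by auto
  have e: "(- 1 :: int) ^ ((p - 1) div 2) = (if p mod 4 = 1 then 1 else -1)"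
  proof (cases "p mod 4 = 1")
    case True
    then have "even ((p - 1) div 2)" by presburger
    then show ?thesis using True by simp
  next
    case False
    then have "odd ((p - 1) div 2)" using odd by presburger
    then show ?thesis using False by simp
  qed
  show "[Legendre (-1) p = (if p mod 4 = 1 then 1 else -1)] (mod p)"
    using euler_criterion[OF assms, of "-1"] unfolding e .
qed (use assms Legendre_range in auto)

text \<open>Gauss's lemma for the multiplier 2: with \<open>h = (p - 1) / 2\<close>, the residues among
  \<open>2, 4, \<dots>, 2 h\<close> that exceed \<open>h\<close> are the doubles of the \<open>h - h div 2\<close> numbers in \<open>{h div 2<..h}\<close>.\<close>
lemma Legendre_two:
  fixes p :: nat
  assumes "Factorial_Ring.prime p" "2 < p"
  shows "Legendre 2 p = (if p mod 8 \<in> {1, 7} then 1 else -1)"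
proof -
  have odd: "odd p" using assms prime_odd_nat by auto
  have "\<not> int p dvd 2" using assms(2) zdvd_not_zless by fastforce
  then interpret G: GAUSS p 2
    using assms by unfold_locales (auto simp: cong_0_iff)
  define h where "h = (int p - 1) div 2"
  have p: "int p = 2 * h + 1" using odd unfolding h_def by presburger
  have C: "G.C = (\<lambda>x. 2 * x) ` {0<..h}"
    unfolding G.C_def G.B_def G.A_def h_def[symmetric] image_image
    by (rule image_cong) (use p in auto)
  have E: "G.E = (\<lambda>x. 2 * x) ` {h div 2<..h}"
    unfolding G.E_def h_def[symmetric] C
    by (auto simp: image_iff)
  have "card G.E = nat (h - h div 2)"
    unfolding E by (subst card_image) (auto simp: inj_on_def)
  then have L: "Legendre 2 p = (-1) ^ nat (h - h div 2)"
    using G.gauss_lemma by simp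
  have h0: "h \<ge> 0" using assms p by linarith
  have parity: "(int p mod 8 = 1 \<or> int p mod 8 = 7) \<longleftrightarrow> even (h - h div 2)"
  proof -
    define t where "t = h div 4"
    have "h mod 4 = 0 \<or> h mod 4 = 1 \<or> h mod 4 = 2 \<or> h mod 4 = 3" by presburger
    moreover have "h = 4 * t + h mod 4" unfolding t_def by simp
    ultimately consider "h = 4 * t" | "h = 4 * t + 1" | "h = 4 * t + 2" | "h = 4 * t + 3" by fastforce
    then show ?thesis
    proof cases
      case 1
      have "int p = 8 * t + 1" using p 1 by simp
      then have "int p mod 8 = 1" by simp
      moreover have "h div 2 = 2 * t" using 1 by simp
      then have "h - h div 2 = 2 * t" using 1 by simp
      ultimately show ?thesis by simp
    next
      case 2
      have "int p = 8 * t + 3" using p 2 by simp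
      then have "int p mod 8 = 3" by simp
      moreover have "h div 2 = 2 * t" using 2 by simp
      then have "h - h div 2 = 2 * t + 1" using 2 by simp
      ultimately show ?thesis by simp
    next
      case 3
      have "int p = 8 * t + 5" using p 3 by simp
      then have "int p mod 8 = 5" by simp
      moreover have "h div 2 = 2 * t + 1" using 3 by simp
      then have "h - h div 2 = 2 * t + 1" using 3 by simp
      ultimately show ?thesis by simp
    next
      case 4
      have "int p = 8 * t + 7" using p 4 by simp
      then have "int p mod 8 = 7" by simp
      moreover have "h div 2 = 2 * t + 1" using 4 by simp
      then have "h - h div 2 = 2 * (t + 1)" using 4 by simp
      ultimately show ?thesis by simp
    qed
  qed
  moreover have "p mod 8 \<in> {1, 7} \<longleftrightarrow> int p mod 8 = 1 \<or> int p mod 8 = 7"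
  proof -
    have "p mod 8 = 1 \<longleftrightarrow> int p mod 8 = 1" "p mod 8 = 7 \<longleftrightarrow> int p mod 8 = 7"
      using int_mod_eq_iff[of p 8 1] int_mod_eq_iff[of p 8 7] by simp_all
    then show ?thesis by simp
  qed
  moreover have "0 \<le> h - h div 2" using h0 by presburger
  then have "even (nat (h - h div 2)) \<longleftrightarrow> even (h - h div 2)" by (simp add: even_nat_iff)
  ultimately show ?thesis unfolding L by simp
qed

lemma Legendre_prime_commute:
  fixes p q :: nat
  assumes "Factorial_Ring.prime p" "p mod 4 = 1" "Factorial_Ring.prime q" "2 < q" "p \<noteq> q"
  shows "Legendre (int q) (int p) = Legendre (int p) (int q)"
proof -
  have "p \<noteq> 2" using assms(2) by auto
  then have p2: "2 < p" using prime_ge_2_nat[OF assms(1)] by linarith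
  have "even ((p - 1) div 2)" using assms(2) by presburger
  then have "Legendre p q * Legendre q p = 1"
    using Quadratic_Reciprocity[OF assms(1) p2 assms(3-5)] by (simp add: power_mult)
  then show ?thesis
    using Legendre_range[of p q] Legendre_range[of q p] by auto
qed

text \<open>The residue of an odd square modulo 16 detects whether its root is \<open>\<plusminus>1\<close> modulo 8.\<close>
lemma odd_square_mod_16:
  fixes x :: int
  assumes "odd x" shows "x\<^sup>2 mod 16 = (if x mod 8 = 1 \<or> x mod 8 = 7 then 1 else 9)"
proof -
  define k where "k = x div 8"
  have dec: "x = 8 * k + x mod 8" by (simp add: k_def)
  have "x\<^sup>2 - (x mod 8)\<^sup>2 = (8 * k) * (8 * k + 2 * (x mod 8))"
    by (subst dec) (simp add: power2_eq_square algebra_simps)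
  also have "\<dots> = 16 * (k * (4 * k + (x mod 8)))" by (simp add: algebra_simps)
  finally have "x\<^sup>2 mod 16 = ((x mod 8)\<^sup>2) mod 16" by (simp add: mod_eq_dvd_iff)
  moreover have "x mod 8 = 1 \<or> x mod 8 = 3 \<or> x mod 8 = 5 \<or> x mod 8 = 7" using assms by presburger
  ultimately show ?thesis by auto
qed

text \<open>The quadratic characters of \<open>\<rat>(\<surd>2)\<close> and \<open>\<rat>(\<surd>-2)\<close>, on odd numbers.\<close>
definition chi8 :: "nat \<Rightarrow> int" where "chi8 n = (if n mod 8 \<in> {1, 7} then 1 else -1)"
definition chi8' :: "nat \<Rightarrow> int" where "chi8' n = (if n mod 8 \<in> {1, 3} then 1 else -1)"

lemma odd_mod_8: "odd (n::nat) \<Longrightarrow> n mod 8 \<in> {1, 3, 5, 7}"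
proof -
  assume "odd n"
  then have "n mod 8 = 1 \<or> n mod 8 = 3 \<or> n mod 8 = 5 \<or> n mod 8 = 7" by presburger
  then show ?thesis by auto
qed

lemma chi8_mult: "odd m \<Longrightarrow> odd n \<Longrightarrow> chi8 (m * n) = chi8 m * chi8 n"
proof -
  assume o: "odd m" "odd n"
  have "(m * n) mod 8 = ((m mod 8) * (n mod 8)) mod 8" by (simp add: mod_mult_eq)
  moreover have "\<forall>a \<in> {1, 3, 5, 7}. \<forall>b \<in> {1, 3, 5, 7}. F ((a * b) mod 8) = F a * F b"
    if "F = (\<lambda>r::nat. if r \<in> {1, 7} then 1 else (-1::int))" for F
    unfolding that by simp
  ultimately show ?thesis
    using odd_mod_8[OF o(1)] odd_mod_8[OF o(2)] unfolding chi8_def by metis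
qed

lemma chi8'_mult: "odd m \<Longrightarrow> odd n \<Longrightarrow> chi8' (m * n) = chi8' m * chi8' n"
proof -
  assume o: "odd m" "odd n"
  have "(m * n) mod 8 = ((m mod 8) * (n mod 8)) mod 8" by (simp add: mod_mult_eq)
  moreover have "\<forall>a \<in> {1, 3, 5, 7}. \<forall>b \<in> {1, 3, 5, 7}. F ((a * b) mod 8) = F a * F b"
    if "F = (\<lambda>r::nat. if r \<in> {1, 3} then 1 else (-1::int))" for F
    unfolding that by simp
  ultimately show ?thesis
    using odd_mod_8[OF o(1)] odd_mod_8[OF o(2)] unfolding chi8'_def by metis
qed

text \<open>Two multiplicative functions on odd numbers agree if they agree on primes. This replaces the Jacobi
  symbol in all the computations of Legendre symbols below.\<close>
lemma Legendre_eq_character: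
  fixes p N :: nat and \<chi> :: "nat \<Rightarrow> int"
  assumes p: "Factorial_Ring.prime p" "2 < p" and N: "odd N"
    and one: "\<chi> 1 = 1" and mult: "\<And>a b. odd a \<Longrightarrow> odd b \<Longrightarrow> \<chi> (a * b) = \<chi> a * \<chi> b"
    and primes: "\<And>q. Factorial_Ring.prime q \<Longrightarrow> q dvd N \<Longrightarrow> Legendre (int q) (int p) = \<chi> q"
  shows "Legendre (int N) (int p) = \<chi> N"
  using N primes
proof (induction N rule: less_induct)
  case (less N)
  show ?case
  proof (cases "N = 1")
    case True
    have "Legendre 1 (int p) = 1"
      by (rule Legendre_eq_1I[of _ 1]) (use p in auto)
    then show ?thesis using True one by simp
  next
    case False
    then obtain q where q: "Factorial_Ring.prime q" "q dvd N" using prime_factor_nat by blast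
    then obtain M where M: "N = q * M" by (elim dvdE)
    have "M \<noteq> 0" "q > 1" using M less.prems(1) q prime_gt_1_nat by (auto intro: Nat.gr0I)
    then have "M < N" using M by simp
    moreover have "odd M" "odd q" using less.prems(1) M by auto
    ultimately have "Legendre (int M) (int p) = \<chi> M"
      using less.IH[of M] less.prems(2) M by auto
    then show ?thesis
      using Legendre_mult[OF p, of q M] less.prems(2)[OF q] mult[OF \<open>odd q\<close> \<open>odd M\<close>] M by simp
  qed
qed

lemma Legendre_one: "Factorial_Ring.prime (q::nat) \<Longrightarrow> Legendre 1 q = 1"
  by (rule Legendre_eq_1I[of _ 1]) (use prime_gt_1_nat[of q] in auto)

lemma Legendre_two_chi8: "Factorial_Ring.prime q \<Longrightarrow> 2 < q \<Longrightarrow> Legendre 2 (int q) = chi8 q"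
  by (simp add: Legendre_two chi8_def)

lemma Legendre_minus_two_chi8':
  assumes "Factorial_Ring.prime q" "2 < q" shows "Legendre (-2) (int q) = chi8' q"
proof -
  have "odd q" using assms prime_odd_nat by auto
  have "Legendre (-2) q = Legendre (-1) q * Legendre 2 q" using Legendre_mult[OF assms, of "-1" 2] by simp
  moreover have "q mod 4 = (q mod 8) mod 4" by (simp add: mod_mod_cancel)
  ultimately show ?thesis
    using odd_mod_8[OF \<open>odd q\<close>] unfolding Legendre_minus_one[OF assms] Legendre_two[OF assms] chi8'_def
    by (elim insertE emptyE; simp)
qed

text \<open>If \<open>d p\<close> is a nonzero square modulo each prime \<open>q\<close> dividing \<open>N\<close>, then \<open>p\<close> and \<open>d\<close> have the same
  Legendre symbol \<open>\<chi>(q)\<close> at \<open>q\<close>, and since \<open>p \<equiv> 1 (mod 4)\<close>, reciprocity makes it the symbol of \<open>q\<close> at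
  \<open>p\<close>. A binary form representing \<open>p\<close> gives such squares for the divisors of its variables.\<close>
lemma Legendre_by_reciprocity:
  fixes p N :: nat and d :: int and \<chi> :: "nat \<Rightarrow> int"
  assumes p: "Factorial_Ring.prime p" "p mod 4 = 1" and N: "odd N"
    and one: "\<chi> 1 = 1" and mult: "\<And>a b. odd a \<Longrightarrow> odd b \<Longrightarrow> \<chi> (a * b) = \<chi> a * \<chi> b"
    and \<chi>: "\<And>q. Factorial_Ring.prime q \<Longrightarrow> 2 < q \<Longrightarrow> Legendre d (int q) = \<chi> q"
    and square: "\<And>q. Factorial_Ring.prime q \<Longrightarrow> int q dvd int N \<Longrightarrow>
      \<not> int q dvd d * int p \<and> (\<exists>y. [d * int p = y\<^sup>2] (mod int q))"
  shows "Legendre (int N) (int p) = \<chi> N"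
proof -
  have "p \<noteq> 1" "p \<noteq> 2" using p prime_gt_1_nat by auto
  then have p2: "2 < p" using prime_gt_1_nat[OF p(1)] by linarith
  show ?thesis
  proof (rule Legendre_eq_character[OF p(1) p2 N one mult])
    fix q assume q: "Factorial_Ring.prime q" "q dvd N"
    have "q \<noteq> 2" using N q(2) by auto
    then have q2: "2 < q" using prime_ge_2_nat[OF q(1)] by linarith
    have sq: "\<not> int q dvd d * int p" "\<exists>y. [d * int p = y\<^sup>2] (mod int q)" using square[OF q(1)] q(2) by simp_all
    then have "Legendre (d * int p) q = 1" using Legendre_eq_1I by blast
    then have "Legendre d q * Legendre p q = 1" using Legendre_mult[OF q(1) q2] by simp
    then have "Legendre p q = Legendre d q"
      using Legendre_range[of d q] Legendre_range[of p q] by auto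
    moreover have "p \<noteq> q" using sq(1) by auto
    ultimately show "Legendre (int q) (int p) = \<chi> q"
      using Legendre_prime_commute[OF p q(1) q2] \<chi>[OF q(1) q2] by simp
  qed
qed

lemma prime_dvd_prime_int: "Factorial_Ring.prime q \<Longrightarrow> Factorial_Ring.prime p \<Longrightarrow> int q dvd int p \<Longrightarrow> q = p"
  by (simp add: primes_dvd_imp_eq)

section \<open>Two binary quadratic forms representing p\<close>

text \<open>Thue's lemma: more than \<open>p\<close> pairs have both entries between \<open>0\<close> and \<open>\<surd>p\<close>, so two of them give the
  same value of \<open>x - r y\<close> modulo \<open>p\<close>.\<close>
lemma thue:
  fixes p :: nat and r :: int
  assumes p: "Factorial_Ring.prime p"
  obtains x y :: int where "(x, y) \<noteq> (0, 0)" "x\<^sup>2 < p" "y\<^sup>2 < p" "int p dvd x - r * y"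
proof -
  define k where "k = nat \<lfloor>sqrt (real p)\<rfloor>"
  have k: "k * k \<le> p" "p < (k + 1) * (k + 1)"
  proof -
    have "real k \<le> sqrt p" unfolding k_def by simp
    then have "real k * real k \<le> real p"
      by (metis mult_mono' of_nat_0_le_iff real_sqrt_mult_self abs_of_nat)
    then show "k * k \<le> p" by (metis of_nat_le_iff of_nat_mult)
    have "sqrt p < real (k + 1)" unfolding k_def by (simp add: nat_le_iff) linarith
    then have "sqrt p * sqrt p < real (k+1) * real (k+1)"
      by (intro mult_strict_mono) auto
    then have "real p < real ((k+1)*(k+1))" by (simp only: of_nat_mult real_sqrt_mult_self)
    then show "p < (k + 1) * (k + 1)" using of_nat_less_iff by blast
  qed
  have "k * k \<noteq> p"
  proof
    assume e: "k * k = p"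
    then have "k dvd p" by auto
    then have "k = 1 \<or> k = p" using p prime_nat_iff by blast
    then show False using e prime_gt_1_nat[OF p] by auto
  qed
  then have kk: "k * k < p" using k by linarith
  define f where "f = (\<lambda>(x, y). (int x - r * int y) mod int p)"
  have "\<not> inj_on f ({0..k} \<times> {0..k})"
  proof (rule pigeonhole)
    have "p > 0" by (rule prime_gt_0_nat[OF p])
    then have "f z \<in> {0..<int p}" for z by (cases z) (simp add: f_def)
    then have "f ` ({0..k} \<times> {0..k}) \<subseteq> {0..<int p}" by blast
    then have "card (f ` ({0..k} \<times> {0..k})) \<le> card {0..<int p}"
      by (rule card_mono[rotated]) (rule finite_atLeastLessThan_int)
    also have "card {0..<int p} = p" by simp
    also have "p < (k + 1) * (k + 1)" by (rule k(2))
    also have "(k + 1) * (k + 1) = card ({0..k} \<times> {0..k})"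
      by (simp add: card_cartesian_product del: mult_Suc mult_Suc_right)
    finally show "card (f ` ({0..k} \<times> {0..k})) < card ({0..k} \<times> {0..k})" .
  qed
  then obtain z z' where z: "z \<in> {0..k} \<times> {0..k}" "z' \<in> {0..k} \<times> {0..k}" "z \<noteq> z'" "f z = f z'"
    unfolding inj_on_def by blast
  obtain a b c d where "z = (a, b)" "z' = (c, d)" by (cases z, cases z')
  then have abcd: "a \<le> k" "b \<le> k" "c \<le> k" "d \<le> k" "(a, b) \<noteq> (c, d)" "f (a, b) = f (c, d)"
    using z by auto
  define x y where "x = int a - int c" and "y = int b - int d"
  have sm: "z\<^sup>2 < p" if "\<bar>z\<bar> \<le> int k" for z :: int
  proof -
    have "z\<^sup>2 \<le> (int k)\<^sup>2" using that by (metis abs_le_square_iff abs_of_nat)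
    also have "\<dots> < p" using kk by (simp add: power2_eq_square flip: of_nat_mult)
    finally show ?thesis .
  qed
  show thesis
  proof (rule that)
    show "(x, y) \<noteq> (0, 0)" using abcd(5) by (auto simp: x_def y_def)
    show "x\<^sup>2 < p" "y\<^sup>2 < p" using abcd by (auto intro!: sm simp: x_def y_def)
    have "int p dvd (int a - r * int b) - (int c - r * int d)"
      using abcd(6) by (simp add: f_def mod_eq_dvd_iff)
    then show "int p dvd x - r * y" by (simp add: x_def y_def algebra_simps)
  qed
qed

lemma sq_eq_prime_mult_sq:
  fixes x y :: int
  assumes p: "Factorial_Ring.prime p" and e: "x\<^sup>2 = p * y\<^sup>2"
  shows "y = 0"
proof (rule ccontr)
  assume y: "y \<noteq> 0"
  have pe: "prime_elem p" "p \<noteq> 0" using p by auto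
  then have "x \<noteq> 0" using e y by auto
  then have "multiplicity p (x\<^sup>2) = 2 * multiplicity p x"
    using pe by (simp add: prime_elem_multiplicity_power_distrib)
  moreover have "multiplicity p (p * y\<^sup>2) = 1 + 2 * multiplicity p y"
    using pe y by (simp add: prime_elem_multiplicity_mult_distrib prime_elem_multiplicity_power_distrib)
  ultimately have "2 * multiplicity p x = 1 + 2 * multiplicity p y" using e by simp
  then show False by presburger
qed

lemma QuadRes_two:
  fixes p :: nat
  assumes p: "Factorial_Ring.prime p" "p mod 8 = 1"
  obtains t :: int where "[t\<^sup>2 = 2] (mod p)" "\<not> int p dvd t"
proof -
  have "p \<noteq> 1" "p \<noteq> 2" using p prime_gt_1_nat by auto
  then have p2: "2 < p" using prime_gt_1_nat[OF p(1)] by linarith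
  then have nd: "\<not> int p dvd 2" using zdvd_not_zless by fastforce
  have "Legendre 2 p = 1" using Legendre_two[OF p(1) p2] p(2) by simp
  then obtain t :: int where t: "[t\<^sup>2 = 2] (mod p)"
    by (auto simp: Legendre_def QuadRes_def split: if_splits)
  moreover have "\<not> int p dvd t"
  proof
    assume "int p dvd t"
    then have "int p dvd t\<^sup>2" by (simp add: power2_eq_square)
    then show False using t nd cong_dvd_iff by blast
  qed
  ultimately show thesis using that by blast
qed

text \<open>A small solution of \<open>x \<equiv> j y\<close> has \<open>x\<^sup>2 + y\<^sup>2\<close> divisible by \<open>p\<close> and strictly between \<open>0\<close> and \<open>2 p\<close>.
  The even one of the two squares is a multiple of 16, because \<open>p \<equiv> 1 (mod 8)\<close>.\<close>
lemma sum_of_two_squares_prime: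
  fixes p :: nat and j :: int
  assumes p: "Factorial_Ring.prime p" "p mod 8 = 1" and j: "[j\<^sup>2 = -1] (mod p)"
  obtains m n :: int where "int p = m\<^sup>2 + n\<^sup>2" "4 dvd m" "odd n" "n > 0"
proof -
  obtain x y :: int where xy: "(x, y) \<noteq> (0, 0)" "x\<^sup>2 < p" "y\<^sup>2 < p" "int p dvd x - j * y"
    by (rule thue[OF p(1), of j])
  have d: "int p dvd x\<^sup>2 + y\<^sup>2"
  proof -
    have "int p dvd j\<^sup>2 + 1" using j by (simp add: cong_iff_dvd_diff)
    then have "int p dvd (x - j * y) * (x + j * y) + (j\<^sup>2 + 1) * y\<^sup>2"
      by (rule dvd_add[OF dvd_mult2[OF xy(4)] dvd_mult2])
    then show ?thesis by (simp add: algebra_simps power2_eq_square)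
  qed
  then obtain c where c: "x\<^sup>2 + y\<^sup>2 = int p * c" by (elim dvdE)
  have pp: "int p > 0" using p(1) prime_gt_0_nat by simp
  have "x\<^sup>2 + y\<^sup>2 > 0" using xy(1) by (auto simp: sum_power2_gt_zero_iff)
  then have "c > 0" using c pp by (simp add: zero_less_mult_iff)
  moreover have "int p * c < int p * 2" using c xy(2,3) by linarith
  then have "c < 2" using pp by (simp add: mult_less_cancel_left)
  ultimately have e: "int p = x\<^sup>2 + y\<^sup>2" using c by simp
  have aux: "4 dvd a \<and> odd b \<and> b \<noteq> 0" if "int p = a\<^sup>2 + b\<^sup>2" "even a" for a b :: int
  proof -
    have p8: "int p mod 8 = 1" using p(2) int_mod_eq_iff[of p 8 1] by simp
    then have "odd (int p)" by presburger
    then have "odd (a\<^sup>2 + b\<^sup>2)" using that(1) by simp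
    then have ob: "odd b" using that(2) by simp
    then obtain l where l: "b = 2 * l + 1" by (elim oddE)
    have "even (l * (l + 1))" by simp
    then obtain t :: int where "l * (l + 1) = 2 * t" by (elim evenE)
    then have b1: "b\<^sup>2 = 8 * t + 1" using l by (simp add: power2_eq_square algebra_simps)
    obtain a' where a': "a = 2 * a'" using \<open>even a\<close> by (elim evenE)
    have "int p = 4 * a'\<^sup>2 + (8 * t + 1)"
      using \<open>int p = a\<^sup>2 + b\<^sup>2\<close> b1 a' by (simp add: power2_eq_square)
    moreover have "even z" if "int p = 4 * z + (8 * t + 1)" for z using that p8 by presburger
    ultimately have "even (a'\<^sup>2)" by blast
    then show ?thesis using ob a' by (auto elim!: evenE)
  qed
  have "odd p" using p(2) by presburger
  then have "odd (x\<^sup>2 + y\<^sup>2)" unfolding e[symmetric] by simp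
  then have "even x \<or> even y" by simp
  moreover have "int p = y\<^sup>2 + x\<^sup>2" using e by simp
  ultimately obtain a b where "int p = a\<^sup>2 + b\<^sup>2" "even a" using e by blast
  then show thesis using that[of a "\<bar>b\<bar>"] aux[of a b] by simp
qed

text \<open>A small solution of \<open>x\<^sup>2 \<equiv> 2 y\<^sup>2\<close> has \<open>x\<^sup>2 - 2 y\<^sup>2\<close> divisible by \<open>p\<close> and strictly between \<open>- 2 p\<close> and \<open>p\<close>,
  hence equal to \<open>- p\<close>; the unit \<open>1 + \<surd>2\<close> of norm \<open>-1\<close> turns \<open>- p\<close> into \<open>p\<close>.\<close>
lemma prime_eq_sq_minus_2_sq:
  fixes p :: nat
  assumes p: "Factorial_Ring.prime p" "p mod 8 = 1"
  obtains u w :: int where "int p = u\<^sup>2 - 2 * w\<^sup>2" "odd u" "u > 0" "even w" "w \<noteq> 0"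
proof -
  obtain t :: int where t: "[t\<^sup>2 = 2] (mod p)" by (rule QuadRes_two[OF p])
  obtain x y :: int where xy: "(x, y) \<noteq> (0, 0)" "x\<^sup>2 < p" "y\<^sup>2 < p" "int p dvd x - t * y"
    by (rule thue[OF p(1), of t])
  have d: "int p dvd x\<^sup>2 - 2 * y\<^sup>2"
  proof -
    have "int p dvd t\<^sup>2 - 2" using t by (simp add: cong_iff_dvd_diff)
    then have "int p dvd (x - t * y) * (x + t * y) + (t\<^sup>2 - 2) * y\<^sup>2"
      by (rule dvd_add[OF dvd_mult2[OF xy(4)] dvd_mult2])
    then show ?thesis by (simp add: algebra_simps power2_eq_square)
  qed
  then obtain c where c: "x\<^sup>2 - 2 * y\<^sup>2 = int p * c" by (elim dvdE)
  have pp: "int p > 0" using p(1) prime_gt_0_nat by simp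
  have c0: "c \<noteq> 0"
  proof
    assume "c = 0"
    then have e: "x\<^sup>2 = 2 * y\<^sup>2" using c by simp
    then have "y = 0" using sq_eq_prime_mult_sq[of 2 x y] by simp
    then show False using e xy(1) by simp
  qed
  have "int p * (-2) < int p * c" using c xy(2,3) zero_le_power2[of x] by linarith
  then have "c > -2" using pp by (simp only: mult_less_cancel_left_pos)
  moreover have "int p * c < int p * 1" using c xy(2,3) zero_le_power2[of y] by linarith
  then have "c < 1" using pp by (simp only: mult_less_cancel_left_pos)
  ultimately have "c = -1" using c0 by simp
  then have "int p = (x + 2 * y)\<^sup>2 - 2 * (x + y)\<^sup>2"
    using c by (simp add: power2_eq_square algebra_simps)
  then obtain u w where uw: "int p = u\<^sup>2 - 2 * w\<^sup>2" by blast
  have p8: "int p mod 8 = 1" using p(2) int_mod_eq_iff[of p 8 1] by simp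
  then have "odd (int p)" by presburger
  then have "odd (u\<^sup>2 - 2 * w\<^sup>2)" unfolding uw .
  then have ou: "odd u" by simp
  then obtain l where l: "u = 2 * l + 1" by (elim oddE)
  have "even (l * (l + 1))" by simp
  then obtain k where "l * (l + 1) = 2 * k" by (elim evenE)
  then have "u\<^sup>2 = 8 * k + 1" using l by (simp add: power2_eq_square algebra_simps)
  then have "int p = 8 * k + 1 - 2 * w\<^sup>2" using uw by simp
  moreover have "even z" if "int p = 8 * k + 1 - 2 * z" for z using that p8 by presburger
  ultimately have "even (w\<^sup>2)" by blast
  then have ew: "even w" by simp
  have "w \<noteq> 0"
  proof
    assume "w = 0"
    then have "int p = u\<^sup>2" using uw by simp
    then have "int p = int (nat \<bar>u\<bar> * nat \<bar>u\<bar>)" by (simp add: power2_eq_square)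
    then have e: "p = nat \<bar>u\<bar> * nat \<bar>u\<bar>" by (simp only: of_nat_eq_iff)
    then have "nat \<bar>u\<bar> dvd p" by auto
    then have "nat \<bar>u\<bar> = 1 \<or> nat \<bar>u\<bar> = p" using p prime_nat_iff by blast
    then show False using e prime_gt_1_nat[OF p(1)] by auto
  qed
  then show thesis using that[of "\<bar>u\<bar>" w] uw ou ew by auto
qed

section \<open>The quadratic character of 1 + j\<close>

text \<open>If \<open>m \<equiv> j n\<close> modulo \<open>p\<close>, then \<open>m + n \<equiv> n (1 + j)\<close>. Modulo \<open>m + n\<close> the number \<open>2 p\<close> is the square
  \<open>(m - n)\<^sup>2\<close>, so \<open>m + n\<close> contributes the character of \<open>\<rat>(\<surd>2)\<close>; modulo \<open>n\<close> the number \<open>p\<close> is the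
  square \<open>m\<^sup>2\<close>, so \<open>n\<close> is a quadratic residue.\<close>
lemma Legendre_one_plus_sqrt_minus_one_by_sum_of_squares:
  fixes p :: nat and j m n :: int
  assumes p: "Factorial_Ring.prime p" "p mod 8 = 1" and j: "[j\<^sup>2 = -1] (mod p)"
    and mn: "int p = m\<^sup>2 + n\<^sup>2" "4 dvd m" "odd n" "n > 0"
  shows "Legendre (1 + j) p = (if (m + n) mod 8 \<in> {1, 7} then 1 else -1)"
proof -
  have "p \<noteq> 1" "p \<noteq> 2" using p prime_gt_1_nat by auto
  then have p2: "2 < p" using prime_gt_1_nat[OF p(1)] by linarith
  have p4: "p mod 4 = 1" using p(2) by presburger
  have pI: "Factorial_Ring.prime (int p)" using p(1) by simp
  have ndvd: "\<not> int p dvd x" if "x\<^sup>2 < int p" "x \<noteq> 0" for x :: int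
  proof
    assume "int p dvd x"
    then obtain c where c: "x = int p * c" by (elim dvdE)
    then have "c \<noteq> 0" using that by auto
    then have "c\<^sup>2 \<ge> 1" by (simp add: int_one_le_iff_zero_less)
    then have "(int p)\<^sup>2 * 1 \<le> (int p)\<^sup>2 * c\<^sup>2" by (rule mult_left_mono) simp
    moreover have "int p * 1 \<le> (int p)\<^sup>2 * 1" using p2 by (simp add: power2_eq_square)
    ultimately have "int p \<le> x\<^sup>2" unfolding c power_mult_distrib by linarith
    then show False using that(1) by simp
  qed
  have m0: "m \<noteq> 0"
  proof
    assume "m = 0"
    then have e: "p = nat n * nat n" using mn(1,4) by (metis add_0 nat_int nat_mult_distrib order_less_imp_le power2_eq_square zero_power2)
    then have "nat n = 1 \<or> nat n = p" using p prime_nat_iff by (metis dvd_triv_left)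
    then show False using e prime_gt_1_nat[OF p(1)] by auto
  qed
  have nn: "\<not> int p dvd n" by (rule ndvd) (use mn m0 in auto)
  \<comment> \<open>\<open>M\<close> is that one of \<open>m\<close> and \<open>- m\<close> which is congruent to \<open>j n\<close>; as 4 divides \<open>m\<close>, both choices
    give the same residue of \<open>M + n\<close> modulo 8.\<close>
  have L: "Legendre (1 + j) p = (if (M + n) mod 8 \<in> {1, 7} then 1 else -1)"
    if M: "int p = M\<^sup>2 + n\<^sup>2" "4 dvd M" "int p dvd M - j * n" for M
  proof -
    define N where "N = nat \<bar>M + n\<bar>"
    have oMn: "odd (M + n)" using M(2) mn(3) by auto
    then have oN: "odd N" by (simp add: N_def even_nat_iff)
    have "Legendre (int N) p = chi8 N"
    proof (rule Legendre_by_reciprocity[OF p(1) p4 oN, of chi8 2])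
      fix q assume q: "Factorial_Ring.prime q" "int q dvd int N"
      have qd: "int q dvd M + n" using q(2) unfolding N_def by simp
      have qnd2: "\<not> int q dvd 2"
        using oN q prime_ge_2_nat[OF q(1)] zdvd_not_zless[of 2 "int q"] by (cases "q = 2") auto
      have "q \<noteq> p"
      proof
        assume "q = p"
        then have "int p dvd (M + n) - (M - j * n)" using qd M(3) dvd_diff by blast
        then have "int p dvd (1 + j) * n" by (simp add: algebra_simps)
        then have "int p dvd 1 + j" using nn pI prime_dvd_mult_iff by blast
        moreover have "int p dvd j\<^sup>2 - (-1)" using j by (simp add: cong_iff_dvd_diff)
        ultimately have "int p dvd (1 + j) * (1 - j) + (j\<^sup>2 - (-1))"
          by (rule dvd_add[OF dvd_mult2])
        then have "int p dvd 2" by (simp add: algebra_simps power2_eq_square)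
        then show False using p2 zdvd_not_zless by fastforce
      qed
      then have "\<not> int q dvd 2 * int p"
        using qnd2 prime_dvd_prime_int[OF q(1) p(1)] q(1) prime_dvd_mult_iff[of "int q" 2 "int p"] by auto
      moreover have "2 * int p - (M - n)\<^sup>2 = (M + n) * (M + n)"
        using M(1) by (simp add: power2_eq_square algebra_simps)
      then have "[2 * int p = (M - n)\<^sup>2] (mod q)" using qd by (simp add: cong_iff_dvd_diff)
      ultimately show "\<not> int q dvd 2 * int p \<and> (\<exists>y. [2 * int p = y\<^sup>2] (mod int q))" by blast
    qed (simp_all add: chi8_mult Legendre_two_chi8, simp add: chi8_def)
    moreover have "chi8 N = (if (M + n) mod 8 \<in> {1, 7} then 1 else -1)"
    proof -
      have "(N mod 8 = 1 \<or> N mod 8 = 7) \<longleftrightarrow> ((M + n) mod 8 = 1 \<or> (M + n) mod 8 = 7)"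
      proof -
        have "int N = M + n \<or> int N = - (M + n)" by (auto simp: N_def)
        moreover have "(N mod 8 = 1 \<or> N mod 8 = 7) \<longleftrightarrow> (int N mod 8 = 1 \<or> int N mod 8 = 7)"
          using int_mod_eq_iff[of N 8 1] int_mod_eq_iff[of N 8 7] by simp
        moreover have "((- x) mod 8 = 1 \<or> (- x) mod 8 = 7) \<longleftrightarrow> (x mod 8 = 1 \<or> x mod 8 = 7)"
          for x :: int by presburger
        ultimately show ?thesis by metis
      qed
      then show ?thesis by (simp add: chi8_def)
    qed
    moreover have "Legendre (M + n) p = Legendre (int N) p"
    proof (cases "M + n \<ge> 0")
      case False
      then have "M + n = (-1) * int N" by (simp add: N_def)
      then show ?thesis
        using Legendre_mult[OF p(1) p2, of "-1" "int N"] Legendre_minus_one[OF p(1) p2] p4 by simp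
    qed (simp add: N_def)
    moreover have "Legendre n p = 1"
    proof -
      have "Legendre (int (nat n)) (int p) = (\<lambda>_. 1) (nat n)"
      proof (rule Legendre_by_reciprocity[OF p(1) p4, of _ "\<lambda>_. 1" 1])
        show "odd (nat n)" using mn(3,4) by (simp add: even_nat_iff)
        fix q assume q: "Factorial_Ring.prime q" "int q dvd int (nat n)"
        then have qn: "int q dvd n" using mn(4) by simp
        then have "\<not> int q dvd int p" using prime_dvd_prime_int[OF q(1) p(1)] nn by auto
        moreover have "[int p = m\<^sup>2] (mod q)"
          using qn mn(1) by (simp add: cong_iff_dvd_diff power2_eq_square)
        ultimately show "\<not> int q dvd 1 * int p \<and> (\<exists>y. [1 * int p = y\<^sup>2] (mod int q))" by auto
      qed (simp_all add: Legendre_one)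
      then show ?thesis using mn(4) by simp
    qed
    moreover have "Legendre (M + n) p = Legendre n p * Legendre (1 + j) p"
    proof -
      have "[M + n = n * (1 + j)] (mod p)" using M(3) by (simp add: cong_iff_dvd_diff algebra_simps)
      then show ?thesis using Legendre_cong Legendre_mult[OF p(1) p2] by metis
    qed
    ultimately show ?thesis by simp
  qed
  have "int p dvd (m - j * n) * (m + j * n)"
  proof -
    have "(m - j * n) * (m + j * n) = int p - (j\<^sup>2 - (-1)) * n\<^sup>2"
      using mn(1) by (simp add: power2_eq_square algebra_simps)
    moreover have "int p dvd j\<^sup>2 - (-1)" using j by (simp add: cong_iff_dvd_diff)
    ultimately show ?thesis by (metis dvd_diff dvd_mult2 dvd_refl)
  qed
  then consider "int p dvd m - j * n" | "int p dvd m + j * n"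
    using pI prime_dvd_mult_iff by blast
  then show ?thesis
  proof cases
    case 1
    then show ?thesis using L mn by blast
  next
    case 2
    then have "int p dvd (- m) - j * n" using dvd_minus_iff[of "int p" "m + j * n"] by simp
    then have "Legendre (1 + j) p = (if (- m + n) mod 8 \<in> {1, 7} then 1 else -1)"
      using mn by (intro L) auto
    moreover have "(- m + n) mod 8 = (m + n) mod 8"
    proof -
      obtain a where "m = 4 * a" using mn(2) by (elim dvdE)
      then have "(m + n) - (- m + n) = 8 * a" by simp
      then show ?thesis by (simp add: mod_eq_dvd_iff dvd_diff_commute)
    qed
    ultimately show ?thesis by simp
  qed
qed

text \<open>Modulo \<open>p\<close>, the number \<open>t = u / w\<close> is a square root of 2, and \<open>1 + j = \<zeta> t\<close> with \<open>\<zeta>\<^sup>2 = j\<close>, so \<open>\<zeta>\<close> is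
  a primitive eighth root of unity, which is a quadratic residue iff \<open>p \<equiv> 1 (mod 16)\<close>. Modulo \<open>u\<close> the number
  \<open>- 2 p\<close> is the square \<open>(2 w)\<^sup>2\<close>, so \<open>u\<close> contributes the character of \<open>\<rat>(\<surd>-2)\<close>; modulo the odd part
  of \<open>w\<close> the number \<open>p\<close> is a square, so \<open>w\<close> is a quadratic residue. Finally \<open>p = u\<^sup>2 - 2 w\<^sup>2\<close> expresses
  \<open>p\<close> modulo 16 in terms of \<open>u\<close> modulo 8 and \<open>w\<close> modulo 4.\<close>
lemma Legendre_one_plus_sqrt_minus_one_by_sq_minus_2_sq:
  fixes p :: nat and j u w :: int
  assumes p: "Factorial_Ring.prime p" "p mod 8 = 1" and j: "[j\<^sup>2 = -1] (mod p)"
    and uw: "int p = u\<^sup>2 - 2 * w\<^sup>2" "odd u" "u > 0" "even w" "w \<noteq> 0"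
  shows "Legendre (1 + j) p = (if (u + w) mod 4 = 1 then 1 else -1)"
proof -
  have "p \<noteq> 1" "p \<noteq> 2" using p prime_gt_1_nat by auto
  then have p2: "2 < p" using prime_gt_1_nat[OF p(1)] by linarith
  have p4: "p mod 4 = 1" using p(2) by presburger
  have pI: "Factorial_Ring.prime (int p)" using p(1) by simp
  have "\<not> int p dvd 2" using p2 zdvd_not_zless by fastforce
  have m1: "Legendre (-1) p = 1" using Legendre_minus_one[OF p(1) p2] p4 by simp
  have L2: "Legendre 2 p = 1" using Legendre_two[OF p(1) p2] p(2) by simp
  have nw: "\<not> int p dvd w"
  proof
    assume "int p dvd w"
    then obtain c where c: "w = int p * c" by (elim dvdE)
    have "u\<^sup>2 = int p * (1 + 2 * int p * c\<^sup>2)" using uw(1) c by (simp add: power2_eq_square algebra_simps)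
    then have "int p dvd u" using pI prime_dvd_power_int by (metis dvd_triv_left)
    then obtain d where d: "u = int p * d" by (elim dvdE)
    have "int p * 1 = int p * (int p * (d\<^sup>2 - 2 * c\<^sup>2))"
      using uw(1) c d by (simp add: power2_eq_square algebra_simps)
    then have "int p * (d\<^sup>2 - 2 * c\<^sup>2) = 1" using p2 by (metis mult_cancel_left of_nat_0_less_iff less_irrefl prime_gt_0_nat[OF p(1)])
    then have "int p dvd 1" by (metis dvd_triv_left)
    then show False using p2 by simp
  qed
  have nu: "\<not> int p dvd u"
  proof
    assume "int p dvd u"
    then have "int p dvd u\<^sup>2 - int p" by (simp add: power2_eq_square)
    then have "int p dvd 2 * w\<^sup>2" using uw(1) by simp
    then show False using nw \<open>\<not> int p dvd 2\<close> pI prime_dvd_mult_iff prime_dvd_power_int by blast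
  qed
  \<comment> \<open>\<open>v\<close> and \<open>h\<close> are the inverses of \<open>w\<close> and 2 modulo \<open>p\<close>.\<close>
  obtain v :: int where v: "[w * v = 1] (mod p)"
    using nw pI by (metis prime_imp_coprime coprime_commute cong_solve_coprime_int)
  have sq: "[(u * v)\<^sup>2 = 2] (mod p)"
  proof -
    have "[u\<^sup>2 = 2 * w\<^sup>2] (mod p)" using uw(1) by (simp add: cong_iff_dvd_diff)
    then have "[u\<^sup>2 * v\<^sup>2 = 2 * w\<^sup>2 * v\<^sup>2] (mod p)" by (rule cong_scalar_right)
    also have "2 * w\<^sup>2 * v\<^sup>2 = 2 * (w * v)\<^sup>2" by (simp add: power_mult_distrib)
    also have "[\<dots> = 2 * 1\<^sup>2] (mod p)" by (intro cong_scalar_left cong_pow v)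
    finally show ?thesis by (simp add: power_mult_distrib)
  qed
  obtain h :: int where h: "[2 * h = 1] (mod p)"
    using \<open>\<not> int p dvd 2\<close> pI by (metis prime_imp_coprime coprime_commute cong_solve_coprime_int)
  define t where "t = u * v"
  define z where "z = (1 + j) * t * h"
  have j1: "[(1 + j)\<^sup>2 = 2 * j] (mod p)"
  proof -
    have "(1 + j)\<^sup>2 - 2 * j = j\<^sup>2 - (-1)" by (simp add: power2_eq_square algebra_simps)
    then show ?thesis using j by (simp add: cong_iff_dvd_diff)
  qed
  have z2: "[z\<^sup>2 = j] (mod p)"
  proof -
    have "z\<^sup>2 = (1 + j)\<^sup>2 * t\<^sup>2 * h\<^sup>2" by (simp add: z_def power_mult_distrib)
    also have "[\<dots> = (2 * j) * 2 * h\<^sup>2] (mod p)"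
      by (intro cong_mult cong_refl j1 sq[folded t_def])
    also have "(2 * j) * 2 * h\<^sup>2 = j * (2 * h)\<^sup>2" by (simp add: power_mult_distrib)
    also have "[\<dots> = j * 1\<^sup>2] (mod p)" by (intro cong_scalar_left cong_pow h)
    finally show ?thesis by simp
  qed
  have zt: "[1 + j = z * t] (mod p)"
  proof -
    have "z * t = (1 + j) * t\<^sup>2 * h" by (simp add: z_def power2_eq_square)
    also have "[\<dots> = (1 + j) * 2 * h] (mod p)" by (intro cong_mult cong_refl sq[folded t_def])
    also have "(1 + j) * 2 * h = (1 + j) * (2 * h)" by simp
    also have "[\<dots> = (1 + j) * 1] (mod p)" by (intro cong_scalar_left h)
    finally show ?thesis by (simp add: cong_sym_eq)
  qed
  have Lz: "Legendre z p = (if p mod 16 = 1 then 1 else -1)"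
  proof (rule eq_if_cong_unit_interval)
    define k where "k = (p - 1) div 8"
    have p8k: "p = 8 * k + 1"
    proof -
      have "p = 8 * (p div 8) + 1" using p(2) mult_div_mod_eq[of 8 p] by simp
      then show ?thesis unfolding k_def by (metis add_diff_cancel_right' nonzero_mult_div_cancel_left zero_neq_numeral)
    qed
    then have k: "(p - 1) div 2 = 2 * (2 * k)" by simp
    have "z ^ ((p - 1) div 2) = (z\<^sup>2) ^ (2 * k)" unfolding k power_mult[of z 2 "2 * k"] ..
    also have "[\<dots> = j ^ (2 * k)] (mod p)" by (rule cong_pow[OF z2])
    also have "j ^ (2 * k) = (j\<^sup>2) ^ k" by (rule power_mult)
    also have "[\<dots> = (-1) ^ k] (mod p)" by (rule cong_pow[OF j])
    also have "(-1) ^ k = (if p mod 16 = 1 then 1 else -1 :: int)"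
    proof -
      have "even k \<longleftrightarrow> p mod 16 = 1"
      proof (cases "even k")
        case True
        then obtain i where "k = 2 * i" by (elim evenE)
        then have "p = 16 * i + 1" using p8k by simp
        then show ?thesis using True by simp
      next
        case False
        then obtain i where "k = 2 * i + 1" by (elim oddE)
        then have "p = 16 * i + 9" using p8k by simp
        then show ?thesis using False by simp
      qed
      then show ?thesis by simp
    qed
    finally show "[Legendre z p = (if p mod 16 = 1 then 1 else -1)] (mod p)"
      using euler_criterion[OF p(1) p2, of z] cong_trans by blast
  qed (use p2 Legendre_range in auto)
  have Lu: "Legendre u p = chi8' (nat u)"
  proof -
    have ou: "odd (nat u)" using uw(2,3) by (simp add: even_nat_iff)
    have "Legendre (int (nat u)) p = chi8' (nat u)"
    proof (rule Legendre_by_reciprocity[OF p(1) p4 ou, of chi8' "-2"])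
      fix q assume q: "Factorial_Ring.prime q" "int q dvd int (nat u)"
      have qu: "int q dvd u" using q(2) uw(3) by simp
      have "\<not> int q dvd 2"
        using uw(2) qu prime_ge_2_nat[OF q(1)] zdvd_not_zless[of 2 "int q"] by (cases "q = 2") auto
      moreover have "\<not> int q dvd int p" using prime_dvd_prime_int[OF q(1) p(1)] nu qu by auto
      ultimately have "\<not> int q dvd - 2 * int p"
        using q(1) prime_dvd_mult_iff[of "int q" 2 "int p"] by simp
      moreover have "(-2) * int p - (2 * w)\<^sup>2 = u * (- 2 * u)"
        using uw(1) by (simp add: power2_eq_square algebra_simps)
      then have "[(-2) * int p = (2 * w)\<^sup>2] (mod q)"
        unfolding cong_iff_dvd_diff using qu dvd_mult2 by metis
      ultimately show "\<not> int q dvd - 2 * int p \<and> (\<exists>y. [- 2 * int p = y\<^sup>2] (mod int q))" by blast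
    qed (simp_all add: chi8'_mult Legendre_minus_two_chi8', simp add: chi8'_def)
    then show ?thesis using uw(3) by simp
  qed
  have Lw: "Legendre w p = 1"
  proof -
    define k where "k = multiplicity 2 w"
    obtain b where b: "w = 2 ^ k * b" "\<not> 2 dvd b"
      using multiplicity_decompose'[of w 2] uw(5) unfolding k_def by auto
    have Lpow: "Legendre (2 ^ k) p = 1"
    proof (induction k)
      case 0
      show ?case by (rule Legendre_eq_1I[of _ 1]) (use p2 in auto)
    next
      case (Suc k)
      then show ?case using Legendre_mult[OF p(1) p2, of 2 "2 ^ k"] L2 by simp
    qed
    have ob: "odd (nat \<bar>b\<bar>)" using b(2) by (simp add: even_nat_iff)
    have "Legendre (int (nat \<bar>b\<bar>)) (int p) = (\<lambda>_. 1) (nat \<bar>b\<bar>)"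
    proof (rule Legendre_by_reciprocity[OF p(1) p4 ob, of "\<lambda>_. 1" 1])
      fix q assume q: "Factorial_Ring.prime q" "int q dvd int (nat \<bar>b\<bar>)"
      then have qw: "int q dvd w" using b(1) by simp
      then have "\<not> int q dvd int p" using prime_dvd_prime_int[OF q(1) p(1)] nw by auto
      moreover have "[int p = u\<^sup>2] (mod q)"
        using qw uw(1) by (simp add: cong_iff_dvd_diff power2_eq_square)
      ultimately show "\<not> int q dvd 1 * int p \<and> (\<exists>y. [1 * int p = y\<^sup>2] (mod int q))" by auto
    qed (simp_all add: Legendre_one)
    moreover have "b = int (nat \<bar>b\<bar>) \<or> b = (-1) * int (nat \<bar>b\<bar>)" by auto
    ultimately have "Legendre b p = 1"
      using Legendre_mult[OF p(1) p2, of "-1" "int (nat \<bar>b\<bar>)"] m1 by auto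
    then show ?thesis using Legendre_mult[OF p(1) p2] b(1) Lpow by simp
  qed
  have Lt: "Legendre t p = Legendre u p"
  proof -
    have "[t * w = u] (mod p)"
    proof -
      have "t * w = u * (w * v)" by (simp add: t_def)
      also have "[\<dots> = u * 1] (mod p)" by (intro cong_scalar_left v)
      finally show ?thesis by simp
    qed
    then have "Legendre (t * w) p = Legendre u p" by (rule Legendre_cong)
    then show ?thesis using Legendre_mult[OF p(1) p2] Lw by simp
  qed
  have "Legendre (1 + j) p = Legendre z p * chi8' (nat u)"
    using Legendre_cong[OF zt] Legendre_mult[OF p(1) p2] Lt Lu by simp
  also have "\<dots> = (if (u + w) mod 4 = 1 then 1 else -1)"
  proof -
    obtain w' where w': "w = 2 * w'" using uw(4) by (elim evenE)
    define k where "k = u div 8"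
    have dec: "u = 8 * k + u mod 8" unfolding k_def by presburger
    have um: "u mod 8 = 1 \<or> u mod 8 = 3 \<or> u mod 8 = 5 \<or> u mod 8 = 7" using uw(2) by presburger
    have nu8: "nat u mod 8 = nat (u mod 8)" using uw(3) by (simp add: nat_mod_distrib)
    note u16 = odd_square_mod_16[OF uw(2)]
    have pe: "int p = u\<^sup>2 - 8 * w'\<^sup>2" using uw(1) w' by (simp add: power_mult_distrib)
    have i16: "p mod 16 = 1 \<longleftrightarrow> int p mod 16 = 1" using int_mod_eq_iff[of p 16 1] by simp
    have u4: "u mod 4 = (u mod 8) mod 4" by (simp add: mod_mod_cancel)
    have "(p mod 16 = 1 \<longleftrightarrow> ((u mod 8 = 1 \<or> u mod 8 = 7) \<longleftrightarrow> even w')) \<and>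
        ((u + w) mod 4 = 1 \<longleftrightarrow> ((u mod 8 = 1 \<or> u mod 8 = 5) \<longleftrightarrow> even w'))"
    proof (cases "even w'")
      case True
      then obtain i where i: "w' = 2 * i" by (elim evenE)
      have "int p - u\<^sup>2 = 16 * (- 2 * i\<^sup>2)" using pe i by (simp add: power2_eq_square)
      then have "int p mod 16 = u\<^sup>2 mod 16" by (simp add: mod_eq_dvd_iff)
      moreover have "(u + w) mod 4 = u mod 4" using w' i by simp
      ultimately show ?thesis using True um unfolding i16 u4 u16 by (elim disjE) simp_all
    next
      case False
      then obtain i where i: "w' = 2 * i + 1" by (elim oddE)
      have "int p - (u\<^sup>2 - 8) = 16 * (- 2 * (i * (i + 1)))"
        using pe i by (simp add: power2_eq_square algebra_simps)
      then have "int p mod 16 = (u\<^sup>2 - 8) mod 16" by (simp add: mod_eq_dvd_iff)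
      also have "\<dots> = (u\<^sup>2 mod 16 - 8) mod 16" by (simp add: mod_diff_left_eq)
      finally have "int p mod 16 = (u\<^sup>2 mod 16 - 8) mod 16" .
      moreover have "(u + w) mod 4 = ((u mod 4) + 2) mod 4"
      proof -
        have "(u + w) - (u + 2) = 4 * i" using w' i by simp
        then have "(u + w) mod 4 = (u + 2) mod 4" by (simp add: mod_eq_dvd_iff)
        then show ?thesis by (simp add: mod_add_left_eq)
      qed
      ultimately show ?thesis using False um unfolding i16 u4 u16 by (elim disjE) simp_all
    qed
    then have P: "p mod 16 = 1 \<longleftrightarrow> ((u mod 8 = 1 \<or> u mod 8 = 7) \<longleftrightarrow> even w')"
      and Q: "(u + w) mod 4 = 1 \<longleftrightarrow> ((u mod 8 = 1 \<or> u mod 8 = 5) \<longleftrightarrow> even w')" by blast+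
    show ?thesis using um unfolding Lz P Q chi8'_def nu8 by auto
  qed
  finally show ?thesis .
qed

section \<open>Square classes of a field\<close>

locale plain_field = field R for R :: "'a ring" (structure)
begin

lemma comm_group_mult_of: "comm_group (mult_of R)"
proof -
  have "mult_of R = units_of R"
    using field_Units by (simp add: mult_of_def units_of_def)
  then show ?thesis using units_comm_group by simp
qed

lemma subgroup_nonzero_squares: "subgroup (nonzero_squares R) (mult_of R)"
proof -
  interpret M: comm_group "mult_of R" by (rule comm_group_mult_of)
  show ?thesis
  proof (rule M.subgroupI)
    show "nonzero_squares R \<subseteq> carrier (mult_of R)"
      using mult_of.m_closed by (fastforce simp: nonzero_squares_def)
    show "nonzero_squares R \<noteq> {}"
      using mult_of.one_closed by (auto simp: nonzero_squares_def)
  next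
    fix a assume "a \<in> nonzero_squares R"
    then obtain x where x: "x \<in> carrier (mult_of R)" "a = x \<otimes>\<^bsub>mult_of R\<^esub> x"
      by (auto simp: nonzero_squares_def)
    then have "inv\<^bsub>mult_of R\<^esub> a = inv\<^bsub>mult_of R\<^esub> x \<otimes>\<^bsub>mult_of R\<^esub> inv\<^bsub>mult_of R\<^esub> x"
      by (simp only: M.inv_mult)
    then show "inv\<^bsub>mult_of R\<^esub> a \<in> nonzero_squares R"
      using M.inv_closed[OF x(1)] unfolding nonzero_squares_def mult_mult_of by blast
  next
    fix a b assume "a \<in> nonzero_squares R" "b \<in> nonzero_squares R"
    then obtain x y where x: "x \<in> carrier (mult_of R)" "a = x \<otimes>\<^bsub>mult_of R\<^esub> x"
      and y: "y \<in> carrier (mult_of R)" "b = y \<otimes>\<^bsub>mult_of R\<^esub> y"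
      by (auto simp: nonzero_squares_def)
    have "a \<otimes>\<^bsub>mult_of R\<^esub> b = (x \<otimes>\<^bsub>mult_of R\<^esub> y) \<otimes>\<^bsub>mult_of R\<^esub> (x \<otimes>\<^bsub>mult_of R\<^esub> y)"
      unfolding x(2) y(2) using x(1) y(1) by (simp add: m_ac)
    then show "a \<otimes>\<^bsub>mult_of R\<^esub> b \<in> nonzero_squares R"
      using mult_of.m_closed[OF x(1) y(1)] unfolding nonzero_squares_def mult_mult_of by blast
  qed
qed

lemma normal_nonzero_squares: "nonzero_squares R \<lhd> mult_of R"
  by (rule comm_group.subgroup_imp_normal[OF comm_group_mult_of subgroup_nonzero_squares])

lemma mem_sq_class_iff:
  "y \<in> sq_class R x \<longleftrightarrow> (\<exists>z\<in>carrier (mult_of R). y = z \<otimes> z \<otimes> x)"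
  by (auto simp: sq_class_def r_coset_def nonzero_squares_def)

lemma sq_class_eq_iff:
  assumes "x \<in> carrier (mult_of R)" "y \<in> carrier (mult_of R)"
  shows "sq_class R x = sq_class R y \<longleftrightarrow> (\<exists>z\<in>carrier (mult_of R). y = z \<otimes> z \<otimes> x)"
proof -
  interpret M: comm_group "mult_of R" by (rule comm_group_mult_of)
  have "sq_class R x = sq_class R y \<longleftrightarrow> y \<in> sq_class R x"
    using M.rcos_self[OF assms(2) subgroup_nonzero_squares]
      M.repr_independence[OF _ assms(1) subgroup_nonzero_squares]
    by (auto simp: sq_class_def)
  then show ?thesis by (simp only: mem_sq_class_iff)
qed

lemma sq_class_eq_iff_mult:
  assumes "x \<in> carrier (mult_of R)" "y \<in> carrier (mult_of R)"
  shows "sq_class R x = sq_class R y \<longleftrightarrow> x \<otimes> y \<in> nonzero_squares R"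
proof -
  interpret M: comm_group "mult_of R" by (rule comm_group_mult_of)
  show ?thesis
  proof
    assume "sq_class R x = sq_class R y"
    then obtain z where z: "z \<in> carrier (mult_of R)" "y = z \<otimes> z \<otimes> x"
      using sq_class_eq_iff assms by blast
    have "x \<otimes> y = (z \<otimes> x) \<otimes> (z \<otimes> x)"
      unfolding z(2) using z(1) assms by (simp add: m_ac)
    moreover have "z \<otimes> x \<in> carrier (mult_of R)" using mult_of.m_closed[OF z(1) assms(1)] .
    ultimately show "x \<otimes> y \<in> nonzero_squares R" unfolding nonzero_squares_def by blast
  next
    assume "x \<otimes> y \<in> nonzero_squares R"
    then obtain z where z: "z \<in> carrier (mult_of R)" "x \<otimes> y = z \<otimes> z"
      by (auto simp: nonzero_squares_def)
    define i where "i = inv\<^bsub>mult_of R\<^esub> x"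
    have i: "i \<in> carrier (mult_of R)" "i \<otimes> x = \<one>"
      unfolding i_def using M.inv_closed[OF assms(1)] M.l_inv[OF assms(1)] by auto
    have "(z \<otimes> i) \<otimes> (z \<otimes> i) \<otimes> x = (z \<otimes> z) \<otimes> i \<otimes> (i \<otimes> x)"
      using z(1) i(1) assms by (simp add: m_ac)
    also have "\<dots> = (x \<otimes> y) \<otimes> i \<otimes> (i \<otimes> x)" using z(2) by simp
    also have "\<dots> = y \<otimes> (i \<otimes> x) \<otimes> (i \<otimes> x)"
      using z(1) i(1) assms by (simp add: m_ac)
    also have "\<dots> = y" using i assms by simp
    finally have "y = (z \<otimes> i) \<otimes> (z \<otimes> i) \<otimes> x" by simp
    moreover have "z \<otimes> i \<in> carrier (mult_of R)" using mult_of.m_closed[OF z(1) i(1)] .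
    ultimately show "sq_class R x = sq_class R y" using sq_class_eq_iff assms by blast
  qed
qed

lemma carrier_sq_group: "carrier (sq_group R) = sq_class R ` carrier (mult_of R)"
  unfolding sq_group_def carrier_FactGroup by (rule image_cong) (simp_all only: sq_class_def)

lemma mult_sq_group:
  assumes "x \<in> carrier (mult_of R)" "y \<in> carrier (mult_of R)"
  shows "sq_class R x \<otimes>\<^bsub>sq_group R\<^esub> sq_class R y = sq_class R (x \<otimes> y)"
  using normal.rcos_sum[OF normal_nonzero_squares assms] by (simp add: sq_group_def sq_class_def)

lemma one_sq_group: "\<one>\<^bsub>sq_group R\<^esub> = sq_class R \<one>"
proof -
  interpret M: comm_group "mult_of R" by (rule comm_group_mult_of)
  show ?thesis
    using M.coset_mult_one[OF subgroup.subset[OF subgroup_nonzero_squares]]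
    by (simp add: sq_group_def sq_class_def)
qed

text \<open>The triple of product 1 with given first two entries; every element of the ambient group has this form.\<close>
definition class_triple :: "'a \<Rightarrow> 'a \<Rightarrow> 'a set \<times> 'a set \<times> 'a set" where
  "class_triple x y = (sq_class R x, sq_class R y, sq_class R (x \<otimes> y))"

lemma carrier_prod_one_triples:
  "carrier (prod_one_triples R) = {class_triple x y |x y. x \<in> carrier (mult_of R) \<and> y \<in> carrier (mult_of R)}"
proof -
  interpret M: comm_group "mult_of R" by (rule comm_group_mult_of)
  have *: "sq_class R x \<otimes>\<^bsub>sq_group R\<^esub> sq_class R y \<otimes>\<^bsub>sq_group R\<^esub> sq_class R z = \<one>\<^bsub>sq_group R\<^esub>
      \<longleftrightarrow> sq_class R z = sq_class R (x \<otimes> y)"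
    if "x \<in> carrier (mult_of R)" "y \<in> carrier (mult_of R)" "z \<in> carrier (mult_of R)" for x y z
  proof -
    have xy: "x \<otimes> y \<in> carrier (mult_of R)" using mult_of.m_closed[OF that(1,2)] .
    have xyz: "x \<otimes> y \<otimes> z \<in> carrier (mult_of R)" using mult_of.m_closed[OF xy that(3)] .
    have o: "\<one> \<in> carrier (mult_of R)" using mult_of.one_closed by simp
    have "sq_class R x \<otimes>\<^bsub>sq_group R\<^esub> sq_class R y \<otimes>\<^bsub>sq_group R\<^esub> sq_class R z = \<one>\<^bsub>sq_group R\<^esub>
      \<longleftrightarrow> sq_class R (x \<otimes> y \<otimes> z) = sq_class R \<one>"
      using that xy by (simp only: mult_sq_group one_sq_group)
    also have "\<dots> \<longleftrightarrow> x \<otimes> y \<otimes> z \<otimes> \<one> \<in> nonzero_squares R"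
      by (rule sq_class_eq_iff_mult[OF xyz o])
    also have "x \<otimes> y \<otimes> z \<otimes> \<one> = z \<otimes> (x \<otimes> y)"
      using xy that by (simp add: m_comm)
    also have "z \<otimes> (x \<otimes> y) \<in> nonzero_squares R \<longleftrightarrow> sq_class R z = sq_class R (x \<otimes> y)"
      by (rule sq_class_eq_iff_mult[OF that(3) xy, symmetric])
    finally show ?thesis .
  qed
  have cl: "x \<otimes> y \<in> carrier (mult_of R)" if "x \<in> carrier (mult_of R)" "y \<in> carrier (mult_of R)" for x y
    using mult_of.m_closed[OF that] .
  show ?thesis
  proof (intro equalityI subsetI)
    fix c assume "c \<in> carrier (prod_one_triples R)"
    then obtain x y z where xyz: "x \<in> carrier (mult_of R)" "y \<in> carrier (mult_of R)" "z \<in> carrier (mult_of R)"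
      and c: "c = (sq_class R x, sq_class R y, sq_class R z)"
        "sq_class R x \<otimes>\<^bsub>sq_group R\<^esub> sq_class R y \<otimes>\<^bsub>sq_group R\<^esub> sq_class R z = \<one>\<^bsub>sq_group R\<^esub>"
      unfolding prod_one_triples_def carrier_sq_group by auto
    then have "c = class_triple x y" unfolding class_triple_def using *[OF xyz] by simp
    then show "c \<in> {class_triple x y |x y. x \<in> carrier (mult_of R) \<and> y \<in> carrier (mult_of R)}"
      using xyz by blast
  next
    fix c assume "c \<in> {class_triple x y |x y. x \<in> carrier (mult_of R) \<and> y \<in> carrier (mult_of R)}"
    then obtain x y where xy: "x \<in> carrier (mult_of R)" "y \<in> carrier (mult_of R)" "c = class_triple x y"
      by blast
    have "sq_class R x \<otimes>\<^bsub>sq_group R\<^esub> sq_class R y \<otimes>\<^bsub>sq_group R\<^esub> sq_class R (x \<otimes> y) = \<one>\<^bsub>sq_group R\<^esub>"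
      using *[OF xy(1,2) cl[OF xy(1,2)]] by simp
    then show "c \<in> carrier (prod_one_triples R)"
      unfolding prod_one_triples_def carrier_sq_group xy(3) class_triple_def
      using xy(1,2) cl[OF xy(1,2)] by (simp del: carrier_mult_of)
  qed
qed

lemma mult_prod_one_triples:
  assumes "x \<in> carrier (mult_of R)" "y \<in> carrier (mult_of R)"
    "x' \<in> carrier (mult_of R)" "y' \<in> carrier (mult_of R)"
  shows "class_triple x y \<otimes>\<^bsub>prod_one_triples R\<^esub> class_triple x' y' = class_triple (x \<otimes> x') (y \<otimes> y')"
proof -
  interpret M: comm_group "mult_of R" by (rule comm_group_mult_of)
  have cl: "x \<otimes> y \<in> carrier (mult_of R)" "x' \<otimes> y' \<in> carrier (mult_of R)"
    using mult_of.m_closed assms by blast+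
  have e: "(x \<otimes> y) \<otimes> (x' \<otimes> y') = (x \<otimes> x') \<otimes> (y \<otimes> y')"
    using assms by (simp add: m_ac)
  show ?thesis
    unfolding class_triple_def prod_one_triples_def using assms cl e
    by (simp add: mult_sq_group del: carrier_mult_of)
qed

lemma one_prod_one_triples: "\<one>\<^bsub>prod_one_triples R\<^esub> = class_triple \<one> \<one>"
  by (simp add: prod_one_triples_def class_triple_def one_sq_group)

lemma class_triple_square:
  assumes "x \<in> carrier (mult_of R)" "y \<in> carrier (mult_of R)"
  shows "class_triple (x \<otimes> x) (y \<otimes> y) = class_triple \<one> \<one>"
proof -
  interpret M: comm_group "mult_of R" by (rule comm_group_mult_of)
  have *: "sq_class R (z \<otimes> z) = sq_class R \<one>" if "z \<in> carrier (mult_of R)" for z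
  proof -
    have zz: "z \<otimes> z \<in> carrier (mult_of R)" using mult_of.m_closed[OF that that] .
    have o: "\<one> \<in> carrier (mult_of R)" using mult_of.one_closed by simp
    show ?thesis unfolding sq_class_eq_iff_mult[OF zz o] using zz that
      by (auto simp: nonzero_squares_def)
  qed
  have xy: "x \<otimes> y \<in> carrier (mult_of R)" using mult_of.m_closed[OF assms] .
  have "(x \<otimes> x) \<otimes> (y \<otimes> y) = (x \<otimes> y) \<otimes> (x \<otimes> y)"
    using assms by (simp add: m_ac)
  then show ?thesis using *[OF assms(1)] *[OF assms(2)] *[OF xy] by (simp add: class_triple_def)
qed

text \<open>The shape of the Selmer group: conditions imposed separately on the first two entries, each closed
  under multiplication, cut out a group. Closure under inverses comes from the exponent 2.\<close>
lemma comm_group_class_triples: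
  assumes A: "A \<subseteq> carrier (mult_of R)" "\<one> \<in> A" "\<And>x y. x \<in> A \<Longrightarrow> y \<in> A \<Longrightarrow> x \<otimes> y \<in> A"
    and B: "B \<subseteq> carrier (mult_of R)" "\<one> \<in> B" "\<And>x y. x \<in> B \<Longrightarrow> y \<in> B \<Longrightarrow> x \<otimes> y \<in> B"
  defines "G \<equiv> (prod_one_triples R)\<lparr>carrier := {class_triple x y |x y. x \<in> A \<and> y \<in> B}\<rparr>"
  shows "comm_group G" and "\<And>c. c \<in> carrier G \<Longrightarrow> c \<otimes>\<^bsub>G\<^esub> c = \<one>\<^bsub>G\<^esub>"
proof -
  have car: "carrier G = {class_triple x y |x y. x \<in> A \<and> y \<in> B}" by (simp add: G_def)
  have mult: "class_triple x y \<otimes>\<^bsub>G\<^esub> class_triple x' y' = class_triple (x \<otimes> x') (y \<otimes> y')"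
    if "x \<in> A" "y \<in> B" "x' \<in> A" "y' \<in> B" for x y x' y'
    using mult_prod_one_triples[of x y x' y'] that A(1) B(1) unfolding G_def by auto
  have one: "\<one>\<^bsub>G\<^esub> = class_triple \<one> \<one>" by (simp add: G_def one_prod_one_triples)
  have AR: "x \<in> carrier R" if "x \<in> A" for x using that A(1) by auto
  have BR: "x \<in> carrier R" if "x \<in> B" for x using that B(1) by auto
  show sq: "c \<otimes>\<^bsub>G\<^esub> c = \<one>\<^bsub>G\<^esub>" if c: "c \<in> carrier G" for c
  proof -
    obtain x y where xy: "x \<in> A" "y \<in> B" "c = class_triple x y" using c unfolding car by blast
    then show ?thesis using mult[of x y x y] one class_triple_square[of x y] A(1) B(1) by auto
  qed
  show "comm_group G"
  proof (rule comm_groupI)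
    fix c d assume c: "c \<in> carrier G" and d: "d \<in> carrier G"
    obtain x y where xy: "x \<in> A" "y \<in> B" "c = class_triple x y" using c unfolding car by blast
    obtain x' y' where xy': "x' \<in> A" "y' \<in> B" "d = class_triple x' y'" using d unfolding car by blast
    show "c \<otimes>\<^bsub>G\<^esub> d \<in> carrier G"
      using mult[of x y x' y'] xy xy' A(3) B(3) car by blast
    show "c \<otimes>\<^bsub>G\<^esub> d = d \<otimes>\<^bsub>G\<^esub> c"
      using mult[of x y x' y'] mult[of x' y' x y] xy xy' AR BR by (simp add: m_comm)
  next
    show "\<one>\<^bsub>G\<^esub> \<in> carrier G" unfolding one car using A(2) B(2) by blast
  next
    fix c d e assume c: "c \<in> carrier G" and d: "d \<in> carrier G" and e: "e \<in> carrier G"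
    obtain x y where xy: "x \<in> A" "y \<in> B" "c = class_triple x y" using c unfolding car by blast
    obtain x' y' where xy': "x' \<in> A" "y' \<in> B" "d = class_triple x' y'" using d unfolding car by blast
    obtain x'' y'' where xy'': "x'' \<in> A" "y'' \<in> B" "e = class_triple x'' y''" using e unfolding car by blast
    show "c \<otimes>\<^bsub>G\<^esub> d \<otimes>\<^bsub>G\<^esub> e = c \<otimes>\<^bsub>G\<^esub> (d \<otimes>\<^bsub>G\<^esub> e)"
      using xy xy' xy'' A(3) B(3) AR BR by (simp add: mult m_assoc)
  next
    fix c assume c: "c \<in> carrier G"
    obtain x y where xy: "x \<in> A" "y \<in> B" "c = class_triple x y" using c unfolding car by blast
    show "\<one>\<^bsub>G\<^esub> \<otimes>\<^bsub>G\<^esub> c = c" using xy A(2) B(2) AR BR by (simp add: one mult)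
    show "\<exists>d\<in>carrier G. d \<otimes>\<^bsub>G\<^esub> c = \<one>\<^bsub>G\<^esub>" using sq[OF c] c by blast
  qed
qed

lemma card_class_triples:
  assumes "A \<subseteq> carrier (mult_of R)" "B \<subseteq> carrier (mult_of R)"
  shows "card {class_triple x y |x y. x \<in> A \<and> y \<in> B} = card (sq_class R ` A) * card (sq_class R ` B)"
proof -
  interpret M: comm_group "mult_of R" by (rule comm_group_mult_of)
  have e: "class_triple x y = (\<lambda>(C, D). (C, D, C \<otimes>\<^bsub>sq_group R\<^esub> D)) (sq_class R x, sq_class R y)"
    if "x \<in> A" "y \<in> B" for x y
    using mult_sq_group[OF subsetD[OF assms(1) that(1)] subsetD[OF assms(2) that(2)]]
    by (simp only: class_triple_def prod.case)
  have c: "{class_triple x y |x y. x \<in> A \<and> y \<in> B}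
      = (\<lambda>(C, D). (C, D, C \<otimes>\<^bsub>sq_group R\<^esub> D)) ` (sq_class R ` A \<times> sq_class R ` B)" (is "?L = ?f ` ?S")
  proof (intro equalityI subsetI)
    fix t assume "t \<in> ?L"
    then obtain x y where xy: "x \<in> A" "y \<in> B" "t = class_triple x y" by (elim CollectE exE conjE)
    show "t \<in> ?f ` ?S" unfolding xy(3) e[OF xy(1,2)] using xy(1,2) by (intro imageI SigmaI)
  next
    fix t assume "t \<in> ?f ` ?S"
    then obtain x y where xy: "x \<in> A" "y \<in> B" "t = ?f (sq_class R x, sq_class R y)"
      by (elim imageE SigmaE) (simp only:)
    have "t = class_triple x y" unfolding xy(3) by (rule e[OF xy(1,2), symmetric])
    then show "t \<in> ?L" using xy(1,2) by blast
  qed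
  have "inj_on ?f ?S" by (rule inj_onI) (simp only: split_paired_all prod.case prod.inject)
  then show ?thesis unfolding c by (simp only: card_image card_cartesian_product)
qed

end

section \<open>Groups of exponent 2 as vector spaces\<close>

lemma (in vectorspace) card_eq_power_dim:
  assumes "finite (carrier V)" "finite (carrier K)"
  shows "fin_dim" and "card (carrier V) = card (carrier K) ^ dim"
proof -
  have "span (carrier V) = carrier V"
    by (metis module.in_own_span module_axioms order_refl span_is_subset2 subset_antisym)
  then show fd: "fin_dim" using assms(1) unfolding fin_dim_def by blast
  obtain b where b: "finite b" "basis b" using finite_basis_exists[OF fd] by blast
  have bc: "b \<subseteq> carrier V" using b(2) by (simp add: basis_def)
  have bij: "bij_betw (\<lambda>a. lincomb a b) (b \<rightarrow>\<^sub>E carrier K) (carrier V)"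
  proof (rule bij_betwI')
    have ex1: "\<exists>!a. a \<in> b \<rightarrow>\<^sub>E carrier K \<and> lincomb a b = v" if "v \<in> carrier V" for v
      using basis_criterion[OF b(1) bc] b(2) that by blast
    have lc: "lincomb a b \<in> carrier V" if "a \<in> b \<rightarrow>\<^sub>E carrier K" for a
      using that bc by (intro lincomb_closed) auto
    fix x y assume "x \<in> b \<rightarrow>\<^sub>E carrier K" "y \<in> b \<rightarrow>\<^sub>E carrier K"
    then show "(lincomb x b = lincomb y b) = (x = y)" using ex1 lc by metis
  next
    fix x assume "x \<in> b \<rightarrow>\<^sub>E carrier K"
    then show "lincomb x b \<in> carrier V" using bc by (intro lincomb_closed) auto
  next
    fix v assume "v \<in> carrier V"
    then show "\<exists>a\<in>b \<rightarrow>\<^sub>E carrier K. v = lincomb a b"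
      using basis_criterion[OF b(1) bc] b(2) by blast
  qed
  have "card (carrier V) = card (b \<rightarrow>\<^sub>E carrier K)" using bij_betw_same_card[OF bij] by simp
  also have "\<dots> = card (carrier K) ^ card b" using b(1) by (simp add: card_PiE)
  also have "card b = dim" using dim_basis[OF b] by simp
  finally show "card (carrier V) = card (carrier K) ^ dim" .
qed

lemma F2_module_vectorspace:
  assumes G: "comm_group G" and sq: "\<And>x. x \<in> carrier G \<Longrightarrow> x \<otimes>\<^bsub>G\<^esub> x = \<one>\<^bsub>G\<^esub>"
    and card: "card (carrier G) = 2 ^ d"
  shows "vectorspace (residue_ring 2) (F2_module G) \<and>
    vectorspace.fin_dim (residue_ring 2) (F2_module G) \<and>
    vectorspace.dim (residue_ring 2) (F2_module G) = d"
proof -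
  interpret G: comm_group G by (rule G)
  interpret P: residues_prime 2 "residue_ring (int 2)"
    by unfold_locales simp_all
  have F: "field (residue_ring 2)" using P.field_axioms by simp
  have C: "cring (residue_ring 2)" using P.cring_axioms by simp
  have car: "carrier (residue_ring 2) = {0, 1}" by (auto simp: residue_ring_def)
  have M: "module (residue_ring 2) (F2_module G)"
    by (rule module_criteria)
      (use C car sq G.m_assoc G.m_comm in \<open>auto simp: F2_module_def residue_ring_def G.int_pow_one intro: G.inv_closed\<close>)
  interpret V: vectorspace "residue_ring 2" "F2_module G"
    using M F by (simp add: vectorspace_def)
  have fin: "finite (carrier (F2_module G))" using card by (simp add: F2_module_def card_ge_0_finite)
  have "2 ^ V.dim = (2::nat) ^ d"
  proof -
    have "card (carrier (F2_module G)) = 2 ^ d" using card by (simp add: F2_module_def)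
    moreover have "card {0, 1 :: int} = 2" by simp
    moreover have "finite (carrier (residue_ring 2))" unfolding car by simp
    ultimately show ?thesis using V.card_eq_power_dim(2)[OF fin] unfolding car by presburger
  qed
  then have "V.dim = d" by simp
  then show ?thesis
    using V.vectorspace_axioms V.card_eq_power_dim(1)[OF fin] by (simp add: car)
qed

section \<open>Completions of a subfield\<close>

text \<open>Subfields of a field type, so that the ring operations of the associated record are the ordinary ones.\<close>
locale type_subfield =
  fixes F :: "'a::field set"
  assumes zero_mem [simp]: "0 \<in> F" and one_mem [simp]: "1 \<in> F"
    and add_mem [simp]: "x \<in> F \<Longrightarrow> y \<in> F \<Longrightarrow> x + y \<in> F"
    and uminus_mem [simp]: "x \<in> F \<Longrightarrow> - x \<in> F"
    and mult_mem [simp]: "x \<in> F \<Longrightarrow> y \<in> F \<Longrightarrow> x * y \<in> F"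
    and inverse_mem [simp]: "x \<in> F \<Longrightarrow> inverse x \<in> F"
begin

definition K :: "'a ring" where "K = ring_of_type_algebra\<lparr>carrier := F\<rparr>"

lemma diff_mem [simp]: "x \<in> F \<Longrightarrow> y \<in> F \<Longrightarrow> x - y \<in> F"
  using add_mem[of x "- y"] by simp

lemma divide_mem [simp]: "x \<in> F \<Longrightarrow> y \<in> F \<Longrightarrow> x / y \<in> F"
  by (simp add: divide_inverse)

lemma K_simps [simp]: "carrier K = F" "x \<otimes>\<^bsub>K\<^esub> y = x * y" "x \<oplus>\<^bsub>K\<^esub> y = x + y"
    "\<zero>\<^bsub>K\<^esub> = 0" "\<one>\<^bsub>K\<^esub> = 1"
  by (simp_all add: K_def ring_of_type_algebra_def)

lemma plain_field_K: "plain_field K"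
proof -
  have "cring K"
  proof (rule cringI)
    have "\<exists>y\<in>F. y + x = 0" if "x \<in> F" for x
      using that by (intro bexI[of _ "- x"]) simp_all
    then show "abelian_group K" by (intro abelian_groupI) (simp_all add: add_ac)
    show "comm_monoid K" by (intro comm_monoidI) (simp_all add: mult_ac)
  qed (simp add: algebra_simps)
  then have "field K"
  proof (rule cring.cring_fieldI2)
    fix a assume "a \<in> carrier K" "a \<noteq> \<zero>\<^bsub>K\<^esub>"
    then show "\<exists>b\<in>carrier K. a \<otimes>\<^bsub>K\<^esub> b = \<one>\<^bsub>K\<^esub>"
      by (intro bexI[of _ "inverse a"]) simp_all
  qed simp
  then show ?thesis by (simp add: plain_field_def)
qed

lemma a_minus_K [simp]:
  assumes "x \<in> F" shows "\<ominus>\<^bsub>K\<^esub> x = - x"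
proof -
  interpret plain_field K by (rule plain_field_K)
  show ?thesis using assms by (intro minus_equality) simp_all
qed

lemma minus_K [simp]: "x \<in> F \<Longrightarrow> y \<in> F \<Longrightarrow> x \<ominus>\<^bsub>K\<^esub> y = x - y"
  by (simp add: a_minus_def)

end

text \<open>The properties of an absolute value from which the squares of the completion can be determined
  inside the field. An element closer to 1 than \<open>\<delta>\<close> has arbitrarily good approximate square roots in the set
  \<open>G\<close>, which selects one of the two signs: sums of elements of \<open>G\<close> stay away from 0, whence
  \<open>\<gamma> \<bar>r - s\<bar> \<le> \<bar>r\<^sup>2 - s\<^sup>2\<bar>\<close>, and approximate roots of a Cauchy sequence form again a Cauchy sequence.
  At a 2-adic place \<open>G\<close> is \<open>1 + 4 \<int>\<^sub>2\<close>, at a real place the half-line of elements above \<open>1/2\<close>.\<close>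
locale valued_type_subfield = type_subfield F for F :: "'a::field set" +
  fixes v :: "'a place" and \<delta> \<gamma> :: real and G :: "'a set"
  assumes abs_zero: "place_abs K v 0 = 0"
    and abs_pos: "x \<in> F \<Longrightarrow> x \<noteq> 0 \<Longrightarrow> place_abs K v x > 0"
    and abs_mult: "x \<in> F \<Longrightarrow> y \<in> F \<Longrightarrow> place_abs K v (x * y) = place_abs K v x * place_abs K v y"
    and abs_add: "x \<in> F \<Longrightarrow> y \<in> F \<Longrightarrow> place_abs K v (x + y) \<le> place_abs K v x + place_abs K v y"
    and \<delta>: "\<delta> > 0" and \<gamma>: "\<gamma> > 0"
    and approx_root: "t \<in> F \<Longrightarrow> place_abs K v (t - 1) < \<delta> \<Longrightarrow> \<epsilon> > 0 \<Longrightarrow>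
      \<exists>r\<in>F. r \<in> G \<and> place_abs K v (r * r - t) < \<epsilon>"
    and root_sum: "r \<in> F \<Longrightarrow> s \<in> F \<Longrightarrow> r \<in> G \<Longrightarrow> s \<in> G \<Longrightarrow> place_abs K v (r + s) \<ge> \<gamma>"
begin

abbreviation N :: "'a \<Rightarrow> real" where "N \<equiv> place_abs K v"
abbreviation CS :: "(nat \<Rightarrow> 'a) ring" where "CS \<equiv> cauchy_ring K v"
abbreviation NS :: "(nat \<Rightarrow> 'a) set" where "NS \<equiv> null_seqs K v"
abbreviation L :: "(nat \<Rightarrow> 'a) set ring" where "L \<equiv> completion K v"
abbreviation emb :: "'a \<Rightarrow> (nat \<Rightarrow> 'a) set" where "emb \<equiv> completion_embed K v"

lemma N_nonneg: "x \<in> F \<Longrightarrow> N x \<ge> 0"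
  using abs_pos[of x] abs_zero by (cases "x = 0") auto

lemma N_one: "N 1 = 1"
  using abs_mult[of 1 1] abs_pos[of 1] by simp

lemma N_uminus: assumes "x \<in> F" shows "N (- x) = N x"
proof -
  have "N (-1) * N (-1) = 1" using abs_mult[of "-1" "-1"] N_one by simp
  then have "N (-1) = 1" using N_nonneg[of "-1"] by (simp add: square_eq_1_iff)
  then show ?thesis using abs_mult[of "-1" x] assms by simp
qed

lemma N_diff_commute: assumes "x \<in> F" "y \<in> F" shows "N (x - y) = N (y - x)"
  using N_uminus[of "x - y"] assms by simp

lemma N_diff: assumes "x \<in> F" "y \<in> F" shows "N (x - y) \<le> N x + N y"
  using abs_add[of x "- y"] N_uminus[of y] assms by simp

lemma N_diff_trans: assumes "x \<in> F" "y \<in> F" "z \<in> F" shows "N (x - z) \<le> N (x - y) + N (y - z)"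
  using abs_add[of "x - y" "y - z"] assms by simp

lemma N_ge: assumes "x \<in> F" "y \<in> F" shows "N x \<ge> N y - N (x - y)"
  using N_diff[of x "x - y"] assms by simp

definition cauchy :: "(nat \<Rightarrow> 'a) \<Rightarrow> bool" where
  "cauchy s \<longleftrightarrow> (\<forall>n. s n \<in> F) \<and> (\<forall>e>0. \<exists>M. \<forall>m\<ge>M. \<forall>n\<ge>M. N (s m - s n) < e)"

lemma cauchy_mem: "cauchy s \<Longrightarrow> s n \<in> F" by (simp add: cauchy_def)

lemma cauchyD:
  assumes "cauchy s" "e > 0"
  obtains M where "\<And>m n. m \<ge> M \<Longrightarrow> n \<ge> M \<Longrightarrow> N (s m - s n) < e"
  using assms unfolding cauchy_def by blast

lemma CS_simps [simp]: "s \<in> carrier CS \<longleftrightarrow> cauchy s" "s \<otimes>\<^bsub>CS\<^esub> t = (\<lambda>n. s n * t n)"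
    "s \<oplus>\<^bsub>CS\<^esub> t = (\<lambda>n. s n + t n)" "\<zero>\<^bsub>CS\<^esub> = (\<lambda>n. 0)" "\<one>\<^bsub>CS\<^esub> = (\<lambda>n. 1)"
proof -
  show "s \<in> carrier CS \<longleftrightarrow> cauchy s"
    by (auto simp: cauchy_ring_def cauchy_def)
qed (simp_all add: cauchy_ring_def)

lemma null_iff: "s \<in> NS \<longleftrightarrow> cauchy s \<and> (\<forall>e>0. \<exists>M. \<forall>n\<ge>M. N (s n) < e)"
  using N_nonneg cauchy_mem unfolding null_seqs_def
  by (auto simp: lim_sequentially dist_real_def)

lemma cauchy_const: "x \<in> F \<Longrightarrow> cauchy (\<lambda>_. x)"
  by (simp add: cauchy_def abs_zero)

lemma cauchy_add:
  assumes s: "cauchy s" and t: "cauchy t" shows "cauchy (\<lambda>n. s n + t n)"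
  unfolding cauchy_def
proof (intro conjI allI impI)
  fix e :: real assume e: "e > 0"
  obtain M1 where M1: "\<And>m n. m \<ge> M1 \<Longrightarrow> n \<ge> M1 \<Longrightarrow> N (s m - s n) < e / 2"
    using cauchyD[OF s, of "e / 2"] e by auto
  obtain M2 where M2: "\<And>m n. m \<ge> M2 \<Longrightarrow> n \<ge> M2 \<Longrightarrow> N (t m - t n) < e / 2"
    using cauchyD[OF t, of "e / 2"] e by auto
  have "N (s m + t m - (s n + t n)) < e" if "m \<ge> max M1 M2" "n \<ge> max M1 M2" for m n
  proof -
    have "N (s m + t m - (s n + t n)) \<le> N (s m - s n) + N (t m - t n)"
      using abs_add[of "s m - s n" "t m - t n"] cauchy_mem[OF s] cauchy_mem[OF t]
      by (simp add: algebra_simps)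
    then show ?thesis using M1[of m n] M2[of m n] that by simp
  qed
  then show "\<exists>M. \<forall>m\<ge>M. \<forall>n\<ge>M. N (s m + t m - (s n + t n)) < e" by blast
qed (use s t cauchy_mem in auto)

lemma cauchy_uminus:
  assumes s: "cauchy s" shows "cauchy (\<lambda>n. - s n)"
proof -
  have "N (- s m - - s n) = N (s m - s n)" for m n
    using N_diff_commute[of "s m" "s n"] cauchy_mem[OF s] by simp
  then show ?thesis using s unfolding cauchy_def by simp
qed

lemma cauchy_bounded:
  assumes s: "cauchy s"
  obtains B M where "B > 0" "\<And>n. n \<ge> M \<Longrightarrow> N (s n) \<le> B"
proof -
  obtain M where M: "\<And>m n. m \<ge> M \<Longrightarrow> n \<ge> M \<Longrightarrow> N (s m - s n) < 1"
    using cauchyD[OF s, of 1] by auto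
  have "N (s n) \<le> N (s M) + 1" if "n \<ge> M" for n
    using M[of n M] that abs_add[of "s n - s M" "s M"] cauchy_mem[OF s] by simp
  then show thesis using that[of "N (s M) + 1" M] N_nonneg[of "s M"] cauchy_mem[OF s] by simp
qed

lemma cauchy_mult:
  assumes s: "cauchy s" and t: "cauchy t" shows "cauchy (\<lambda>n. s n * t n)"
  unfolding cauchy_def
proof (intro conjI allI impI)
  fix e :: real assume e: "e > 0"
  note mem = cauchy_mem[OF s] cauchy_mem[OF t]
  obtain B1 K1 where B1: "B1 > 0" "\<And>n. n \<ge> K1 \<Longrightarrow> N (s n) \<le> B1" using cauchy_bounded[OF s] by blast
  obtain B2 K2 where B2: "B2 > 0" "\<And>n. n \<ge> K2 \<Longrightarrow> N (t n) \<le> B2" using cauchy_bounded[OF t] by blast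
  obtain M1 where M1: "\<And>m n. m \<ge> M1 \<Longrightarrow> n \<ge> M1 \<Longrightarrow> N (s m - s n) < e / (2 * B2)"
    using cauchyD[OF s, of "e / (2 * B2)"] e B2(1) by auto
  obtain M2 where M2: "\<And>m n. m \<ge> M2 \<Longrightarrow> n \<ge> M2 \<Longrightarrow> N (t m - t n) < e / (2 * B1)"
    using cauchyD[OF t, of "e / (2 * B1)"] e B1(1) by auto
  define M where "M = max (max M1 M2) (max K1 K2)"
  have "N (s m * t m - s n * t n) < e" if "m \<ge> M" "n \<ge> M" for m n
  proof -
    have "s m * t m - s n * t n = s m * (t m - t n) + t n * (s m - s n)"
      by (simp add: algebra_simps)
    then have "N (s m * t m - s n * t n) \<le> N (s m) * N (t m - t n) + N (t n) * N (s m - s n)"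
      using abs_add[of "s m * (t m - t n)" "t n * (s m - s n)"] mem by (simp add: abs_mult)
    also have "N (s m) * N (t m - t n) \<le> B1 * N (t m - t n)"
      using B1(2)[of m] that N_nonneg mem by (intro mult_right_mono) (auto simp: M_def)
    also have "B1 * N (t m - t n) < B1 * (e / (2 * B1))"
      using M2[of m n] that B1(1) by (intro mult_strict_left_mono) (auto simp: M_def)
    also have "N (t n) * N (s m - s n) \<le> B2 * N (s m - s n)"
      using B2(2)[of n] that N_nonneg mem by (intro mult_right_mono) (auto simp: M_def)
    also have "B2 * N (s m - s n) < B2 * (e / (2 * B2))"
      using M1[of m n] that B2(1) by (intro mult_strict_left_mono) (auto simp: M_def)
    also have "B1 * (e / (2 * B1)) + B2 * (e / (2 * B2)) = e"
      using B1(1) B2(1) by simp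
    finally show ?thesis by simp
  qed
  then show "\<exists>M. \<forall>m\<ge>M. \<forall>n\<ge>M. N (s m * t m - s n * t n) < e" by blast
qed (use s t cauchy_mem in auto)

lemma cring_CS: "cring CS"
proof (rule cringI)
  show "abelian_group CS"
  proof (rule abelian_groupI)
    fix s assume "s \<in> carrier CS"
    then show "\<exists>t\<in>carrier CS. t \<oplus>\<^bsub>CS\<^esub> s = \<zero>\<^bsub>CS\<^esub>"
      using cauchy_uminus by (intro bexI[of _ "\<lambda>n. - s n"]) simp_all
  qed (simp_all add: add_ac cauchy_add cauchy_const)
  show "comm_monoid CS"
    by (rule comm_monoidI) (simp_all add: mult_ac cauchy_mult cauchy_const)
qed (simp add: algebra_simps)

lemma a_minus_CS [simp]: assumes "cauchy s" shows "\<ominus>\<^bsub>CS\<^esub> s = (\<lambda>n. - s n)"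
proof -
  interpret cring CS by (rule cring_CS)
  show ?thesis using assms cauchy_uminus by (intro minus_equality) simp_all
qed

lemma ideal_NS: "ideal NS CS"
proof (rule idealI)
  interpret C: cring CS by (rule cring_CS)
  show "ring CS" by (rule C.ring_axioms)
  have mult: "(\<lambda>n. s n * t n) \<in> NS" if s: "s \<in> NS" and t: "cauchy t" for s t
    unfolding null_iff
  proof (intro conjI allI impI)
    have sc: "cauchy s" using s by (simp add: null_iff)
    show "cauchy (\<lambda>n. s n * t n)" by (rule cauchy_mult[OF sc t])
    fix e :: real assume e: "e > 0"
    obtain B M where B: "B > 0" "\<And>n. n \<ge> M \<Longrightarrow> N (t n) \<le> B" using cauchy_bounded[OF t] by blast
    have "e / B > 0" using e B(1) by simp
    then obtain M' where M': "\<And>n. n \<ge> M' \<Longrightarrow> N (s n) < e / B"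
      using s unfolding null_iff by blast
    have "N (s n * t n) < e" if "n \<ge> max M M'" for n
    proof -
      have "N (s n * t n) = N (s n) * N (t n)"
        using cauchy_mem[OF sc] cauchy_mem[OF t] by (simp add: abs_mult)
      also have "\<dots> \<le> N (s n) * B"
        using B(2)[of n] that N_nonneg cauchy_mem[OF sc] by (intro mult_left_mono) auto
      also have "\<dots> < e / B * B"
        using M'[of n] that B(1) by (intro mult_strict_right_mono) auto
      finally show ?thesis using B(1) by simp
    qed
    then show "\<exists>M. \<forall>n\<ge>M. N (s n * t n) < e" by blast
  qed
  have add: "(\<lambda>n. s n + t n) \<in> NS" if s: "s \<in> NS" and t: "t \<in> NS" for s t
    unfolding null_iff
  proof (intro conjI allI impI)
    have c: "cauchy s" "cauchy t" using s t by (simp_all add: null_iff)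
    show "cauchy (\<lambda>n. s n + t n)" using c by (rule cauchy_add)
    fix e :: real assume "e > 0"
    then have e: "e / 2 > 0" by simp
    obtain M1 where M1: "\<And>n. n \<ge> M1 \<Longrightarrow> N (s n) < e / 2" using s e unfolding null_iff by blast
    obtain M2 where M2: "\<And>n. n \<ge> M2 \<Longrightarrow> N (t n) < e / 2" using t e unfolding null_iff by blast
    have "N (s n + t n) < e" if "n \<ge> max M1 M2" for n
      using abs_add[of "s n" "t n"] cauchy_mem[OF c(1)] cauchy_mem[OF c(2)] M1[of n] M2[of n] that
      by simp
    then show "\<exists>M. \<forall>n\<ge>M. N (s n + t n) < e" by blast
  qed
  show "subgroup NS (add_monoid CS)"
  proof (rule C.add.subgroupI)
    show "NS \<subseteq> carrier CS" by (auto simp: null_iff)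
    have "(\<lambda>_. 0) \<in> NS" by (simp add: null_iff cauchy_const abs_zero)
    then show "NS \<noteq> {}" by blast
    fix s assume s: "s \<in> NS"
    have "(\<lambda>n. s n * (-1)) \<in> NS" by (rule mult[OF s]) (rule cauchy_const, simp)
    then show "\<ominus>\<^bsub>CS\<^esub> s \<in> NS" using s by (simp add: null_iff)
  qed (use add in simp)
  show "t \<otimes>\<^bsub>CS\<^esub> s \<in> NS" "s \<otimes>\<^bsub>CS\<^esub> t \<in> NS" if "s \<in> NS" "t \<in> carrier CS" for s t
    using mult[of s t] that by (simp_all add: mult.commute)
qed

definition cls :: "(nat \<Rightarrow> 'a) \<Rightarrow> (nat \<Rightarrow> 'a) set" where "cls s = NS +>\<^bsub>CS\<^esub> s"

lemma cls_hom: "cls \<in> ring_hom CS L"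
  using ideal.rcos_ring_hom[OF ideal_NS] unfolding cls_def[abs_def] completion_def .

lemma carrier_L: "carrier L = cls ` {s. cauchy s}"
proof -
  have "carrier L = (\<Union>s\<in>carrier CS. {NS +>\<^bsub>CS\<^esub> s})"
    by (simp only: completion_def FactRing_def A_RCOSETS_def' partial_object.select_convs)
  then show ?thesis by (auto simp: cls_def)
qed

lemma cls_eq_iff:
  assumes "cauchy s" "cauchy t"
  shows "cls s = cls t \<longleftrightarrow> (\<lambda>n. s n - t n) \<in> NS"
proof -
  interpret C: cring CS by (rule cring_CS)
  have "cls s = cls t \<longleftrightarrow> s \<ominus>\<^bsub>CS\<^esub> t \<in> NS"
    using C.quotient_eq_iff_same_a_r_cos[OF ideal_NS] assms by (simp add: cls_def)
  then show ?thesis using assms(2) by (simp add: a_minus_def)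
qed

lemma cls_simps:
  assumes "cauchy s" "cauchy t"
  shows "cls s \<otimes>\<^bsub>L\<^esub> cls t = cls (\<lambda>n. s n * t n)" "cls s \<oplus>\<^bsub>L\<^esub> cls t = cls (\<lambda>n. s n + t n)"
  using ring_hom_mult[OF cls_hom] ring_hom_add[OF cls_hom] assms by simp_all

lemma cring_L: "cring L"
  unfolding completion_def by (rule ideal.quotient_is_cring[OF ideal_NS cring_CS])

lemma zero_L: "\<zero>\<^bsub>L\<^esub> = cls (\<lambda>_. 0)"
  using ring_hom_zero[OF cls_hom cring.axioms(1)[OF cring_CS] cring.axioms(1)[OF cring_L]] by simp

lemma one_L: "\<one>\<^bsub>L\<^esub> = cls (\<lambda>_. 1)"
  using ring_hom_one[OF cls_hom] by simp

lemma cls_eq_0_iff: "cauchy s \<Longrightarrow> cls s = \<zero>\<^bsub>L\<^esub> \<longleftrightarrow> s \<in> NS"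
  using cls_eq_iff[of s "\<lambda>_. 0"] cauchy_const[of 0] by (simp add: zero_L)

lemma nonnull_bounded_below:
  assumes s: "cauchy s" "s \<notin> NS"
  obtains c M where "c > 0" "\<And>n. n \<ge> M \<Longrightarrow> N (s n) \<ge> c"
proof -
  obtain e where e: "e > 0" "\<And>M. \<exists>n\<ge>M. N (s n) \<ge> e"
    using s by (auto simp: null_iff not_less)
  obtain M where M: "\<And>m n. m \<ge> M \<Longrightarrow> n \<ge> M \<Longrightarrow> N (s m - s n) < e / 2"
    using cauchyD[OF s(1), of "e / 2"] e(1) by auto
  obtain m where m: "m \<ge> M" "N (s m) \<ge> e" using e(2) by blast
  have "N (s n) \<ge> e / 2" if "n \<ge> M" for n
    using N_ge[of "s n" "s m"] M[of n m] m that cauchy_mem[OF s(1)] by simp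
  then show thesis using that[of "e / 2" M] e(1) by simp
qed

lemma plain_field_L: "plain_field L"
proof -
  have "field L"
  proof (rule cring.cring_fieldI2[OF cring_L])
    have "(\<lambda>n. 1) \<notin> NS"
    proof
      assume "(\<lambda>n. 1) \<in> NS"
      then have "\<forall>e>0. \<exists>M::nat. \<forall>n\<ge>M. (1::real) < e" unfolding null_iff N_one by (rule conjunct2)
      then have "(0::real) < 1 \<longrightarrow> (\<exists>M::nat. \<forall>n\<ge>M. (1::real) < 1)" by (rule spec)
      moreover have "(0::real) < 1" by simp
      ultimately have "\<exists>M::nat. \<forall>n\<ge>M. (1::real) < 1" by (rule mp)
      then obtain M :: nat where M: "\<forall>n\<ge>M. (1::real) < 1" by (rule exE)
      show False using M[rule_format, OF order_refl] by simp
    qed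
    then show "\<zero>\<^bsub>L\<^esub> \<noteq> \<one>\<^bsub>L\<^esub>"
      using cls_eq_0_iff[of "\<lambda>_. 1"] cauchy_const[of 1] by (simp add: one_L)
  next
    fix a assume "a \<in> carrier L" "a \<noteq> \<zero>\<^bsub>L\<^esub>"
    then obtain s where s: "cauchy s" "a = cls s" "s \<notin> NS"
      using cls_eq_0_iff by (auto simp: carrier_L)
    obtain c M where c: "c > 0" "\<And>n. n \<ge> M \<Longrightarrow> N (s n) \<ge> c"
      using nonnull_bounded_below[OF s(1,3)] by blast
    define t where "t = (\<lambda>n. inverse (s n))"
    have tF: "t n \<in> F" for n using cauchy_mem[OF s(1)] by (simp add: t_def)
    have nz: "s n \<noteq> 0" if "n \<ge> M" for n using c(1) c(2)[OF that] abs_zero by auto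
    have t: "cauchy t" unfolding cauchy_def
    proof (intro conjI allI impI)
      fix e :: real assume e: "e > 0"
      obtain M' where M': "\<And>m n. m \<ge> M' \<Longrightarrow> n \<ge> M' \<Longrightarrow> N (s m - s n) < e * (c * c)"
        using cauchyD[OF s(1), of "e * (c * c)"] e c(1) by auto
      have "N (t m - t n) < e" if "m \<ge> max M M'" "n \<ge> max M M'" for m n
      proof -
        have "s m * s n * (t m - t n) = s n - s m"
          using nz[of m] nz[of n] that by (simp add: t_def field_simps)
        then have "N (s m) * N (s n) * N (t m - t n) = N (s n - s m)"
          using abs_mult cauchy_mem[OF s(1)] tF by (metis diff_mem mult_mem)
        also have "\<dots> < e * (c * c)" using M'[of n m] that by simp
        finally have "N (s m) * N (s n) * N (t m - t n) < e * (c * c)" .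
        moreover have "c * c * N (t m - t n) \<le> N (s m) * N (s n) * N (t m - t n)"
          using c(1) c(2)[of m] c(2)[of n] that N_nonneg tF by (intro mult_right_mono mult_mono) auto
        ultimately have "(c * c) * N (t m - t n) < (c * c) * e" by (simp add: mult_ac)
        then show ?thesis using c(1) by (simp add: mult_less_cancel_left)
      qed
      then show "\<exists>M. \<forall>m\<ge>M. \<forall>n\<ge>M. N (t m - t n) < e" by blast
    qed (rule tF)
    have "(\<lambda>n. s n * t n - 1) \<in> NS"
    proof -
      have "s n * t n - 1 = 0" if "n \<ge> M" for n using nz[OF that] by (simp add: t_def)
      then have "N (s n * t n - 1) = 0" if "n \<ge> M" for n using that abs_zero by simp
      moreover have "cauchy (\<lambda>n. s n * t n - 1)"
        using cauchy_add[OF cauchy_mult[OF s(1) t] cauchy_const[of "-1"]] by simp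
      ultimately show ?thesis unfolding null_iff by (auto intro!: exI[of _ M])
    qed
    then have "a \<otimes>\<^bsub>L\<^esub> cls t = \<one>\<^bsub>L\<^esub>"
      using cls_eq_iff[OF cauchy_mult[OF s(1) t] cauchy_const[of 1]] s t
      by (simp add: cls_simps one_L)
    then show "\<exists>b\<in>carrier L. a \<otimes>\<^bsub>L\<^esub> b = \<one>\<^bsub>L\<^esub>" using t by (auto simp: carrier_L)
  qed
  then show ?thesis by (simp add: plain_field_def)
qed

lemma emb_eq_cls: "emb x = cls (\<lambda>_. x)"
  by (simp add: completion_embed_def cls_def)

lemma emb_simps:
  assumes "x \<in> F" "y \<in> F"
  shows "emb x \<in> carrier L" "emb x \<otimes>\<^bsub>L\<^esub> emb y = emb (x * y)" "emb x \<oplus>\<^bsub>L\<^esub> emb y = emb (x + y)"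
    "emb 0 = \<zero>\<^bsub>L\<^esub>" "emb 1 = \<one>\<^bsub>L\<^esub>" "emb x = \<zero>\<^bsub>L\<^esub> \<longleftrightarrow> x = 0"
proof -
  have c: "cauchy (\<lambda>_. x)" "cauchy (\<lambda>_. y)" using assms by (simp_all add: cauchy_const)
  show "emb x \<in> carrier L" using c by (auto simp: carrier_L emb_eq_cls)
  show "emb x \<otimes>\<^bsub>L\<^esub> emb y = emb (x * y)" "emb x \<oplus>\<^bsub>L\<^esub> emb y = emb (x + y)"
    using cls_simps[OF c] by (simp_all add: emb_eq_cls)
  show "emb 0 = \<zero>\<^bsub>L\<^esub>" "emb 1 = \<one>\<^bsub>L\<^esub>" by (simp_all add: emb_eq_cls zero_L one_L)
  have "(\<lambda>_. x) \<in> NS \<longleftrightarrow> x = 0"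
  proof
    assume "(\<lambda>_. x) \<in> NS"
    then have "\<forall>e>0. N x < e" unfolding null_iff by blast
    then have "\<not> N x > 0" by blast
    then show "x = 0" using abs_pos[OF assms(1)] by blast
  qed (use c in \<open>simp add: null_iff abs_zero\<close>)
  then show "emb x = \<zero>\<^bsub>L\<^esub> \<longleftrightarrow> x = 0" using cls_eq_0_iff[OF c(1)] by (simp add: emb_eq_cls)
qed

lemma emb_uminus:
  assumes "x \<in> F" shows "\<ominus>\<^bsub>L\<^esub> emb x = emb (- x)"
proof -
  interpret L: plain_field L by (rule plain_field_L)
  have "emb (- x) \<oplus>\<^bsub>L\<^esub> emb x = \<zero>\<^bsub>L\<^esub>" using assms by (simp add: emb_simps)
  then show ?thesis by (rule L.minus_equality) (use assms in \<open>simp_all add: emb_simps\<close>)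
qed

text \<open>Approximate square roots of the terms, taken in \<open>G\<close>, form a Cauchy sequence and represent a root of
  the limit.\<close>
lemma near_one_cauchy_is_square:
  assumes t: "cauchy t" and near: "\<And>n. n \<ge> M \<Longrightarrow> N (t n - 1) < \<delta>"
  obtains r where "cauchy r" "cls t = cls r \<otimes>\<^bsub>L\<^esub> cls r"
proof -
  note tF = cauchy_mem[OF t]
  have "\<exists>r. r \<in> F \<and> (n \<ge> M \<longrightarrow> r \<in> G \<and> N (r * r - t n) < 1 / real (Suc n))" for n
  proof (cases "n \<ge> M")
    case True
    have "1 / real (Suc n) > 0" by simp
    then show ?thesis using approx_root[OF tF near[OF True]] by blast
  qed (auto intro: exI[of _ 0])
  then obtain r where rF: "\<And>n. r n \<in> F"
    and r: "\<And>n. n \<ge> M \<Longrightarrow> r n \<in> G" "\<And>n. n \<ge> M \<Longrightarrow> N (r n * r n - t n) < 1 / real (Suc n)"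
    by metis
  have small: "\<exists>M'\<ge>M. \<forall>n\<ge>M'. N (r n * r n - t n) < e" if e: "e > 0" for e
  proof -
    obtain k where k: "inverse (real (Suc k)) < e" using reals_Archimedean[OF e] by blast
    have "N (r n * r n - t n) < e" if "n \<ge> max M k" for n
    proof -
      have "N (r n * r n - t n) < 1 / real (Suc n)" using r(2) that by simp
      also have "\<dots> \<le> inverse (real (Suc k))" using that by (simp add: field_simps)
      finally show ?thesis using k by simp
    qed
    then show ?thesis by (intro exI[of _ "max M k"]) simp
  qed
  have rc: "cauchy r" unfolding cauchy_def
  proof (intro conjI allI impI)
    fix e :: real assume e: "e > 0"
    define d where "d = e * \<gamma> / 3"
    have d: "d > 0" using e \<gamma> by (simp add: d_def)
    obtain M1 where M1: "M1 \<ge> M" "\<And>n. n \<ge> M1 \<Longrightarrow> N (r n * r n - t n) < d" using small[OF d] by blast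
    obtain M2 where M2: "\<And>m n. m \<ge> M2 \<Longrightarrow> n \<ge> M2 \<Longrightarrow> N (t m - t n) < d" using cauchyD[OF t d] by blast
    have "N (r m - r n) < e" if mn: "m \<ge> max M1 M2" "n \<ge> max M1 M2" for m n
    proof -
      have "N (r m - r n) * \<gamma> \<le> N (r m - r n) * N (r m + r n)"
        using mn M1(1) r(1) rF by (intro mult_left_mono root_sum N_nonneg) simp_all
      also have "\<dots> = N (r m * r m - r n * r n)"
        using rF abs_mult[of "r m - r n" "r m + r n"] by (simp add: algebra_simps)
      also have "\<dots> \<le> N (r m * r m - t m) + N (t m - r n * r n)"
        using rF tF by (intro N_diff_trans) simp_all
      also have "N (t m - r n * r n) \<le> N (t m - t n) + N (t n - r n * r n)"
        using rF tF by (intro N_diff_trans) simp_all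
      also have "N (t n - r n * r n) = N (r n * r n - t n)"
        using rF tF by (intro N_diff_commute) simp_all
      finally have "N (r m - r n) * \<gamma> < 3 * d"
        using M1(2)[of m] M1(2)[of n] M2[of m n] mn by simp
      also have "3 * d = e * \<gamma>" by (simp add: d_def)
      finally show ?thesis using \<gamma> by simp
    qed
    then show "\<exists>M. \<forall>m\<ge>M. \<forall>n\<ge>M. N (r m - r n) < e" by blast
  qed (rule rF)
  have "cauchy (\<lambda>n. r n * r n - t n)"
    using cauchy_add[OF cauchy_mult[OF rc rc] cauchy_uminus[OF t]] by simp
  then have "(\<lambda>n. r n * r n - t n) \<in> NS" unfolding null_iff using small by blast
  then have "cls (\<lambda>n. r n * r n) = cls t" using cls_eq_iff[OF cauchy_mult[OF rc rc] t] by simp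
  then show thesis using that[OF rc] cls_simps[OF rc rc] by simp
qed

section \<open>Square classes of the completion\<close>

text \<open>Being a nonzero square in the completion, expressed inside the field by closeness to a square;
  \<open>local_square_iff\<close> justifies the name.\<close>
definition local_square :: "'a \<Rightarrow> bool" where
  "local_square x \<longleftrightarrow> x \<in> F \<and> x \<noteq> 0 \<and> (\<exists>y\<in>F. y \<noteq> 0 \<and> N (x - y * y) < \<delta> * N (y * y))"

lemma nonzero_squares_L_I:
  assumes "a \<in> carrier L" "b \<in> carrier L" "a = b \<otimes>\<^bsub>L\<^esub> b" "a \<noteq> \<zero>\<^bsub>L\<^esub>"
  shows "a \<in> nonzero_squares L"
proof -
  interpret L: plain_field L by (rule plain_field_L)
  have "b \<noteq> \<zero>\<^bsub>L\<^esub>" using assms by auto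
  then show ?thesis using assms by (auto simp: nonzero_squares_def)
qed

lemma local_square_iff:
  assumes "x \<in> F" "x \<noteq> 0"
  shows "emb x \<in> nonzero_squares L \<longleftrightarrow> local_square x"
proof
  interpret L: plain_field L by (rule plain_field_L)
  assume "local_square x"
  then obtain y where y: "y \<in> F" "y \<noteq> 0" "N (x - y * y) < \<delta> * N (y * y)"
    unfolding local_square_def by blast
  define t where "t = x / (y * y)"
  have tF: "t \<in> F" using assms y by (simp add: t_def)
  have xt: "x = y * y * t" using y(2) by (simp add: t_def)
  have "x - y * y = y * y * (t - 1)" using y(2) by (simp add: t_def field_simps)
  then have "N (y * y) * N (t - 1) < N (y * y) * \<delta>"
    using y abs_mult[of "y * y" "t - 1"] tF by (simp add: mult.commute)
  then have "N (t - 1) < \<delta>" using abs_pos[of "y * y"] y by (simp add: mult_less_cancel_left)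
  then obtain r where r: "cauchy r" "cls (\<lambda>_. t) = cls r \<otimes>\<^bsub>L\<^esub> cls r"
    using near_one_cauchy_is_square[OF cauchy_const[OF tF], of 0] by blast
  have rL: "cls r \<in> carrier L" using r(1) by (auto simp: carrier_L)
  have yL: "emb y \<in> carrier L" using y by (simp add: emb_simps)
  have "emb x = emb y \<otimes>\<^bsub>L\<^esub> emb y \<otimes>\<^bsub>L\<^esub> emb t"
    using y tF by (simp add: emb_simps) (simp add: xt)
  also have "\<dots> = (emb y \<otimes>\<^bsub>L\<^esub> cls r) \<otimes>\<^bsub>L\<^esub> (emb y \<otimes>\<^bsub>L\<^esub> cls r)"
    using r(2) rL yL by (simp add: emb_eq_cls[of t] L.m_ac)
  finally have e: "emb x = (emb y \<otimes>\<^bsub>L\<^esub> cls r) \<otimes>\<^bsub>L\<^esub> (emb y \<otimes>\<^bsub>L\<^esub> cls r)" .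
  show "emb x \<in> nonzero_squares L"
    by (rule nonzero_squares_L_I[OF _ _ e])
      (use emb_simps(1,6)[OF assms(1,1)] assms(2) rL yL in simp_all)
next
  interpret L: plain_field L by (rule plain_field_L)
  assume "emb x \<in> nonzero_squares L"
  then obtain b where b: "b \<in> carrier L" "b \<noteq> \<zero>\<^bsub>L\<^esub>" "emb x = b \<otimes>\<^bsub>L\<^esub> b"
    by (auto simp: nonzero_squares_def)
  then obtain s where s: "cauchy s" "b = cls s" "s \<notin> NS"
    using cls_eq_0_iff by (auto simp: carrier_L)
  obtain c M where c: "c > 0" "\<And>n. n \<ge> M \<Longrightarrow> N (s n) \<ge> c"
    using nonnull_bounded_below[OF s(1,3)] by blast
  have "cls (\<lambda>_. x) = cls (\<lambda>n. s n * s n)"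
    using b(3) s(2) cls_simps[OF s(1) s(1)] by (simp add: emb_eq_cls)
  then have "(\<lambda>n. x - s n * s n) \<in> NS"
    using cls_eq_iff[OF cauchy_const cauchy_mult[OF s(1) s(1)]] assms(1) by blast
  moreover have "\<delta> * (c * c) > 0" using \<delta> c(1) by simp
  ultimately obtain M' where M': "\<And>n. n \<ge> M' \<Longrightarrow> N (x - s n * s n) < \<delta> * (c * c)"
    unfolding null_iff by blast
  define y where "y = s (max M M')"
  have yF: "y \<in> F" using cauchy_mem[OF s(1)] by (simp add: y_def)
  have yc: "N y \<ge> c" using c(2) by (simp add: y_def)
  have "N (x - y * y) < \<delta> * (c * c)" using M' by (simp add: y_def)
  also have "\<delta> * (c * c) \<le> \<delta> * (N y * N y)"
    using yc c(1) \<delta> by (intro mult_left_mono mult_mono) auto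
  also have "N y * N y = N (y * y)" using yF by (simp add: abs_mult)
  finally have "N (x - y * y) < \<delta> * N (y * y)" .
  moreover have "y \<noteq> 0" using yc c(1) abs_zero by auto
  ultimately show "local_square x" using assms yF unfolding local_square_def by blast
qed

text \<open>For large \<open>n\<close> and all later \<open>k\<close> the quotient \<open>s k / s n\<close> is close to 1, so the limit of \<open>s\<close> differs from \<open>s n\<close> by a square.
  Hence every square class of the completion meets the field.\<close>
lemma square_class_approx:
  assumes s: "cauchy s" "s \<notin> NS"
  obtains M where "\<And>n. n \<ge> M \<Longrightarrow> s n \<noteq> 0 \<and> sq_class L (cls s) = sq_class L (emb (s n))"
proof -
  interpret L: plain_field L by (rule plain_field_L)
  note sF = cauchy_mem[OF s(1)]
  obtain c M where c: "c > 0" "\<And>n. n \<ge> M \<Longrightarrow> N (s n) \<ge> c"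
    using nonnull_bounded_below[OF s] by blast
  have "\<delta> * c > 0" using \<delta> c(1) by simp
  then obtain M' where M': "\<And>m n. m \<ge> M' \<Longrightarrow> n \<ge> M' \<Longrightarrow> N (s m - s n) < \<delta> * c"
    using cauchyD[OF s(1)] by blast
  have "s n \<noteq> 0 \<and> sq_class L (cls s) = sq_class L (emb (s n))" if n: "n \<ge> max M M'" for n
  proof -
    have Nn: "N (s n) \<ge> c" using c(2) n by simp
    then have nz: "s n \<noteq> 0" using c(1) abs_zero by auto
    define t where "t = (\<lambda>k. s k * inverse (s n))"
    have tc: "cauchy t" unfolding t_def
      by (rule cauchy_mult[OF s(1) cauchy_const]) (simp add: sF)
    have "N (t k - 1) < \<delta>" if k: "k \<ge> M'" for k
    proof -
      have "s n * (t k - 1) = s k - s n" using nz by (simp add: t_def field_simps)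
      then have "N (s n) * N (t k - 1) = N (s k - s n)"
        using sF cauchy_mem[OF tc] by (metis abs_mult diff_mem one_mem)
      also have "\<dots> < \<delta> * c" using M'[of k n] k n by simp
      also have "\<dots> \<le> N (s n) * \<delta>" using Nn \<delta> by simp
      finally show ?thesis using Nn c(1) by (simp add: mult_less_cancel_left)
    qed
    then obtain r where r: "cauchy r" "cls t = cls r \<otimes>\<^bsub>L\<^esub> cls r"
      using near_one_cauchy_is_square[OF tc, of M'] by blast
    have sL: "cls s \<in> carrier L" and rL: "cls r \<in> carrier L" using s(1) r(1) by (auto simp: carrier_L)
    have s0: "cls s \<noteq> \<zero>\<^bsub>L\<^esub>" using s cls_eq_0_iff by simp
    have eL: "emb (s n) \<in> carrier L" "emb (s n) \<noteq> \<zero>\<^bsub>L\<^esub>" using emb_simps(1,6)[OF sF sF] nz by simp_all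
    have "cls s = emb (s n) \<otimes>\<^bsub>L\<^esub> cls t"
    proof -
      have "(\<lambda>k. s n * t k) = s" using nz by (auto simp: t_def)
      then show ?thesis using cls_simps(1)[OF cauchy_const[OF sF] tc] by (simp add: emb_eq_cls)
    qed
    then have st: "cls s = emb (s n) \<otimes>\<^bsub>L\<^esub> (cls r \<otimes>\<^bsub>L\<^esub> cls r)" using r(2) by simp
    have "cls s \<otimes>\<^bsub>L\<^esub> emb (s n) = (emb (s n) \<otimes>\<^bsub>L\<^esub> cls r) \<otimes>\<^bsub>L\<^esub> (emb (s n) \<otimes>\<^bsub>L\<^esub> cls r)"
      unfolding st using rL eL by (simp add: L.m_ac)
    then have "cls s \<otimes>\<^bsub>L\<^esub> emb (s n) \<in> nonzero_squares L"
      using L.m_closed[OF sL eL(1)] L.m_closed[OF eL(1) rL] L.integral_iff[OF sL eL(1)] s0 eL(2)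
      by (intro nonzero_squares_L_I[of _ "emb (s n) \<otimes>\<^bsub>L\<^esub> cls r"]) simp_all
    then show ?thesis using nz L.sq_class_eq_iff_mult[of "cls s" "emb (s n)"] sL s0 eL by simp
  qed
  then show thesis using that by blast
qed

lemma emb_class_eq_iff:
  assumes "x \<in> F" "x \<noteq> 0" "y \<in> F" "y \<noteq> 0"
  shows "sq_class L (emb x) = sq_class L (emb y) \<longleftrightarrow> local_square (x * y)"
proof -
  interpret L: plain_field L by (rule plain_field_L)
  show ?thesis
    using L.sq_class_eq_iff_mult[of "emb x" "emb y"] local_square_iff[of "x * y"] assms
    by (simp add: emb_simps)
qed

lemma local_class_eq:
  assumes "x \<in> F" "x \<noteq> 0"
  shows "local_class K v (sq_class K x) = sq_class L (emb x)"
proof -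
  interpret K: plain_field K by (rule plain_field_K)
  interpret L: plain_field L by (rule plain_field_L)
  have "sq_class (completion K v) (completion_embed K v y) = sq_class L (emb x)" if y: "y \<in> sq_class K x" for y
  proof -
    obtain z where z: "z \<in> F" "z \<noteq> 0" "y = z * z * x"
      using y unfolding K.mem_sq_class_iff by auto
    have "emb y = emb z \<otimes>\<^bsub>L\<^esub> emb z \<otimes>\<^bsub>L\<^esub> emb x" using z assms by (simp add: emb_simps)
    moreover have "emb x \<in> carrier (mult_of L)" "emb y \<in> carrier (mult_of L)" "emb z \<in> carrier (mult_of L)"
      using z assms by (simp_all add: emb_simps)
    ultimately show ?thesis
      using L.sq_class_eq_iff[of "emb x" "emb y"] by metis
  qed
  moreover have "x \<in> sq_class K x"
    unfolding K.mem_sq_class_iff using assms by (auto intro!: bexI[of _ 1])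
  ultimately have "(\<lambda>y. sq_class (completion K v) (completion_embed K v y)) ` sq_class K x = {sq_class L (emb x)}"
    by blast
  then show ?thesis by (simp add: local_class_def)
qed

section \<open>The local Kummer image\<close>

text \<open>Representatives in the field of the local Kummer image: the values at infinity and at the three points of
  order 2, and those at the points whose \<open>x\<close>-coordinate \<open>a\<close> lies in the field and whose
  \<open>y\<close>-coordinate lies in the completion.\<close>
definition kummer_values :: "('a \<times> 'a \<times> 'a) set" where
  "kummer_values = {(1, 1, 1), (2, -1, -2), (1, -1, -1), (2, 1, 2)} \<union>
     {(a + 1, a, a - 1) |a. a \<in> F \<and> local_square ((a + 1) * a * (a - 1))}"

lemma two_nonzero: "(2::'a) \<noteq> 0"
proof -
  obtain r where r: "r \<in> F" "r \<in> G" using approx_root[of 1 1] \<delta> abs_zero by auto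
  then have "N (r + r) > 0" using root_sum[of r r] \<gamma> by simp
  then have "r + r \<noteq> 0" using abs_zero by auto
  then show ?thesis by (metis mult_2 mult_zero_left)
qed

lemma local_square_mem: "local_square x \<Longrightarrow> x \<in> F \<and> x \<noteq> 0"
  by (simp add: local_square_def)

lemma cubic_factor:
  assumes "a \<in> carrier L"
  shows "a [^]\<^bsub>L\<^esub> (3::nat) \<ominus>\<^bsub>L\<^esub> a = (a \<oplus>\<^bsub>L\<^esub> \<one>\<^bsub>L\<^esub>) \<otimes>\<^bsub>L\<^esub> a \<otimes>\<^bsub>L\<^esub> (a \<ominus>\<^bsub>L\<^esub> \<one>\<^bsub>L\<^esub>)"
proof -
  interpret L: plain_field L by (rule plain_field_L)
  have "a [^]\<^bsub>L\<^esub> (3::nat) = a \<otimes>\<^bsub>L\<^esub> a \<otimes>\<^bsub>L\<^esub> a"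
    using assms by (simp add: numeral_3_eq_3)
  moreover have "a \<otimes>\<^bsub>L\<^esub> a \<otimes>\<^bsub>L\<^esub> a \<ominus>\<^bsub>L\<^esub> u \<otimes>\<^bsub>L\<^esub> u \<otimes>\<^bsub>L\<^esub> a = (a \<oplus>\<^bsub>L\<^esub> u) \<otimes>\<^bsub>L\<^esub> a \<otimes>\<^bsub>L\<^esub> (a \<ominus>\<^bsub>L\<^esub> u)"
    if "u \<in> carrier L" for u
    using assms that by algebra
  from this[of "\<one>\<^bsub>L\<^esub>"]
  have "a \<otimes>\<^bsub>L\<^esub> a \<otimes>\<^bsub>L\<^esub> a \<ominus>\<^bsub>L\<^esub> a = (a \<oplus>\<^bsub>L\<^esub> \<one>\<^bsub>L\<^esub>) \<otimes>\<^bsub>L\<^esub> a \<otimes>\<^bsub>L\<^esub> (a \<ominus>\<^bsub>L\<^esub> \<one>\<^bsub>L\<^esub>)"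
    using assms by simp
  ultimately show ?thesis by simp
qed

lemma two_of_L: "two_of L = emb 2"
  using emb_simps(3)[of 1 1] by (simp add: two_of_def emb_simps(5)[of 1 1, symmetric])

text \<open>For a point with \<open>b \<noteq> 0\<close> the coordinate \<open>a\<close> is replaced by a term of a Cauchy sequence so late that
  \<open>a + 1\<close>, \<open>a\<close> and \<open>a - 1\<close> all keep their square classes; their product then remains a square.\<close>
lemma kummer_in_values:
  assumes P: "P \<in> curve_points L"
  obtains a1 a2 a3 where "(a1, a2, a3) \<in> kummer_values"
    "kummer L P = (sq_class L (emb a1), sq_class L (emb a2), sq_class L (emb a3))"
proof -
  interpret L: plain_field L by (rule plain_field_L)
  note e1 = emb_simps(5)[of 1 1, OF one_mem one_mem, symmetric]
  have two: "(2::'a) \<in> F" using add_mem[of 1 1] by simp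
  have um: "\<ominus>\<^bsub>L\<^esub> \<one>\<^bsub>L\<^esub> = emb (-1)" "\<ominus>\<^bsub>L\<^esub> (two_of L) = emb (-2)"
    using emb_uminus[of 1] emb_uminus[OF two] by (simp_all add: e1 two_of_L)
  show thesis
  proof (cases P)
    case Infinity
    then show thesis using that[of 1 1 1] by (simp add: kummer_values_def sq_triple_def e1)
  next
    case (Affine a b)
    then have ab: "a \<in> carrier L" "b \<in> carrier L" "b [^]\<^bsub>L\<^esub> (2::nat) = a [^]\<^bsub>L\<^esub> (3::nat) \<ominus>\<^bsub>L\<^esub> a"
      using P by (auto simp: curve_points_def)
    show thesis
    proof (cases "b = \<zero>\<^bsub>L\<^esub>")
      case True
      show thesis
      proof (cases "a = \<ominus>\<^bsub>L\<^esub> \<one>\<^bsub>L\<^esub>")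
        case True
        then show thesis using that[of 2 "-1" "-2"] \<open>b = \<zero>\<^bsub>L\<^esub>\<close> Affine um
          by (simp add: kummer_values_def sq_triple_def two_of_L)
      next
        case na: False
        show thesis
        proof (cases "a = \<zero>\<^bsub>L\<^esub>")
          case True
          then show thesis using that[of 1 "-1" "-1"] na \<open>b = \<zero>\<^bsub>L\<^esub>\<close> Affine um
            by (simp add: kummer_values_def sq_triple_def e1)
        next
          case False
          then show thesis using that[of 2 1 2] na \<open>b = \<zero>\<^bsub>L\<^esub>\<close> Affine
            by (simp add: kummer_values_def sq_triple_def two_of_L e1)
        qed
      qed
    next
      case b0: False
      obtain s where s: "cauchy s" "a = cls s" using ab(1) by (auto simp: carrier_L)
      note sF = cauchy_mem[OF s(1)]
      have one: "cauchy (\<lambda>_. 1)" "cauchy (\<lambda>_. -1)" by (simp_all add: cauchy_const)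
      have sp: "cauchy (\<lambda>n. s n + 1)" "cauchy (\<lambda>n. s n - 1)"
        using cauchy_add[OF s(1) one(1)] cauchy_add[OF s(1) one(2)] by simp_all
      have ap: "a \<oplus>\<^bsub>L\<^esub> \<one>\<^bsub>L\<^esub> = cls (\<lambda>n. s n + 1)"
        using cls_simps(2)[OF s(1) one(1)] s(2) by (simp add: one_L)
      have am: "a \<ominus>\<^bsub>L\<^esub> \<one>\<^bsub>L\<^esub> = cls (\<lambda>n. s n - 1)"
        using cls_simps(2)[OF s(1) one(2)] s(2) um(1) by (simp add: a_minus_def emb_eq_cls)
      have bb: "b \<otimes>\<^bsub>L\<^esub> b = (a \<oplus>\<^bsub>L\<^esub> \<one>\<^bsub>L\<^esub>) \<otimes>\<^bsub>L\<^esub> a \<otimes>\<^bsub>L\<^esub> (a \<ominus>\<^bsub>L\<^esub> \<one>\<^bsub>L\<^esub>)"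
        using ab cubic_factor[OF ab(1)] by (simp add: numeral_2_eq_2)
      have "b \<otimes>\<^bsub>L\<^esub> b \<noteq> \<zero>\<^bsub>L\<^esub>" using b0 ab(2) L.integral by blast
      then have nz: "a \<oplus>\<^bsub>L\<^esub> \<one>\<^bsub>L\<^esub> \<noteq> \<zero>\<^bsub>L\<^esub>" "a \<noteq> \<zero>\<^bsub>L\<^esub>" "a \<ominus>\<^bsub>L\<^esub> \<one>\<^bsub>L\<^esub> \<noteq> \<zero>\<^bsub>L\<^esub>"
        using L.integral_iff ab(1) L.a_closed L.minus_closed L.m_closed L.one_closed
        unfolding bb by metis+
      obtain M1 where M1: "\<And>n. n \<ge> M1 \<Longrightarrow> s n + 1 \<noteq> 0 \<and> sq_class L (a \<oplus>\<^bsub>L\<^esub> \<one>\<^bsub>L\<^esub>) = sq_class L (emb (s n + 1))"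
        using square_class_approx[OF sp(1)] nz(1) cls_eq_0_iff[OF sp(1)] unfolding ap by blast
      obtain M2 where M2: "\<And>n. n \<ge> M2 \<Longrightarrow> s n \<noteq> 0 \<and> sq_class L a = sq_class L (emb (s n))"
        using square_class_approx[OF s(1)] nz(2) cls_eq_0_iff[OF s(1)] unfolding s(2) by blast
      obtain M3 where M3: "\<And>n. n \<ge> M3 \<Longrightarrow> s n - 1 \<noteq> 0 \<and> sq_class L (a \<ominus>\<^bsub>L\<^esub> \<one>\<^bsub>L\<^esub>) = sq_class L (emb (s n - 1))"
        using square_class_approx[OF sp(2)] nz(3) cls_eq_0_iff[OF sp(2)] unfolding am by blast
      define \<alpha> where "\<alpha> = s (max M1 (max M2 M3))"
      have \<alpha>F: "\<alpha> \<in> F" using sF by (simp add: \<alpha>_def)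
      have \<alpha>: "\<alpha> + 1 \<noteq> 0" "\<alpha> \<noteq> 0" "\<alpha> - 1 \<noteq> 0"
        and cl: "sq_class L (a \<oplus>\<^bsub>L\<^esub> \<one>\<^bsub>L\<^esub>) = sq_class L (emb (\<alpha> + 1))" "sq_class L a = sq_class L (emb \<alpha>)"
          "sq_class L (a \<ominus>\<^bsub>L\<^esub> \<one>\<^bsub>L\<^esub>) = sq_class L (emb (\<alpha> - 1))"
        using M1[of "max M1 (max M2 M3)"] M2[of "max M1 (max M2 M3)"] M3[of "max M1 (max M2 M3)"]
        by (simp_all add: \<alpha>_def)
      have u: "a \<oplus>\<^bsub>L\<^esub> \<one>\<^bsub>L\<^esub> \<in> carrier (mult_of L)" "a \<in> carrier (mult_of L)" "a \<ominus>\<^bsub>L\<^esub> \<one>\<^bsub>L\<^esub> \<in> carrier (mult_of L)"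
        unfolding carrier_mult_of Diff_iff singleton_iff
        using nz L.a_closed[OF ab(1) L.one_closed] L.minus_closed[OF ab(1) L.one_closed] ab(1)
        by simp_all
      note u = u L.mult_of.m_closed[OF u(1,2)]
      have w: "emb (\<alpha> + 1) \<in> carrier (mult_of L)" "emb \<alpha> \<in> carrier (mult_of L)" "emb (\<alpha> - 1) \<in> carrier (mult_of L)"
        "emb ((\<alpha> + 1) * \<alpha>) \<in> carrier (mult_of L)"
        using \<alpha> \<alpha>F by (simp_all add: emb_simps)
      have "sq_class L (b \<otimes>\<^bsub>L\<^esub> b) = sq_class L (a \<oplus>\<^bsub>L\<^esub> \<one>\<^bsub>L\<^esub>) \<otimes>\<^bsub>sq_group L\<^esub> sq_class L a \<otimes>\<^bsub>sq_group L\<^esub> sq_class L (a \<ominus>\<^bsub>L\<^esub> \<one>\<^bsub>L\<^esub>)"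
        unfolding bb using u by (simp only: L.mult_sq_group)
      also have "\<dots> = sq_class L (emb (\<alpha> + 1)) \<otimes>\<^bsub>sq_group L\<^esub> sq_class L (emb \<alpha>) \<otimes>\<^bsub>sq_group L\<^esub> sq_class L (emb (\<alpha> - 1))"
        unfolding cl ..
      also have "\<dots> = sq_class L (emb ((\<alpha> + 1) * \<alpha> * (\<alpha> - 1)))"
        using w \<alpha>F by (simp only: L.mult_sq_group emb_simps add_mem mult_mem diff_mem one_mem)
      finally have "sq_class L (emb ((\<alpha> + 1) * \<alpha> * (\<alpha> - 1))) = sq_class L (b \<otimes>\<^bsub>L\<^esub> b)" by simp
      also have "sq_class L (b \<otimes>\<^bsub>L\<^esub> b) = sq_class L \<one>\<^bsub>L\<^esub>"
        using L.sq_class_eq_iff[of "\<one>\<^bsub>L\<^esub>" "b \<otimes>\<^bsub>L\<^esub> b"] ab(2) b0 \<open>b \<otimes>\<^bsub>L\<^esub> b \<noteq> \<zero>\<^bsub>L\<^esub>\<close> by auto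
      also have "\<one>\<^bsub>L\<^esub> = emb 1" by (rule e1)
      finally have "local_square ((\<alpha> + 1) * \<alpha> * (\<alpha> - 1) * 1)"
        using emb_class_eq_iff[of "(\<alpha> + 1) * \<alpha> * (\<alpha> - 1)" 1] \<alpha> \<alpha>F by simp
      then have "(\<alpha> + 1, \<alpha>, \<alpha> - 1) \<in> kummer_values" using \<alpha>F by (auto simp: kummer_values_def)
      moreover have "kummer L P = (sq_class L (emb (\<alpha> + 1)), sq_class L (emb \<alpha>), sq_class L (emb (\<alpha> - 1)))"
        using b0 cl by (simp add: Affine sq_triple_def)
      ultimately show thesis by (rule that)
    qed
  qed
qed

lemma values_in_kummer:
  assumes a: "(a1, a2, a3) \<in> kummer_values"
  shows "(sq_class L (emb a1), sq_class L (emb a2), sq_class L (emb a3)) \<in> kummer L ` curve_points L"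
proof -
  interpret L: plain_field L by (rule plain_field_L)
  note e1 = emb_simps(5)[of 1 1, OF one_mem one_mem, symmetric]
  have two: "(2::'a) \<in> F" using add_mem[of 1 1] by simp
  have um: "\<ominus>\<^bsub>L\<^esub> \<one>\<^bsub>L\<^esub> = emb (-1)" "\<ominus>\<^bsub>L\<^esub> (two_of L) = emb (-2)"
    using emb_uminus[of 1] emb_uminus[OF two] by (simp_all add: e1 two_of_L)
  have m1: "emb (-1) \<noteq> \<zero>\<^bsub>L\<^esub>" "emb (-1) \<in> carrier L" using emb_simps[of "-1" 1] by simp_all
  have ne: "\<one>\<^bsub>L\<^esub> \<noteq> emb (-1)"
  proof
    assume "\<one>\<^bsub>L\<^esub> = emb (-1)"
    then have "emb (1 + 1) = emb (-1) \<oplus>\<^bsub>L\<^esub> emb 1" using emb_simps(3)[of 1 1] by (simp add: e1)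
    also have "\<dots> = \<zero>\<^bsub>L\<^esub>" using emb_simps(3)[of "-1" 1] emb_simps(4)[of 1 1] by simp
    finally show False using emb_simps(6)[OF two two] two_nonzero by simp
  qed
  have z2: "\<zero>\<^bsub>L\<^esub> [^]\<^bsub>L\<^esub> (2::nat) = \<zero>\<^bsub>L\<^esub>" by (simp add: numeral_2_eq_2)
  have pts: "Affine (emb (-1)) \<zero>\<^bsub>L\<^esub> \<in> curve_points L" "Affine \<zero>\<^bsub>L\<^esub> \<zero>\<^bsub>L\<^esub> \<in> curve_points L"
    "Affine \<one>\<^bsub>L\<^esub> \<zero>\<^bsub>L\<^esub> \<in> curve_points L"
    using cubic_factor[of "emb (-1)"] cubic_factor[of "\<zero>\<^bsub>L\<^esub>"] cubic_factor[of "\<one>\<^bsub>L\<^esub>"] m1(2) z2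
      emb_simps(3)[of "-1" 1] emb_simps(4,5)[of 1 1]
    by (simp_all add: curve_points_def a_minus_def L.r_neg)
  consider "(a1, a2, a3) = (1, 1, 1)" | "(a1, a2, a3) = (2, -1, -2)" | "(a1, a2, a3) = (1, -1, -1)"
    | "(a1, a2, a3) = (2, 1, 2)"
    | a where "(a1, a2, a3) = (a + 1, a, a - 1)" "a \<in> F" "local_square ((a + 1) * a * (a - 1))"
    using a unfolding kummer_values_def by blast
  then show ?thesis
  proof cases
    case 1
    then have "kummer L Infinity = (sq_class L (emb a1), sq_class L (emb a2), sq_class L (emb a3))"
      by (simp add: sq_triple_def e1)
    moreover have "Infinity \<in> curve_points L" by (simp add: curve_points_def)
    ultimately show ?thesis by (metis imageI)
  next
    case 2
    then have "kummer L (Affine (emb (-1)) \<zero>\<^bsub>L\<^esub>) = (sq_class L (emb a1), sq_class L (emb a2), sq_class L (emb a3))"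
      using um by (simp add: sq_triple_def two_of_L)
    then show ?thesis using pts(1) by (metis imageI)
  next
    case 3
    then have "kummer L (Affine \<zero>\<^bsub>L\<^esub> \<zero>\<^bsub>L\<^esub>) = (sq_class L (emb a1), sq_class L (emb a2), sq_class L (emb a3))"
      using um m1 by (simp add: sq_triple_def e1)
    then show ?thesis using pts(2) by (metis imageI)
  next
    case 4
    then have "kummer L (Affine \<one>\<^bsub>L\<^esub> \<zero>\<^bsub>L\<^esub>) = (sq_class L (emb a1), sq_class L (emb a2), sq_class L (emb a3))"
      using um(1) ne by (simp add: sq_triple_def two_of_L) (simp add: e1)
    then show ?thesis using pts(3) by (metis imageI)
  next
    case (5 a)
    have aF: "a \<in> F" by (rule 5)
    have "emb ((a + 1) * a * (a - 1)) \<in> nonzero_squares L"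
      using local_square_iff local_square_mem 5(3) by blast
    then obtain b where b: "b \<in> carrier L" "b \<noteq> \<zero>\<^bsub>L\<^esub>" "emb ((a + 1) * a * (a - 1)) = b \<otimes>\<^bsub>L\<^esub> b"
      by (auto simp: nonzero_squares_def)
    have ap: "emb a \<oplus>\<^bsub>L\<^esub> \<one>\<^bsub>L\<^esub> = emb (a + 1)" using emb_simps(3)[of a 1] aF by (simp add: e1)
    have am: "emb a \<ominus>\<^bsub>L\<^esub> \<one>\<^bsub>L\<^esub> = emb (a - 1)"
      using emb_simps(3)[of a "-1"] aF um(1) by (simp add: a_minus_def)
    have "b [^]\<^bsub>L\<^esub> (2::nat) = emb a [^]\<^bsub>L\<^esub> (3::nat) \<ominus>\<^bsub>L\<^esub> emb a"
      using cubic_factor[of "emb a"] b aF unfolding ap am by (simp add: emb_simps numeral_2_eq_2)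
    then have "Affine (emb a) b \<in> curve_points L"
      using b(1) emb_simps(1)[OF aF aF] by (simp add: curve_points_def)
    moreover have "kummer L (Affine (emb a) b) = (sq_class L (emb a1), sq_class L (emb a2), sq_class L (emb a3))"
      using b(2) 5(1) by (simp add: sq_triple_def ap am)
    ultimately show ?thesis by (metis imageI)
  qed
qed

lemma kummer_values_nonzero:
  assumes "(a1, a2, a3) \<in> kummer_values"
  shows "a1 \<in> F" "a1 \<noteq> 0" "a2 \<in> F" "a2 \<noteq> 0" "a3 \<in> F" "a3 \<noteq> 0"
proof -
  have two: "(2::'a) \<in> F" using add_mem[of 1 1] by simp
  have "a1 \<in> F \<and> a1 \<noteq> 0 \<and> a2 \<in> F \<and> a2 \<noteq> 0 \<and> a3 \<in> F \<and> a3 \<noteq> 0"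
    using assms two two_nonzero by (auto simp: kummer_values_def dest!: local_square_mem)
  then show "a1 \<in> F" "a1 \<noteq> 0" "a2 \<in> F" "a2 \<noteq> 0" "a3 \<in> F" "a3 \<noteq> 0" by simp_all
qed

text \<open>The completion disappears from the local condition.\<close>
theorem local_image_iff:
  assumes "x \<in> F" "x \<noteq> 0" "y \<in> F" "y \<noteq> 0" "z \<in> F" "z \<noteq> 0"
  shows "local_triple K v (sq_class K x, sq_class K y, sq_class K z) \<in> kummer L ` curve_points L \<longleftrightarrow>
    (\<exists>a1 a2 a3. (a1, a2, a3) \<in> kummer_values \<and> local_square (x * a1) \<and> local_square (y * a2) \<and> local_square (z * a3))"
    (is "?l \<in> _ \<longleftrightarrow> ?R")
proof -
  have l: "?l = (sq_class L (emb x), sq_class L (emb y), sq_class L (emb z))"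
    using assms by (simp add: local_class_eq)
  show ?thesis
  proof
    assume "?l \<in> kummer L ` curve_points L"
    then obtain P where P: "P \<in> curve_points L" "?l = kummer L P" by blast
    obtain a1 a2 a3 where a: "(a1, a2, a3) \<in> kummer_values"
      "kummer L P = (sq_class L (emb a1), sq_class L (emb a2), sq_class L (emb a3))"
      using kummer_in_values[OF P(1)] .
    have "sq_class L (emb x) = sq_class L (emb a1)" "sq_class L (emb y) = sq_class L (emb a2)"
      "sq_class L (emb z) = sq_class L (emb a3)"
      using P(2) a(2) unfolding l by simp_all
    then have "local_square (x * a1) \<and> local_square (y * a2) \<and> local_square (z * a3)"
      using emb_class_eq_iff assms kummer_values_nonzero[OF a(1)] by simp
    then show ?R using a(1) by blast
  next
    assume ?R
    then obtain a1 a2 a3 where a: "(a1, a2, a3) \<in> kummer_values" "local_square (x * a1)" "local_square (y * a2)" "local_square (z * a3)"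
      by blast
    have "sq_class L (emb x) = sq_class L (emb a1)" "sq_class L (emb y) = sq_class L (emb a2)"
      "sq_class L (emb z) = sq_class L (emb a3)"
      using emb_class_eq_iff assms kummer_values_nonzero[OF a(1)] a(2-4) by simp_all
    then show "?l \<in> kummer L ` curve_points L" unfolding l using values_in_kummer[OF a(1)] by simp
  qed
qed

end

section \<open>Discrete valuations\<close>

locale field_valuation = type_subfield F for F :: "'a::field_char_0 set" +
  fixes v :: "'a \<Rightarrow> int"
  assumes valuation: "discrete_valuation K v"
begin

lemma v_mult: "x \<in> F \<Longrightarrow> x \<noteq> 0 \<Longrightarrow> y \<in> F \<Longrightarrow> y \<noteq> 0 \<Longrightarrow> v (x * y) = v x + v y"
  using valuation unfolding discrete_valuation_def by simp

lemma v_add: "x \<in> F \<Longrightarrow> x \<noteq> 0 \<Longrightarrow> y \<in> F \<Longrightarrow> y \<noteq> 0 \<Longrightarrow> x + y \<noteq> 0 \<Longrightarrow> min (v x) (v y) \<le> v (x + y)"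
  using valuation unfolding discrete_valuation_def by simp

lemma v_surj: obtains x where "x \<in> F" "x \<noteq> 0" "v x = k"
proof -
  have "k \<in> v ` carrier (mult_of K)" using valuation unfolding discrete_valuation_def by simp
  then show thesis using that by auto
qed

lemma of_nat_mem [simp]: "of_nat n \<in> F" by (induction n) simp_all

lemma of_int_mem [simp]: "of_int n \<in> F" by (cases n) (simp_all del: of_nat_Suc)

lemma numeral_mem [simp]: "numeral n \<in> F" using of_nat_mem[of "numeral n"] by simp

lemma power_mem [simp]: "x \<in> F \<Longrightarrow> x ^ n \<in> F" by (induction n) simp_all

lemma powi_mem [simp]: "x \<in> F \<Longrightarrow> x powi n \<in> F" by (simp add: power_int_def)

lemma v_one [simp]: "v 1 = 0" using v_mult[of 1 1] by simp

lemma v_minus_one: "v (-1) = 0" using v_mult[of "-1" "-1"] by simp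

lemma v_uminus: "x \<in> F \<Longrightarrow> v (- x) = v x"
  using v_mult[of "-1" x] v_minus_one by (cases "x = 0") simp_all

lemma v_inverse: assumes "x \<in> F" "x \<noteq> 0" shows "v (inverse x) = - v x"
  using v_mult[of x "inverse x"] assms by simp

lemma v_divide: "x \<in> F \<Longrightarrow> x \<noteq> 0 \<Longrightarrow> y \<in> F \<Longrightarrow> y \<noteq> 0 \<Longrightarrow> v (x / y) = v x - v y"
  using v_mult[of x "inverse y"] v_inverse[of y] by (simp add: divide_inverse)

lemma v_power: "x \<in> F \<Longrightarrow> x \<noteq> 0 \<Longrightarrow> v (x ^ n) = int n * v x"
  by (induction n) (simp_all add: v_mult algebra_simps)

lemma v_powi: "x \<in> F \<Longrightarrow> x \<noteq> 0 \<Longrightarrow> v (x powi n) = n * v x"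
  by (simp add: power_int_def v_power v_inverse)

text \<open>The fractional ideal of elements of valuation at least \<open>k\<close>, with 0 included in all of them; it avoids case
  distinctions at 0, where the valuation itself is arbitrary.\<close>
definition vge :: "int \<Rightarrow> 'a \<Rightarrow> bool" where "vge k x \<longleftrightarrow> x \<in> F \<and> (x = 0 \<or> k \<le> v x)"

lemma vge_mem: "vge k x \<Longrightarrow> x \<in> F" by (simp add: vge_def)

lemma vge_0 [simp]: "vge k 0" by (simp add: vge_def)

lemma vge_mono: "vge k x \<Longrightarrow> l \<le> k \<Longrightarrow> vge l x" by (auto simp: vge_def)

lemma vge_add: assumes "vge k x" "vge k y" shows "vge k (x + y)"
proof (cases "x = 0 \<or> y = 0 \<or> x + y = 0")
  case False
  then show ?thesis using assms v_add[of x y] by (auto simp: vge_def)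
qed (use assms in \<open>auto simp: vge_def\<close>)

lemma vge_uminus: "vge k x \<Longrightarrow> vge k (- x)" by (auto simp: vge_def v_uminus)

lemma vge_diff: assumes "vge k x" "vge k y" shows "vge k (x - y)"
  using vge_add[OF assms(1) vge_uminus[OF assms(2)]] by simp

lemma vge_mult: assumes "vge k x" "vge l y" shows "vge (k + l) (x * y)"
  using assms v_mult[of x y] by (cases "x = 0 \<or> y = 0") (auto simp: vge_def)

lemma vge_self: "x \<in> F \<Longrightarrow> vge (v x) x" by (simp add: vge_def)

lemma vge_of_nat: "vge 0 (of_nat n)"
proof (induction n)
  case (Suc n)
  then show ?case using vge_add[of 0 1 "of_nat n"] by (simp add: vge_def[of 0 1])
qed simp

lemma vge_of_int: "vge 0 (of_int n)"
  using vge_of_nat[of "nat n"] vge_uminus[OF vge_of_nat[of "nat (- n)"]]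
  by (cases "n \<ge> 0") (simp_all add: of_nat_nat)

lemma v_add_eq:
  assumes "x \<in> F" "x \<noteq> 0" "vge (v x + 1) y"
  shows "x + y \<noteq> 0" "v (x + y) = v x"
proof -
  show nz: "x + y \<noteq> 0"
  proof
    assume "x + y = 0"
    then have "y = - x" by (simp add: eq_neg_iff_add_eq_0 add.commute)
    then show False using assms v_uminus[of x] by (auto simp: vge_def)
  qed
  have "vge (v x) (x + y)" using vge_add[OF vge_self[OF assms(1)] vge_mono[OF assms(3)]] by simp
  moreover have "\<not> vge (v x + 1) (x + y)"
  proof
    assume "vge (v x + 1) (x + y)"
    then have "vge (v x + 1) (x + y - y)" using assms(3) by (rule vge_diff)
    then show False using assms(2) by (simp add: vge_def)
  qed
  ultimately show "v (x + y) = v x" using nz by (auto simp: vge_def)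
qed

lemma v_odd_of_int: assumes "v 2 > 0" "odd n" shows "v (of_int n) = 0"
proof -
  obtain k where k: "n = 2 * k + 1" using assms(2) by (elim oddE)
  have "vge (v 2) (2 * of_int k)" using vge_mult[OF vge_self[of 2] vge_of_int[of k]] by simp
  then have "vge 1 (2 * of_int k)" by (rule vge_mono) (use assms(1) in simp)
  then have "v (1 + 2 * of_int k) = 0" using v_add_eq(2)[of 1 "2 * of_int k"] by simp
  then show ?thesis using k by (simp add: add.commute)
qed

text \<open>Below, \<open>v 2 > 0\<close> is all that is known of a place above 2; the value \<open>v 2 = 1\<close> will be deduced from this
  formula.\<close>
lemma v_of_int_eq: assumes "v 2 > 0" "m \<noteq> 0" shows "v (of_int m) = int (multiplicity 2 m) * v 2"
proof -
  obtain m' where m': "m = 2 ^ multiplicity 2 m * m'" "\<not> 2 dvd m'"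
    using multiplicity_decompose'[of m 2] assms by auto
  have "v (of_int m) = v (2 ^ multiplicity 2 m * of_int m')" by (subst m'(1)) simp
  also have "\<dots> = int (multiplicity 2 m) * v 2"
    using m'(2) assms m'(1) v_odd_of_int[OF assms(1), of m'] by (subst v_mult) (auto simp: v_power)
  finally show ?thesis .
qed

end

section \<open>Square classes at a 2-adic place\<close>

text \<open>A place whose completion is \<open>\<rat>\<^sub>2\<close>: it is unramified, and the rational numbers are dense. Relative precision
  \<open>2\<^sup>3\<close> suffices because \<open>1 + 8 \<int>\<^sub>2\<close> consists of squares.\<close>
locale two_adic_place = field_valuation +
  assumes v_two: "v 2 = 1"
    and rational_approx: "x \<in> F \<Longrightarrow> x \<noteq> 0 \<Longrightarrow>
      \<exists>m d :: int. m \<noteq> 0 \<and> d \<noteq> 0 \<and> vge (v x + 3) (x - of_int m / of_int d)"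
begin

lemma v_odd: assumes "odd n" shows "v (of_int n) = 0"
  by (rule v_odd_of_int) (use assms v_two in simp_all)

lemma v_of_int: assumes "m \<noteq> 0" shows "v (of_int m) = int (multiplicity 2 m)"
  using v_of_int_eq[OF _ assms] v_two by simp

lemma vge_of_int_iff: "vge (int k) (of_int m) \<longleftrightarrow> 2 ^ k dvd m"
proof (cases "m = 0")
  case False
  then show ?thesis by (simp add: vge_def v_of_int power_dvd_iff_le_multiplicity)
qed simp

text \<open>\<open>x = 2\<^sup>k n\<close> up to a factor in \<open>1 + 8 \<int>\<^sub>2\<close>. The parity of \<open>k\<close> and the residue of \<open>n\<close> modulo 8 are the
  coordinates of the class of \<open>x\<close> in \<open>\<rat>\<^sub>2\<^sup>*\<close> modulo squares.\<close>
definition dyad :: "'a \<Rightarrow> int \<Rightarrow> int \<Rightarrow> bool" where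
  "dyad x k n \<longleftrightarrow> odd n \<and> (\<exists>e. vge 3 e \<and> x = 2 powi k * (of_int n + e))"

lemma unit_plus: assumes "odd n" "vge 1 e"
  shows "of_int n + e \<noteq> 0" "v (of_int n + e) = 0" "of_int n + e \<in> F"
  using v_add_eq[of "of_int n" e] assms v_odd[of n] vge_mem[of 1 e] by auto

lemma dyadD:
  assumes "dyad x k n"
  shows "x \<in> F" "x \<noteq> 0" "v x = k" "odd n"
proof -
  obtain e where e: "odd n" "vge 3 e" "x = 2 powi k * (of_int n + e)" using assms by (auto simp: dyad_def)
  note u = unit_plus[OF e(1) vge_mono[OF e(2)]]
  show "x \<in> F" "x \<noteq> 0" "v x = k" "odd n"
    using e u by (simp_all add: v_mult v_powi v_two)
qed

lemma dyad_cong: assumes "dyad x k n" "[n = m] (mod 8)" shows "dyad x k m"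
proof -
  obtain e where e: "odd n" "vge 3 e" "x = 2 powi k * (of_int n + e)" using assms by (auto simp: dyad_def)
  have d: "2 ^ 3 dvd n - m" using assms(2) by (simp add: cong_iff_dvd_diff)
  then have "vge 3 (of_int (n - m))" using vge_of_int_iff[of 3 "n - m"] by simp
  then have "vge 3 (of_int (n - m) + e)" using e(2) by (rule vge_add)
  moreover have "x = 2 powi k * (of_int m + (of_int (n - m) + e))" using e(3) by simp
  moreover have "8 dvd n - m" using d by simp
  then have "odd m" using e(1) by presburger
  ultimately show ?thesis unfolding dyad_def by blast
qed

lemma dyad_unique: assumes "dyad x k n" "dyad x l m" shows "k = l" "[n = m] (mod 8)"
proof -
  show kl: "k = l" using dyadD(3) assms by blast
  obtain e where e: "vge 3 e" "x = 2 powi k * (of_int n + e)" using assms(1) by (auto simp: dyad_def)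
  obtain f where f: "vge 3 f" "x = 2 powi k * (of_int m + f)" using assms(2) kl by (auto simp: dyad_def)
  have "of_int n + e = of_int m + f" using e(2) f(2) by simp
  then have "of_int (n - m) = f - e" by (simp add: algebra_simps)
  then have "vge 3 (of_int (n - m))" using vge_diff[OF f(1) e(1)] by simp
  then show "[n = m] (mod 8)" using vge_of_int_iff[of 3 "n - m"] by (simp add: cong_iff_dvd_diff)
qed

lemma dyad_mult: assumes "dyad x k n" "dyad y l m" shows "dyad (x * y) (k + l) (n * m)"
proof -
  obtain e where e: "odd n" "vge 3 e" "x = 2 powi k * (of_int n + e)" using assms(1) by (auto simp: dyad_def)
  obtain f where f: "odd m" "vge 3 f" "y = 2 powi l * (of_int m + f)" using assms(2) by (auto simp: dyad_def)
  have "x * y = 2 powi (k + l) * (of_int (n * m) + (of_int n * f + (of_int m * e + e * f)))"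
    unfolding e(3) f(3) by (simp add: power_int_add algebra_simps)
  moreover have "vge 3 (of_int n * f + (of_int m * e + e * f))"
    using vge_mult[OF vge_of_int[of n] f(2)] vge_mult[OF vge_of_int[of m] e(2)]
      vge_mono[OF vge_mult[OF e(2) f(2)], of 3]
    by (intro vge_add) simp_all
  ultimately show ?thesis using e(1) f(1) unfolding dyad_def by (metis even_mult_iff)
qed

lemma dyad_perturb: assumes "dyad x k n" "vge (k + 3) z" shows "dyad (x + z) k n"
proof -
  obtain e where e: "odd n" "vge 3 e" "x = 2 powi k * (of_int n + e)" using assms by (auto simp: dyad_def)
  have "vge (- k) (2 powi (- k))" by (simp add: vge_def v_powi v_two)
  then have "vge 3 (z * 2 powi (- k))" using vge_mult[OF assms(2)] by fastforce
  then have "vge 3 (e + z * 2 powi (- k))" using e(2) by (rule vge_add[rotated])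
  moreover have "x + z = 2 powi k * (of_int n + (e + z * 2 powi (- k)))"
    using e(3) by (simp add: power_int_minus field_simps)
  ultimately show ?thesis using e(1) unfolding dyad_def by blast
qed

text \<open>An odd denominator may be moved to the numerator, as \<open>d\<^sup>2 \<equiv> 1 (mod 8)\<close>.\<close>
lemma dyad_dyadic_frac:
  assumes "odd m" "odd d" shows "dyad (2 powi k * of_int m / of_int d) k (m * d)"
proof -
  have d0: "of_int d \<noteq> (0::'a)" using assms(2) by auto
  define e where "e = of_int (m * (1 - d * d)) / (of_int d :: 'a)"
  have "8 dvd d * d - 1"
  proof -
    obtain k where k: "d = 2 * k + 1" using assms(2) by (elim oddE)
    have "even (k * (k + 1))" by simp
    then obtain t where "k * (k + 1) = 2 * t" by (elim evenE)
    then have "d * d - 1 = 8 * t" unfolding k by (simp add: algebra_simps)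
    then show ?thesis by simp
  qed
  then have "8 dvd 1 - d * d" by (simp add: dvd_diff_commute)
  then have "2 ^ 3 dvd m * (1 - d * d)" by simp
  then have "vge 3 (of_int (m * (1 - d * d)))" using vge_of_int_iff[of 3 "m * (1 - d * d)"] by simp
  moreover have "vge 0 (inverse (of_int d))" using v_odd[OF assms(2)] d0 by (simp add: vge_def v_inverse)
  ultimately have "vge (3 + 0) (of_int (m * (1 - d * d)) * inverse (of_int d))" by (rule vge_mult)
  then have "vge 3 e" by (simp add: e_def divide_inverse)
  moreover have "2 powi k * of_int m / of_int d = 2 powi k * (of_int (m * d) + e)"
    using d0 by (simp add: e_def field_simps)
  moreover have "odd (m * d)" using assms by simp
  ultimately show ?thesis unfolding dyad_def by blast
qed

lemma dyad_exists:
  assumes "x \<in> F" "x \<noteq> 0"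
  obtains n where "dyad x (v x) n"
proof -
  obtain m d :: int where md: "m \<noteq> 0" "d \<noteq> 0" "vge (v x + 3) (x - of_int m / of_int d)"
    using rational_approx[OF assms] by blast
  obtain m' where m': "m = 2 ^ multiplicity 2 m * m'" "odd m'"
    using multiplicity_decompose'[of m 2] md by auto
  obtain d' where d': "d = 2 ^ multiplicity 2 d * d'" "odd d'"
    using multiplicity_decompose'[of d 2] md by auto
  define k where "k = int (multiplicity 2 m) - int (multiplicity 2 d)"
  have "of_int m / of_int d = (2 ^ multiplicity 2 m * of_int m' / (2 ^ multiplicity 2 d * of_int d') :: 'a)"
    by (subst m'(1), subst d'(1)) simp
  also have "\<dots> = 2 powi k * of_int m' / of_int d'"
    by (simp add: k_def power_int_diff field_simps)
  finally have c: "dyad (of_int m / of_int d) k (m' * d')" using dyad_dyadic_frac[OF m'(2) d'(2)] by simp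
  have "vge (v x + 1) (- (x - of_int m / of_int d))" by (intro vge_uminus vge_mono[OF md(3)]) simp
  then have "v (x + - (x - of_int m / of_int d)) = v x" by (rule v_add_eq(2)[OF assms])
  then have k: "v x = k" using dyadD(3)[OF c] by simp
  have "dyad (of_int m / of_int d + (x - of_int m / of_int d)) k (m' * d')"
    by (rule dyad_perturb[OF c]) (use md(3) k in simp)
  then show thesis using that k by simp
qed

text \<open>Newton's iteration \<open>r \<mapsto> (r + t / r) / 2\<close> from \<open>r = 1\<close>: a correction \<open>d\<close> of valuation at least \<open>k + 2\<close>
  leaves the error \<open>d\<^sup>2\<close>. Keeping one more digit per step is enough.\<close>
lemma newton_root:
  assumes t: "vge 3 (t - 1)"
  shows "\<exists>r. vge 2 (r - 1) \<and> vge (int k + 3) (r * r - t)"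
proof (induction k)
  case 0
  show ?case using vge_uminus[OF t] by (intro exI[of _ 1]) simp
next
  case (Suc k)
  then obtain r where r: "vge 2 (r - 1)" "vge (int k + 3) (r * r - t)" by blast
  have u: "r \<noteq> 0" "v r = 0" "r \<in> F" using unit_plus[of 1 "r - 1"] vge_mono[OF r(1)] by simp_all
  define d where "d = (t - r * r) * inverse (2 * r)"
  have "v (2 * r) = 1" using u by (simp add: v_mult v_two)
  then have "vge (- 1) (inverse (2 * r))" using u v_inverse[of "2 * r"]
    by (simp add: vge_def del: inverse_mult_distrib)
  moreover have "vge (int k + 3) (t - r * r)" using vge_uminus[OF r(2)] by simp
  ultimately have d: "vge (int k + 2) d" unfolding d_def using vge_mult[of "int k + 3" "t - r * r" "-1" "inverse (2 * r)"]
    by (simp add: add.commute del: inverse_mult_distrib)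
  have "(r + d) * (r + d) - t = d * d" using u(1) by (simp add: d_def field_simps)
  moreover have "vge (int (Suc k) + 3) (d * d)" by (rule vge_mono[OF vge_mult[OF d d]]) simp
  moreover have "vge 2 (r + d - 1)" using vge_add[OF r(1) vge_mono[OF d]] by (simp add: algebra_simps)
  ultimately show ?case by (intro exI[of _ "r + d"]) simp
qed

lemma two_powi_less_iff: "(2::real) powi a < 2 powi b \<longleftrightarrow> a < b"
  using power_int_strict_increasing[of a b "2::real"] power_int_increasing[of b a "2::real"]
  by (cases "a < b") simp_all

lemma abs_less_iff_vge: "x \<in> F \<Longrightarrow> place_abs K (Finite_Place v) x < 2 powi (- k) \<longleftrightarrow> vge (k + 1) x"
  by (auto simp: vge_def two_powi_less_iff)

lemma quarter_powi: "1/4 * (2::real) powi (- (k + k)) = 2 powi (- (2 * k + 2))"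
proof -
  have "(2::real) powi (- (k + k) + (- 2)) = 2 powi (- (k + k)) * 2 powi (- 2)"
    by (rule power_int_add) simp
  moreover have "- (k + k) + (- 2) = - (2 * k + 2)" by simp
  moreover have "(2::real) powi (- 2) = 1/4" by (simp add: power_int_minus)
  ultimately show ?thesis by simp
qed

lemma valued: "valued_type_subfield F (Finite_Place v) (1/4) (1/2) {r. vge 2 (r - 1)}"
proof unfold_locales
  fix x y assume xy: "x \<in> F" "y \<in> F"
  show "place_abs K (Finite_Place v) (x * y) = place_abs K (Finite_Place v) x * place_abs K (Finite_Place v) y"
    using xy power_int_add[of "2::real" "- v x" "- v y"] by (simp add: v_mult)
  show "place_abs K (Finite_Place v) (x + y) \<le> place_abs K (Finite_Place v) x + place_abs K (Finite_Place v) y"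
  proof (cases "x = 0 \<or> y = 0 \<or> x + y = 0")
    case False
    have "(2::real) powi (- v (x + y)) \<le> 2 powi (- min (v x) (v y))"
      using v_add[of x y] False xy by (intro power_int_increasing) auto
    also have "\<dots> \<le> 2 powi (- v x) + 2 powi (- v y)" by (simp add: min_def)
    finally show ?thesis using False by simp
  qed auto
next
  fix t assume t: "t \<in> F" "place_abs K (Finite_Place v) (t - 1) < 1 / 4"
  fix \<epsilon> :: real assume \<epsilon>: "\<epsilon> > 0"
  have "(2::real) powi (- 2) = 1/4" by (simp add: power_int_minus)
  then have "vge 3 (t - 1)" using t abs_less_iff_vge[of "t - 1" 2] by simp
  obtain k where k: "(1/2) ^ k < \<epsilon>" using real_arch_pow_inv[OF \<epsilon>, of "1/2"] by auto
  obtain r where r: "vge 2 (r - 1)" "vge (int k + 3) (r * r - t)"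
    using newton_root[OF \<open>vge 3 (t - 1)\<close>] by blast
  have rF: "r \<in> F" using add_mem[OF vge_mem[OF r(1)] one_mem] by simp
  have "place_abs K (Finite_Place v) (r * r - t) < 2 powi (- int k)"
    using abs_less_iff_vge[of "r * r - t" "int k"] vge_mono[OF r(2)] rF t(1) by simp
  also have "\<dots> = (1/2) ^ k" by (simp add: power_int_minus power_one_over field_simps)
  finally show "\<exists>r\<in>F. r \<in> {r. vge 2 (r - 1)} \<and> place_abs K (Finite_Place v) (r * r - t) < \<epsilon>"
    using k r rF by (intro bexI[of _ r]) auto
next
  fix r s assume rs: "r \<in> F" "s \<in> F" "r \<in> {r. vge 2 (r - 1)}" "s \<in> {r. vge 2 (r - 1)}"
  then have "vge 2 ((r - 1) + (s - 1))" by (intro vge_add) simp_all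
  then have "2 + ((r - 1) + (s - 1)) \<noteq> 0" "v (2 + ((r - 1) + (s - 1))) = 1"
    using v_add_eq[of 2 "(r - 1) + (s - 1)"] v_two by simp_all
  then show "1 / 2 \<le> place_abs K (Finite_Place v) (r + s)" by (simp add: algebra_simps)
qed auto

sublocale valued_type_subfield F "Finite_Place v" "1/4" "1/2" "{r. vge 2 (r - 1)}"
  by (rule valued)

lemma local_square_iff_dyad: "local_square x \<longleftrightarrow> (\<exists>k n. dyad x (2 * k) n \<and> n mod 8 = 1)"
proof
  assume "local_square x"
  then obtain y where y: "x \<in> F" "y \<in> F" "y \<noteq> 0" "N (x - y * y) < 1/4 * N (y * y)"
    unfolding local_square_def by blast
  obtain n where n: "dyad y (v y) n" using dyad_exists[OF y(2,3)] .
  have "1/4 * N (y * y) = 2 powi (- (2 * v y + 2))"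
    using y(2,3) quarter_powi[of "v y"] by (simp add: v_mult)
  then have "vge (2 * v y + 3) (x - y * y)"
    using y abs_less_iff_vge[of "x - y * y" "2 * v y + 2"] by (simp add: algebra_simps)
  moreover have "dyad (y * y) (2 * v y) (n * n)" using dyad_mult[OF n n] by simp
  ultimately have "dyad (y * y + (x - y * y)) (2 * v y) (n * n)" by (intro dyad_perturb) simp_all
  moreover have "n * n mod 8 = 1"
  proof -
    have "n mod 8 = 1 \<or> n mod 8 = 3 \<or> n mod 8 = 5 \<or> n mod 8 = 7" using dyadD(4)[OF n] by presburger
    moreover have "n * n mod 8 = ((n mod 8) * (n mod 8)) mod 8" by (simp add: mod_mult_eq)
    ultimately show ?thesis by auto
  qed
  ultimately show "\<exists>k n. dyad x (2 * k) n \<and> n mod 8 = 1" by auto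
next
  assume "\<exists>k n. dyad x (2 * k) n \<and> n mod 8 = 1"
  then obtain k n where kn: "dyad x (2 * k) n" "n mod 8 = 1" by blast
  then have "dyad x (2 * k) 1" using dyad_cong[OF kn(1), of 1] by (simp add: cong_def)
  then obtain e where e: "vge 3 e" "x = 2 powi (2 * k) * (1 + e)" by (auto simp: dyad_def)
  define y :: 'a where "y = 2 powi k"
  have y: "y \<in> F" "y \<noteq> 0" "v y = k" by (simp_all add: y_def v_powi v_two)
  have yy: "y * y = 2 powi (2 * k)" by (simp add: y_def power_int_add[symmetric])
  have "x - y * y = 2 powi (2 * k) * e" using e(2) yy by (simp add: algebra_simps)
  moreover have "vge (2 * k) (2 powi (2 * k))" by (simp add: vge_def v_powi v_two)
  ultimately have "vge (2 * k + 3) (x - y * y)" using vge_mult[OF _ e(1)] by simp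
  then have "N (x - y * y) < 2 powi (- (2 * k + 2))"
    using abs_less_iff_vge[of "x - y * y" "2 * k + 2"] dyadD(1)[OF kn(1)] y(1) by (simp add: algebra_simps)
  also have "2 powi (- (2 * k + 2)) = 1/4 * N (y * y)"
    using y quarter_powi[of k] by (simp add: v_mult)
  finally show "local_square x" using dyadD[OF kn(1)] y unfolding local_square_def by blast
qed

lemma odd_mod_8_int: assumes "odd (n::int)" shows "n mod 8 = 1 \<or> n mod 8 = 3 \<or> n mod 8 = 5 \<or> n mod 8 = 7"
  using assms by presburger

lemma local_square_mult: assumes "local_square x" "local_square y" shows "local_square (x * y)"
proof -
  obtain k n where x: "dyad x (2 * k) n" "n mod 8 = 1" using assms(1) local_square_iff_dyad by blast
  obtain l m where y: "dyad y (2 * l) m" "m mod 8 = 1" using assms(2) local_square_iff_dyad by blast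
  have "dyad (x * y) (2 * (k + l)) (n * m)" using dyad_mult[OF x(1) y(1)] by (simp add: algebra_simps)
  moreover have "n * m mod 8 = 1" using x(2) y(2) mod_mult_eq[of n 8 m] by simp
  ultimately show ?thesis using local_square_iff_dyad by blast
qed

lemma local_square_cancel: assumes "local_square (x * y)" "local_square x" "y \<in> F" "y \<noteq> 0" shows "local_square y"
proof -
  obtain k n where x: "dyad x (2 * k) n" "n mod 8 = 1" using assms(2) local_square_iff_dyad by blast
  obtain m where y: "dyad y (v y) m" using dyad_exists[OF assms(3,4)] .
  obtain l q where xy: "dyad (x * y) (2 * l) q" "q mod 8 = 1" using assms(1) local_square_iff_dyad by blast
  have e: "2 * k + v y = 2 * l" "[n * m = q] (mod 8)" using dyad_unique[OF dyad_mult[OF x(1) y] xy(1)] by simp_all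
  have "n * m mod 8 = (n mod 8) * m mod 8" by (simp add: mod_mult_left_eq)
  then have "m mod 8 = 1" using e(2) xy(2) x(2) by (simp add: cong_def)
  moreover have "v y = 2 * (l - k)" using e(1) by simp
  ultimately show ?thesis using y local_square_iff_dyad by metis
qed

section \<open>The Kummer image at a 2-adic place\<close>

text \<open>The conditions on the first and the second entry of a local Kummer value: as a class modulo squares of \<open>\<rat>\<^sub>2\<close>, the
  first entry is one of \<open>1, 2, 5, 10\<close> and the second is one of \<open>1, -1\<close>.\<close>
definition first_cond :: "'a \<Rightarrow> bool" where
  "first_cond x \<longleftrightarrow> (\<exists>k n. dyad x k n \<and> n mod 4 = 1)"

definition second_cond :: "'a \<Rightarrow> bool" where
  "second_cond x \<longleftrightarrow> (\<exists>k n. dyad x (2 * k) n \<and> (n mod 8 = 1 \<or> n mod 8 = 7))"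

lemma first_cond_mult: assumes "first_cond x" "first_cond y" shows "first_cond (x * y)"
proof -
  obtain k n where x: "dyad x k n" "n mod 4 = 1" using assms(1) first_cond_def by blast
  obtain l m where y: "dyad y l m" "m mod 4 = 1" using assms(2) first_cond_def by blast
  have "n * m mod 4 = 1" using x(2) y(2) mod_mult_eq[of n 4 m] by simp
  then show ?thesis using dyad_mult[OF x(1) y(1)] first_cond_def by blast
qed

lemma first_cond_cancel:
  assumes "first_cond (x * y)" "first_cond x" "y \<in> F" "y \<noteq> 0" shows "first_cond y"
proof -
  obtain k n where x: "dyad x k n" "n mod 4 = 1" using assms(2) first_cond_def by blast
  obtain m where y: "dyad y (v y) m" using dyad_exists[OF assms(3,4)] .
  obtain l q where xy: "dyad (x * y) l q" "q mod 4 = 1" using assms(1) first_cond_def by blast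
  have "[n * m = q] (mod 8)" using dyad_unique[OF dyad_mult[OF x(1) y] xy(1)] by simp
  then have "[n * m = q] (mod 4)" by (rule cong_dvd_modulus) simp
  moreover have "n * m mod 4 = (n mod 4) * m mod 4" by (simp add: mod_mult_left_eq)
  ultimately have "m mod 4 = 1" using xy(2) x(2) by (simp add: cong_def)
  then show ?thesis using y first_cond_def by blast
qed

lemma second_cond_mult: assumes "second_cond x" "second_cond y" shows "second_cond (x * y)"
proof -
  obtain k n where x: "dyad x (2 * k) n" "n mod 8 = 1 \<or> n mod 8 = 7" using assms(1) second_cond_def by blast
  obtain l m where y: "dyad y (2 * l) m" "m mod 8 = 1 \<or> m mod 8 = 7" using assms(2) second_cond_def by blast
  have "dyad (x * y) (2 * (k + l)) (n * m)" using dyad_mult[OF x(1) y(1)] by (simp add: algebra_simps)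
  moreover have "n * m mod 8 = 1 \<or> n * m mod 8 = 7"
    using x(2) y(2) mod_mult_eq[of n 8 m, symmetric] by auto
  ultimately show ?thesis using second_cond_def by blast
qed

lemma second_cond_cancel:
  assumes "second_cond (x * y)" "second_cond x" "y \<in> F" "y \<noteq> 0" shows "second_cond y"
proof -
  obtain k n where x: "dyad x (2 * k) n" "n mod 8 = 1 \<or> n mod 8 = 7" using assms(2) second_cond_def by blast
  obtain m where y: "dyad y (v y) m" using dyad_exists[OF assms(3,4)] .
  obtain l q where xy: "dyad (x * y) (2 * l) q" "q mod 8 = 1 \<or> q mod 8 = 7" using assms(1) second_cond_def by blast
  have e: "2 * k + v y = 2 * l" "[n * m = q] (mod 8)" using dyad_unique[OF dyad_mult[OF x(1) y] xy(1)] by simp_all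
  have nm: "n * m mod 8 = ((n mod 8) * (m mod 8)) mod 8" by (simp add: mod_mult_eq)
  have "m mod 8 = 1 \<or> m mod 8 = 7"
    using e(2) xy(2) x(2) odd_mod_8_int[OF dyadD(4)[OF y]] nm unfolding cong_def by (elim disjE) simp_all
  moreover have "v y = 2 * (l - k)" using e(1) by simp
  ultimately show ?thesis using y second_cond_def by metis
qed

lemma local_square_conds: assumes "local_square x" shows "first_cond x" "second_cond x"
proof -
  obtain k n where x: "dyad x (2 * k) n" "n mod 8 = 1" using assms local_square_iff_dyad by blast
  have "n mod 4 = 1" using x(2) by presburger
  then show "first_cond x" "second_cond x" using x first_cond_def second_cond_def by blast+
qed

text \<open>Let \<open>(a + 1) a (a - 1)\<close> be a square. If \<open>v a \<noteq> 0\<close>, then \<open>v a\<close> is even, so \<open>a\<close> or \<open>1 / a\<close> is divisible by 4 and the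
  residues modulo 8 of the three factors can be compared. If \<open>v a = 0\<close>, then one of \<open>a - 1\<close> and \<open>a + 1\<close> has valuation 1
  and the other one odd valuation at least 3, which forces \<open>a \<equiv> \<plusminus>1 (mod 8)\<close>.\<close>
lemma kummer_values_conds:
  assumes a: "(a1, a2, a3) \<in> kummer_values"
  shows "first_cond a1" "second_cond a2"
proof -
  have one: "dyad 1 (2 * 0) 1" using dyad_dyadic_frac[of 1 1 0] by simp
  have minus_one: "dyad (-1) (2 * 0) (-1)" using dyad_dyadic_frac[of "-1" 1 0] by simp
  have two: "dyad 2 1 1" using dyad_dyadic_frac[of 1 1 1] by simp
  have known: "first_cond 1" "first_cond 2" "second_cond 1" "second_cond (-1)"
  proof -
    show "first_cond 1" "first_cond 2" using one two unfolding first_cond_def by force+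
    have "(1::int) mod 8 = 1" "(-1::int) mod 8 = 7" by simp_all
    then show "second_cond 1" "second_cond (-1)" using one minus_one unfolding second_cond_def by blast+
  qed
  have "first_cond (a + 1) \<and> second_cond a" if a: "a \<in> F" "local_square ((a + 1) * a * (a - 1))" for a
  proof -
    have nz: "a + 1 \<noteq> 0" "a \<noteq> 0" "a - 1 \<noteq> 0" using local_square_mem[OF a(2)] by auto
    have aF: "a + 1 \<in> F" "a - 1 \<in> F" using a(1) by simp_all
    obtain K N' where sq: "dyad ((a + 1) * a * (a - 1)) (2 * K) N'" "N' mod 8 = 1"
      using a(2) local_square_iff_dyad by blast
    have prod: "k + l + h = 2 * K \<and> n * m * q mod 8 = 1"
      if "dyad (a + 1) k n" "dyad a l m" "dyad (a - 1) h q" for k l h n m q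
      using dyad_unique[OF dyad_mult[OF dyad_mult[OF that(1,2)] that(3)] sq(1)] sq(2)
      by (simp add: cong_def)
    obtain u where u: "dyad a (v a) u" using dyad_exists[OF a(1) nz(2)] .
    obtain e where e: "odd u" "vge 3 e" "a = 2 powi (v a) * (of_int u + e)" using u by (auto simp: dyad_def)
    have red: "n * m * q mod 8 = ((n mod 8) * (m mod 8) * (q mod 8)) mod 8" for n m q :: int
      by (metis mod_mult_eq mod_mult_left_eq)
    consider "v a < 0" | "v a > 0" | "v a = 0" by linarith
    then show ?thesis
    proof cases
      case 1
      define t where "t = (2::int) ^ nat (- v a)"
      have t2: "2 powi (v a) * of_int t = (1::'a)"
        using 1 unfolding t_def by (simp add: power_int_def flip: power_mult_distrib)
      have et: "even t" using 1 by (simp add: t_def)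
      have ap: "dyad (a + 1) (v a) (u + t)" "dyad (a - 1) (v a) (u - t)"
      proof -
        have "a + 1 = 2 powi (v a) * (of_int (u + t) + e)" "a - 1 = 2 powi (v a) * (of_int (u - t) + e)"
          by (subst e(3), simp add: t2[symmetric] algebra_simps)+
        then show "dyad (a + 1) (v a) (u + t)" "dyad (a - 1) (v a) (u - t)"
          unfolding dyad_def using e(1,2) et by auto
      qed
      have p: "v a + v a + v a = 2 * K" "(u + t) * u * (u - t) mod 8 = 1"
        using prod[OF ap(1) u ap(2)] by simp_all
      have ev: "even (v a)" using p(1) by presburger
      then have "- v a \<ge> 2" using 1 by presburger
      then have "nat (- v a) \<ge> 2" by simp
      then have "2 ^ 2 dvd t" unfolding t_def by (rule le_imp_power_dvd)
      then have "4 dvd t" by simp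
      then have t4: "t mod 8 = 0 \<or> t mod 8 = 4" by presburger
      have um: "u mod 8 = 1 \<or> u mod 8 = 3 \<or> u mod 8 = 5 \<or> u mod 8 = 7" by (rule odd_mod_8_int[OF e(1)])
      have s: "(u + t) mod 8 = ((u mod 8) + (t mod 8)) mod 8" "(u - t) mod 8 = ((u mod 8) - (t mod 8)) mod 8"
        by (simp_all add: mod_add_eq mod_diff_eq)
      have "u mod 8 = 1"
        using p(2) um t4 unfolding red[of "u + t"] s by (elim disjE) simp_all
      moreover have "(u + t) mod 4 = 1" using \<open>u mod 8 = 1\<close> t4 by presburger
      ultimately show ?thesis using ap(1) u ev unfolding first_cond_def second_cond_def
        by (metis evenE)
    next
      case 2
      define t where "t = (2::int) ^ nat (v a) * u"
      define e' where "e' = 2 ^ nat (v a) * e"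
      have "2 powi (v a) * (of_int u + e) = of_int t + e'"
        using 2 unfolding t_def e'_def by (simp add: power_int_def algebra_simps)
      then have at: "a = of_int t + e'" using e(3) by (rule trans[rotated])
      have et: "even t" using 2 by (simp add: t_def)
      have "vge 0 (2 ^ nat (v a))" using vge_of_int[of "2 ^ nat (v a)"] by simp
      from vge_mult[OF this e(2)] have e3: "vge 3 e'" by (simp add: e'_def)
      have ap: "dyad (a + 1) 0 (t + 1)" "dyad (a - 1) 0 (t - 1)"
        unfolding dyad_def using et e3 at
        by (intro conjI exI[of _ e'], simp_all add: algebra_simps)+
      have p: "v a = 2 * K" "(t + 1) * u * (t - 1) mod 8 = 1"
        using prod[OF ap(1) u ap(2)] by simp_all
      have "v a \<ge> 2" using 2 p(1) by presburger
      then have "nat (v a) \<ge> 2" by simp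
      then have "2 ^ 2 dvd (2::int) ^ nat (v a)" by (rule le_imp_power_dvd)
      then have "2 ^ 2 dvd t" unfolding t_def by (rule dvd_mult2)
      then have "4 dvd t" by simp
      then have t4: "t mod 8 = 0 \<or> t mod 8 = 4" by presburger
      have um: "u mod 8 = 1 \<or> u mod 8 = 3 \<or> u mod 8 = 5 \<or> u mod 8 = 7" by (rule odd_mod_8_int[OF e(1)])
      have s: "(t + 1) mod 8 = ((t mod 8) + 1) mod 8" "(t - 1) mod 8 = ((t mod 8) - 1) mod 8"
        by (simp_all add: mod_add_left_eq mod_diff_left_eq)
      have "u mod 8 = 7"
        using p(2) um t4 unfolding red[of "t + 1"] s by (elim disjE) simp_all
      moreover have "(t + 1) mod 4 = 1" using t4 by presburger
      ultimately show ?thesis using ap(1) u p(1) unfolding first_cond_def second_cond_def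
        by metis
    next
      case 3
      have ae: "a = of_int u + e" using e(3) 3 by simp
      have "u mod 4 = 1 \<or> u mod 4 = 3" using e(1) by presburger
      then consider "u mod 4 = 1" | "u mod 4 = 3" by (elim disjE)
      then show ?thesis
      proof cases
        case 1
        obtain w where w: "dyad (a - 1) (v (a - 1)) w" using dyad_exists[OF aF(2) nz(3)] .
        obtain f where f: "odd w" "vge 3 f" "a - 1 = 2 powi (v (a - 1)) * (of_int w + f)"
          using w by (auto simp: dyad_def)
        define k where "k = nat (v (a - 1))"
        have "4 dvd u - 1" using 1 by presburger
        then have "2 ^ 2 dvd u - 1" by simp
        then have "vge 2 (of_int (u - 1))" using vge_of_int_iff[of 2 "u - 1"] by simp
        then have "vge 2 (of_int (u - 1) + e)" using vge_mono[OF e(2)] by (intro vge_add) simp_all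
        then have "v (a - 1) \<ge> 2" using nz(3) by (simp add: vge_def ae algebra_simps)
        then have k: "v (a - 1) = int k" "k \<ge> 2" by (simp_all add: k_def)
        define t where "t = 2 ^ (k - 1) * w"
        have k1: "(2::'a) ^ k = 2 * 2 ^ (k - 1)" "(2::int) ^ k = 2 * 2 ^ (k - 1)" using k(2) by (cases k; simp)+
        have am: "a - 1 = of_int (2 * t) + 2 ^ k * f" using f(3) k(1) k1 by (simp add: t_def algebra_simps)
        have f3: "vge 3 (2 ^ (k - 1) * f)" using vge_mult[OF vge_of_int[of "2 ^ (k - 1)"] f(2)] by simp
        have et: "even t" using k(2) by (simp add: t_def)
        have ap: "dyad (a + 1) 1 (t + 1)"
          unfolding dyad_def using et f3 k1 am
          by (intro conjI exI[of _ "2 ^ (k - 1) * f"]) (simp_all add: algebra_simps)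
        have p: "1 + 0 + int k = 2 * K" "(t + 1) * u * w mod 8 = 1"
          using prod[OF ap u w] 3 k by simp_all
        have k3: "k - 1 \<ge> 2" using p(1) k(2) by presburger
        then have "2 ^ 2 dvd (2::int) ^ (k - 1)" by (rule le_imp_power_dvd)
        then have t4: "4 dvd t" unfolding t_def by simp
        have "vge 3 (2 ^ k * f)" using vge_mult[OF vge_of_int[of "2 ^ k"] f(2)] by simp
        then have "dyad a 0 (2 * t + 1)"
          unfolding dyad_def using am by (intro conjI exI[of _ "2 ^ k * f"]) (simp_all add: algebra_simps)
        moreover have "(2 * t + 1) mod 8 = 1" using t4 by presburger
        moreover have "(t + 1) mod 4 = 1" using t4 by presburger
        ultimately show ?thesis using ap unfolding first_cond_def second_cond_def
          by (metis mult_zero_right)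
      next
        case 2
        obtain w where w: "dyad (a + 1) (v (a + 1)) w" using dyad_exists[OF aF(1) nz(1)] .
        obtain f where f: "odd w" "vge 3 f" "a + 1 = 2 powi (v (a + 1)) * (of_int w + f)"
          using w by (auto simp: dyad_def)
        define k where "k = nat (v (a + 1))"
        have "4 dvd u + 1" using 2 by presburger
        then have "2 ^ 2 dvd u + 1" by simp
        then have "vge 2 (of_int (u + 1))" using vge_of_int_iff[of 2 "u + 1"] by simp
        then have "vge 2 (of_int (u + 1) + e)" using vge_mono[OF e(2)] by (intro vge_add) simp_all
        then have "v (a + 1) \<ge> 2" using nz(1) by (simp add: vge_def ae algebra_simps)
        then have k: "v (a + 1) = int k" "k \<ge> 2" by (simp_all add: k_def)
        define t where "t = 2 ^ (k - 1) * w"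
        have k1: "(2::'a) ^ k = 2 * 2 ^ (k - 1)" "(2::int) ^ k = 2 * 2 ^ (k - 1)" using k(2) by (cases k; simp)+
        have am: "a + 1 = of_int (2 * t) + 2 ^ k * f" using f(3) k(1) k1 by (simp add: t_def algebra_simps)
        then have am': "a = of_int (2 * t) + 2 ^ k * f - 1" by (simp add: algebra_simps)
        have f3: "vge 3 (2 ^ (k - 1) * f)" using vge_mult[OF vge_of_int[of "2 ^ (k - 1)"] f(2)] by simp
        have et: "even t" using k(2) by (simp add: t_def)
        have ap: "dyad (a - 1) 1 (t - 1)"
          unfolding dyad_def using et f3 k1 am'
          by (intro conjI exI[of _ "2 ^ (k - 1) * f"]) (simp_all add: algebra_simps)
        have p: "int k + 0 + 1 = 2 * K" "w * u * (t - 1) mod 8 = 1"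
          using prod[OF w u ap] 3 k by simp_all
        have k3: "k - 1 \<ge> 2" using p(1) k(2) by presburger
        then have "2 ^ 2 dvd (2::int) ^ (k - 1)" by (rule le_imp_power_dvd)
        then have t4: "4 dvd t" unfolding t_def by simp
        have "vge 3 (2 ^ k * f)" using vge_mult[OF vge_of_int[of "2 ^ k"] f(2)] by simp
        then have a7: "dyad a 0 (2 * t - 1)"
          unfolding dyad_def using am' by (intro conjI exI[of _ "2 ^ k * f"]) (simp_all add: algebra_simps)
        have t7: "(2 * t - 1) mod 8 = 7" using t4 by presburger
        have u7: "u mod 8 = 7" using dyad_unique(2)[OF a7 u[unfolded 3]] t7 by (simp add: cong_def)
        have tm: "(t - 1) mod 8 = 7 \<or> (t - 1) mod 8 = 3" using t4 by presburger
        have "w mod 8 = 1 \<or> w mod 8 = 5"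
          using p(2) u7 tm odd_mod_8_int[OF f(1)] unfolding red[of w] by (elim disjE) simp_all
        then have "w mod 4 = 1" by presburger
        then show ?thesis using a7 t7 w unfolding first_cond_def second_cond_def
          by (metis mult_zero_right)
      qed
    qed
  qed
  then show "first_cond a1" "second_cond a2" using a known unfolding kummer_values_def by auto
qed

text \<open>All eight pairs allowed by the two conditions occur. Points of order 2 and infinity realise the pairs with
  first entry \<open>1\<close> or \<open>2\<close>; multiplication of the first entry by 5 is achieved by points with \<open>x\<close>-coordinates \<open>1/4\<close>,
  \<open>-4\<close>, \<open>-5/3\<close> and \<open>3/5\<close>, at which \<open>x\<^sup>3 - x\<close> is a 2-adic square.\<close>
lemma kummer_values_exhaust:
  assumes "x \<in> F" "y \<in> F" "first_cond x" "second_cond y"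
  obtains a1 a2 a3 where "(a1, a2, a3) \<in> kummer_values" "local_square (x * a1)" "local_square (y * a2)" "local_square (a1 * a2 * a3)"
proof -
  obtain k n where x: "dyad x k n" "n mod 4 = 1" using assms(3) first_cond_def by blast
  obtain l m where y: "dyad y (2 * l) m" "m mod 8 = 1 \<or> m mod 8 = 7" using assms(4) second_cond_def by blast
  have n8: "n mod 8 = 1 \<or> n mod 8 = 5" using x(2) by presburger
  have X: "local_square (x * a)" if "dyad a h q" "even (k + h)" "(n mod 8) * (q mod 8) mod 8 = 1" for a h q
    using dyad_mult[OF x(1) that(1)] that(2,3) unfolding local_square_iff_dyad
    by (metis evenE mod_mult_eq)
  have Y: "local_square (y * a)" if "dyad a h q" "even h" "(m mod 8) * (q mod 8) mod 8 = 1" for a h q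
    using dyad_mult[OF y(1) that(1)] that(2,3) unfolding local_square_iff_dyad
    by (metis dvd_triv_left evenE even_add mod_mult_eq)
  have Z: "local_square a" if "dyad a h q" "even h" "q mod 8 = 1" for a h q
    using that unfolding local_square_iff_dyad by (metis evenE)
  note frac = dyad_dyadic_frac
  have d: "dyad 1 0 1" "dyad (-1) 0 (-1)" "dyad 2 1 1" "dyad 4 2 1"
    using frac[of 1 1 0] frac[of "-1" 1 0] frac[of 1 1 1] frac[of 1 1 2] by simp_all
  have quarter: "dyad (5/4) (-2) 5" "dyad (1/4) (-2) 1" "dyad ((1/4 + 1) * (1/4) * (1/4 - 1)) (-6) (-15)"
    using frac[of 5 1 "-2"] frac[of 1 1 "-2"] frac[of "-15" 1 "-6"] by (simp_all add: power_int_minus)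
  have three_fifths: "dyad (8/5) 3 5" "dyad (3/5) 0 15" "dyad ((3/5 + 1) * (3/5) * (3/5 - 1)) 4 (-375)"
    using frac[of 1 5 3] frac[of 3 5 0] frac[of "-3" 125 4] by simp_all
  have minus_four: "dyad (-3) 0 (-3)" "dyad (-4) 2 (-1)" "dyad ((-4 + 1) * (-4) * (-4 - 1)) 2 (-15)"
    using frac[of "-3" 1 0] frac[of "-1" 1 2] frac[of "-15" 1 2] by simp_all
  have minus_five_thirds: "dyad (-2/3) 1 (-3)" "dyad (-5/3) 0 (-15)" "dyad ((-5/3 + 1) * (-5/3) * (-5/3 - 1)) 4 (-135)"
    using frac[of "-1" 3 1] frac[of "-5" 3 0] frac[of "-5" 27 4] by simp_all
  have kv: "(a + 1, a, a - 1) \<in> kummer_values" if "a \<in> F" "local_square ((a + 1) * a * (a - 1))" for a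
    using that by (auto simp: kummer_values_def)
  have n1: "(- 15) mod 8 = (1::int)" "(- 375) mod 8 = (1::int)" "(- 135) mod 8 = (1::int)" by simp_all
  have kt: "(1, 1, 1) \<in> kummer_values" "(2, -1, -2) \<in> kummer_values" "(1, -1, -1) \<in> kummer_values" "(2, 1, 2) \<in> kummer_values"
    by (simp_all add: kummer_values_def)
  show thesis
  proof (cases "even k")
    case True
    show thesis
    proof (cases "n mod 8 = 1")
      case n: True
      show thesis
      proof (cases "m mod 8 = 1")
        case m: True
        show thesis
        proof (rule that[OF kt(1)])
          show "local_square (x * 1)" using X[OF d(1)] True n by simp
          show "local_square (y * 1)" using Y[OF d(1)] m by simp
          show "local_square (1 * 1 * 1)" using Z[OF d(1)] by simp
        qed
      next
        case m: False
        show thesis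
        proof (rule that[OF kt(3)])
          show "local_square (x * 1)" using X[OF d(1)] True n by simp
          show "local_square (y * -1)" using Y[OF d(2)] y(2) m by simp
          show "local_square (1 * -1 * -1)" using Z[OF d(1)] by simp
        qed
      qed
    next
      case n: False
      show thesis
      proof (cases "m mod 8 = 1")
        case m: True
        show thesis
        proof (rule that[OF kv[of "1/4"]])
          show c: "local_square ((1/4 + 1) * (1/4) * (1/4 - 1))" by (rule Z[OF quarter(3)]) (simp_all add: n1)
          then show "local_square ((1/4 + 1) * (1/4) * (1/4 - 1))" .
          show "local_square (x * (1/4 + 1))" using X[OF quarter(1)] True n n8 by simp
          show "local_square (y * (1/4))" using Y[OF quarter(2)] m by simp
        qed simp
      next
        case m: False
        show thesis
        proof (rule that[OF kv[of "-4"]])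
          show c: "local_square ((-4 + 1) * (-4) * (-4 - 1))" by (rule Z[OF minus_four(3)]) (simp_all add: n1)
          then show "local_square ((-4 + 1) * (-4) * (-4 - 1))" .
          show "local_square (x * (-4 + 1))" using X[OF minus_four(1)] True n n8 by simp
          show "local_square (y * (-4))" using Y[OF minus_four(2)] m y(2) by simp
        qed simp
      qed
    qed
  next
    case False
    show thesis
    proof (cases "n mod 8 = 1")
      case n: True
      show thesis
      proof (cases "m mod 8 = 1")
        case m: True
        show thesis
        proof (rule that[OF kt(4)])
          show "local_square (x * 2)" using X[OF d(3)] False n by simp
          show "local_square (y * 1)" using Y[OF d(1)] m by simp
          show "local_square (2 * 1 * 2)" using Z[OF d(4)] by simp
        qed
      next
        case m: False
        show thesis
        proof (rule that[OF kt(2)])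
          show "local_square (x * 2)" using X[OF d(3)] False n by simp
          show "local_square (y * -1)" using Y[OF d(2)] y(2) m by simp
          show "local_square (2 * -1 * -2)" using Z[OF d(4)] by simp
        qed
      qed
    next
      case n: False
      show thesis
      proof (cases "m mod 8 = 1")
        case m: True
        show thesis
        proof (rule that[OF kv[of "-5/3"]])
          show c: "local_square ((-5/3 + 1) * (-5/3) * (-5/3 - 1))" by (rule Z[OF minus_five_thirds(3)]) (simp_all add: n1)
          then show "local_square ((-5/3 + 1) * (-5/3) * (-5/3 - 1))" .
          show "local_square (x * (-5/3 + 1))" using X[OF minus_five_thirds(1)] False n n8 by simp
          show "local_square (y * (-5/3))" using Y[OF minus_five_thirds(2)] m by simp
        qed simp
      next
        case m: False
        show thesis
        proof (rule that[OF kv[of "3/5"]])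
          show c: "local_square ((3/5 + 1) * (3/5) * (3/5 - 1))" by (rule Z[OF three_fifths(3)]) (simp_all add: n1)
          then show "local_square ((3/5 + 1) * (3/5) * (3/5 - 1))" .
          show "local_square (x * (3/5 + 1))" using X[OF three_fifths(1)] False n n8 by simp
          show "local_square (y * (3/5))" using Y[OF three_fifths(2)] m y(2) by simp
        qed simp
      qed
    qed
  qed
qed

text \<open>The third entry imposes nothing new, since the three entries of a Kummer value multiply to a square.\<close>
theorem local_image_two_adic:
  assumes "x \<in> F" "x \<noteq> 0" "y \<in> F" "y \<noteq> 0"
  shows "local_triple K (Finite_Place v) (sq_class K x, sq_class K y, sq_class K (x * y))
      \<in> kummer L ` curve_points L \<longleftrightarrow> first_cond x \<and> second_cond y"
proof -
  have xy: "x * y \<in> F" "x * y \<noteq> 0" using assms by simp_all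
  show ?thesis unfolding local_image_iff[OF assms xy]
  proof
    assume "\<exists>a1 a2 a3. (a1, a2, a3) \<in> kummer_values \<and> local_square (x * a1) \<and> local_square (y * a2) \<and> local_square (x * y * a3)"
    then obtain a1 a2 a3 where a: "(a1, a2, a3) \<in> kummer_values" "local_square (x * a1)" "local_square (y * a2)" by blast
    show "first_cond x \<and> second_cond y"
      using first_cond_cancel[of a1 x] second_cond_cancel[of a2 y] kummer_values_conds[OF a(1)]
        local_square_conds(1)[OF a(2)] local_square_conds(2)[OF a(3)] assms by (simp add: mult.commute)
  next
    assume "first_cond x \<and> second_cond y"
    then obtain a1 a2 a3 where a: "(a1, a2, a3) \<in> kummer_values" "local_square (x * a1)" "local_square (y * a2)" "local_square (a1 * a2 * a3)"
      using kummer_values_exhaust[OF assms(1,3)] by blast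
    note nz = kummer_values_nonzero[OF a(1)]
    have e: "(x * a1) * (y * a2) * (x * y * a3) = (x * y) * (x * y) * (a1 * a2 * a3)" by (simp add: mult_ac)
    have "local_square ((x * y) * (x * y))" unfolding local_square_def
      using xy \<delta> abs_pos[of "(x * y) * (x * y)"] abs_zero by (intro conjI bexI[of _ "x * y"]) simp_all
    then have "local_square ((x * a1) * (y * a2) * (x * y * a3))" unfolding e using a(4) by (rule local_square_mult)
    then have "local_square (x * y * a3)"
      using local_square_cancel[OF _ local_square_mult[OF a(2,3)]] xy nz by simp
    then show "\<exists>a1 a2 a3. (a1, a2, a3) \<in> kummer_values \<and> local_square (x * a1) \<and> local_square (y * a2) \<and> local_square (x * y * a3)"
      using a by blast
  qed
qed

end

section \<open>The Kummer image at a real place\<close>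

locale real_place = type_subfield F for F :: "'a::field_char_0 set" +
  fixes \<sigma> :: "'a \<Rightarrow> real"
  assumes embedding: "real_embedding K \<sigma>"
begin

lemma sig_mult: "x \<in> F \<Longrightarrow> y \<in> F \<Longrightarrow> \<sigma> (x * y) = \<sigma> x * \<sigma> y"
  using embedding unfolding real_embedding_def ring_hom_def by (simp add: ring_of_type_algebra_def)

lemma sig_add: "x \<in> F \<Longrightarrow> y \<in> F \<Longrightarrow> \<sigma> (x + y) = \<sigma> x + \<sigma> y"
  using embedding unfolding real_embedding_def ring_hom_def by (simp add: ring_of_type_algebra_def)

lemma sig_one [simp]: "\<sigma> 1 = 1"
  using embedding unfolding real_embedding_def ring_hom_def by (simp add: ring_of_type_algebra_def)

lemma sig_zero [simp]: "\<sigma> 0 = 0" using sig_add[of 0 0] by simp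

lemma sig_uminus: "x \<in> F \<Longrightarrow> \<sigma> (- x) = - \<sigma> x" using sig_add[of x "- x"] by simp

lemma sig_diff: "x \<in> F \<Longrightarrow> y \<in> F \<Longrightarrow> \<sigma> (x - y) = \<sigma> x - \<sigma> y"
  using sig_add[of x "- y"] sig_uminus[of y] by simp

lemma sig_eq_0_iff: assumes "x \<in> F" shows "\<sigma> x = 0 \<longleftrightarrow> x = 0"
proof
  assume "\<sigma> x = 0"
  show "x = 0"
  proof (rule ccontr)
    assume "x \<noteq> 0"
    then have "\<sigma> x * \<sigma> (inverse x) = 1" using sig_mult[of x "inverse x"] assms by simp
    then show False using \<open>\<sigma> x = 0\<close> by simp
  qed
qed simp

lemma sig_of_nat: "of_nat n \<in> F \<and> \<sigma> (of_nat n) = of_nat n"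
  by (induction n) (simp_all add: sig_add)

lemma sig_of_int: "of_int n \<in> F \<and> \<sigma> (of_int n) = of_int n"
  using sig_of_nat[of "nat n"] sig_of_nat[of "nat (- n)"] sig_uminus[of "of_nat (nat (- n))"]
    uminus_mem[of "of_nat (nat (- n))"]
  by (cases "n \<ge> 0") (simp_all add: of_nat_nat)

lemma sig_inverse: assumes "x \<in> F" shows "\<sigma> (inverse x) = inverse (\<sigma> x)"
proof (cases "x = 0")
  case False
  then have "\<sigma> x * \<sigma> (inverse x) = 1" using sig_mult[of x "inverse x"] assms by simp
  then show ?thesis by (simp add: inverse_unique)
qed simp

lemma sig_of_rat: "of_rat q \<in> F \<and> \<sigma> (of_rat q) = of_rat q"
proof -
  obtain a b where "quotient_of q = (a, b)" by (cases "quotient_of q")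
  then have q: "q = of_int a / of_int b" using quotient_of_div by blast
  have "of_rat q = (of_int a * inverse (of_int b) :: 'a)" by (simp add: q of_rat_mult of_rat_inverse divide_inverse)
  moreover have "of_rat q = (of_int a * inverse (of_int b) :: real)" by (simp add: q of_rat_mult of_rat_inverse divide_inverse)
  ultimately show ?thesis using sig_of_int sig_inverse sig_mult by simp
qed

lemma rational_between:
  assumes "a < (b::real)"
  obtains r where "r \<in> F" "a < \<sigma> r" "\<sigma> r < b"
  using of_rat_dense[OF assms] sig_of_rat by metis

lemma valued: "valued_type_subfield F (Real_Place \<sigma>) (1/2) 1 {r. \<sigma> r > 1/2}"
proof unfold_locales
  fix t assume t: "t \<in> F" "place_abs K (Real_Place \<sigma>) (t - 1) < 1 / 2"
  fix \<epsilon> :: real assume \<epsilon>: "\<epsilon> > 0"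
  have ts: "\<bar>\<sigma> t - 1\<bar> < 1/2" using t sig_diff[of t 1] by simp
  then have t2: "\<sigma> t > 1/2" by linarith
  define l where "l = max (1/2) (sqrt (max 0 (\<sigma> t - \<epsilon>)))"
  have "l < sqrt (\<sigma> t)"
  proof -
    have "(1/2)\<^sup>2 < \<sigma> t" using t2 by (simp add: power2_eq_square)
    then have "1/2 < sqrt (\<sigma> t)" by (rule real_less_rsqrt)
    moreover have "sqrt (max 0 (\<sigma> t - \<epsilon>)) < sqrt (\<sigma> t)" using \<epsilon> t2 by simp
    ultimately show ?thesis by (simp add: l_def)
  qed
  then obtain r where r: "r \<in> F" "l < \<sigma> r" "\<sigma> r < sqrt (\<sigma> t)" using rational_between by blast
  have rp: "\<sigma> r > 1/2" "sqrt (max 0 (\<sigma> t - \<epsilon>)) < \<sigma> r" using r(2) by (simp_all add: l_def)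
  have "\<sigma> r * \<sigma> r < sqrt (\<sigma> t) * sqrt (\<sigma> t)" using r(3) rp(1) t2 by (intro mult_strict_mono) auto
  then have "\<sigma> r * \<sigma> r < \<sigma> t" using t2 by simp
  moreover have "sqrt (max 0 (\<sigma> t - \<epsilon>)) * sqrt (max 0 (\<sigma> t - \<epsilon>)) < \<sigma> r * \<sigma> r"
    using rp by (intro mult_strict_mono) auto
  then have "max 0 (\<sigma> t - \<epsilon>) < \<sigma> r * \<sigma> r" by simp
  ultimately have "\<bar>\<sigma> r * \<sigma> r - \<sigma> t\<bar> < \<epsilon>" by linarith
  then show "\<exists>r\<in>F. r \<in> {r. \<sigma> r > 1/2} \<and> place_abs K (Real_Place \<sigma>) (r * r - t) < \<epsilon>"
    using r(1) rp(1) t(1) by (intro bexI[of _ r]) (simp_all add: sig_mult sig_diff)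
qed (auto simp: sig_mult sig_add sig_eq_0_iff abs_mult abs_triangle_ineq)

sublocale valued_type_subfield F "Real_Place \<sigma>" "1/2" 1 "{r. \<sigma> r > 1/2}"
  by (rule valued)

lemma local_square_iff_positive: "local_square x \<longleftrightarrow> x \<in> F \<and> \<sigma> x > 0"
proof
  assume "local_square x"
  then obtain y where y: "x \<in> F" "y \<in> F" "y \<noteq> 0" "\<bar>\<sigma> (x - y * y)\<bar> < 1/2 * \<bar>\<sigma> (y * y)\<bar>"
    unfolding local_square_def by auto
  have "\<sigma> (y * y) \<ge> 0" using y by (simp add: sig_mult)
  then have "\<sigma> x > 0" using y by (simp add: sig_diff sig_mult abs_if split: if_splits)
  then show "x \<in> F \<and> \<sigma> x > 0" using y by simp
next
  assume x: "x \<in> F \<and> \<sigma> x > 0"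
  have "sqrt (\<sigma> x * (3/4)) < sqrt (\<sigma> x)" using x by simp
  then obtain y where y: "y \<in> F" "sqrt (\<sigma> x * (3/4)) < \<sigma> y" "\<sigma> y < sqrt (\<sigma> x)" using rational_between by blast
  have "0 \<le> sqrt (\<sigma> x * (3/4))" using x by simp
  then have y0: "\<sigma> y > 0" using y(2) by (rule order.strict_trans1)
  have "\<sigma> y * \<sigma> y < sqrt (\<sigma> x) * sqrt (\<sigma> x)" using y(3) y0 x by (intro mult_strict_mono) auto
  then have u: "\<sigma> y * \<sigma> y < \<sigma> x" using x by simp
  have "sqrt (\<sigma> x * (3/4)) * sqrt (\<sigma> x * (3/4)) < \<sigma> y * \<sigma> y"
    using y(2) y0 x by (intro mult_strict_mono) auto
  then have "\<sigma> x * (3/4) < \<sigma> y * \<sigma> y" using x by simp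
  then have "\<bar>\<sigma> x - \<sigma> y * \<sigma> y\<bar> < 1/2 * \<bar>\<sigma> y * \<sigma> y\<bar>" using u y0 by (simp add: abs_if)
  then show "local_square x" using x y y0 sig_zero unfolding local_square_def
    by (intro conjI bexI[of _ y]) (auto simp: sig_diff sig_mult)
qed

text \<open>On the real curve \<open>(a + 1) a (a - 1) \<ge> 0\<close>, hence \<open>a + 1 \<ge> 0\<close>. The points at infinity and \<open>(0, 0)\<close>
  realise both signs of the second entry.\<close>
theorem local_image_real:
  assumes "x \<in> F" "x \<noteq> 0" "y \<in> F" "y \<noteq> 0"
  shows "local_triple K (Real_Place \<sigma>) (sq_class K x, sq_class K y, sq_class K (x * y))
      \<in> kummer L ` curve_points L \<longleftrightarrow> \<sigma> x > 0"
proof -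
  have xy: "x * y \<in> F" "x * y \<noteq> 0" using assms by simp_all
  have two: "2 \<in> F" "\<sigma> 2 = 2" using sig_of_nat[of 2] by simp_all
  show ?thesis unfolding local_image_iff[OF assms xy]
  proof
    assume "\<exists>a1 a2 a3. (a1, a2, a3) \<in> kummer_values \<and> local_square (x * a1) \<and> local_square (y * a2) \<and> local_square (x * y * a3)"
    then obtain a1 a2 a3 where a: "(a1, a2, a3) \<in> kummer_values" "local_square (x * a1)" by blast
    note nz = kummer_values_nonzero[OF a(1)]
    have "\<sigma> (a + 1) > 0" if "a \<in> F" "local_square ((a + 1) * a * (a - 1))" for a
    proof (rule ccontr)
      assume "\<not> \<sigma> (a + 1) > 0"
      then have le: "\<sigma> a + 1 \<le> 0" using that by (simp add: sig_add)
      have "(\<sigma> a + 1) * (\<sigma> a * (\<sigma> a - 1)) \<le> 0"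
        using le by (intro mult_nonpos_nonneg mult_nonpos_nonpos) auto
      moreover have "(\<sigma> a + 1) * \<sigma> a * (\<sigma> a - 1) > 0"
        using that local_square_iff_positive by (simp add: sig_mult sig_add sig_diff)
      ultimately show False by (simp add: mult.assoc)
    qed
    then have "\<sigma> a1 > 0" using a(1) two unfolding kummer_values_def by auto
    moreover have "\<sigma> x * \<sigma> a1 > 0" using a(2) assms nz local_square_iff_positive by (simp add: sig_mult)
    ultimately show "\<sigma> x > 0" by (simp add: zero_less_mult_iff)
  next
    assume x: "\<sigma> x > 0"
    show "\<exists>a1 a2 a3. (a1, a2, a3) \<in> kummer_values \<and> local_square (x * a1) \<and> local_square (y * a2) \<and> local_square (x * y * a3)"
    proof (cases "\<sigma> y > 0")
      case True
      have "(1, 1, 1) \<in> kummer_values" by (simp add: kummer_values_def)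
      moreover have "local_square (x * 1)" "local_square (y * 1)" "local_square (x * y * 1)"
        using x True assms by (simp_all add: local_square_iff_positive sig_mult)
      ultimately show ?thesis by blast
    next
      case False
      then have y: "\<sigma> y < 0" using sig_eq_0_iff[of y] assms by linarith
      have "(1, -1, -1) \<in> kummer_values" by (simp add: kummer_values_def)
      moreover have "local_square (x * 1)" "local_square (y * -1)" "local_square (x * y * -1)"
        using x y assms by (simp_all add: local_square_iff_positive sig_mult sig_uminus mult_pos_neg)
      ultimately show ?thesis by blast
    qed
  qed
qed

end

lemma rat_int_frac: obtains a b :: int where "b > 0" "(x::rat) = of_int a / of_int b"
proof -
  obtain a b where q: "quotient_of x = (a, b)" by (cases "quotient_of x")
  then show thesis using that[of b a] quotient_of_div[OF q] quotient_of_denom_pos[OF q] by blast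
qed

section \<open>The valuations of the rational numbers\<close>

definition rat_val :: "nat \<Rightarrow> rat \<Rightarrow> int" where
  "rat_val q x = int (multiplicity (int q) (fst (quotient_of x))) - int (multiplicity (int q) (snd (quotient_of x)))"

lemma rat_val_frac:
  fixes a b :: int
  assumes q: "Factorial_Ring.prime q" and "a \<noteq> 0" "b \<noteq> 0"
  shows "rat_val q (of_int a / of_int b) = int (multiplicity (int q) a) - int (multiplicity (int q) b)"
proof -
  have pe: "prime_elem (int q)" using q by simp
  obtain c d where cd: "quotient_of (of_int a / of_int b) = (c, d)" by (cases "quotient_of (of_int a / of_int b)")
  have e: "of_int a / of_int b = (of_int c / of_int d :: rat)" and d: "d > 0"
    using quotient_of_div[OF cd] quotient_of_denom_pos[OF cd] by blast+
  have "of_int (a * d) = (of_int (c * b) :: rat)" using e d assms by (simp add: field_simps)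
  then have ad: "a * d = c * b" by (simp only: of_int_eq_iff)
  then have "c \<noteq> 0" using assms d by auto
  have "multiplicity (int q) (a * d) = multiplicity (int q) (c * b)" unfolding ad ..
  then have "multiplicity (int q) a + multiplicity (int q) d = multiplicity (int q) c + multiplicity (int q) b"
    using pe assms d \<open>c \<noteq> 0\<close> by (simp add: prime_elem_multiplicity_mult_distrib)
  then show ?thesis unfolding rat_val_def cd by simp
qed

lemma rat_val_of_int: assumes "Factorial_Ring.prime q" "a \<noteq> 0"
  shows "rat_val q (of_int a) = int (multiplicity (int q) a)"
  using rat_val_frac[OF assms, of 1] by simp

lemma rat_val_mult:
  assumes q: "Factorial_Ring.prime q" and "x \<noteq> 0" "y \<noteq> 0"
  shows "rat_val q (x * y) = rat_val q x + rat_val q y"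
proof -
  have pe: "prime_elem (int q)" using q by simp
  obtain a b where ab: "b > 0" "x = of_int a / of_int b" by (rule rat_int_frac)
  obtain c d where cd: "d > 0" "y = of_int c / of_int d" by (rule rat_int_frac)
  have nz: "a \<noteq> 0" "c \<noteq> 0" "b \<noteq> 0" "d \<noteq> 0" using ab cd assms by auto
  have "x * y = of_int (a * c) / of_int (b * d)" using ab cd by simp
  then have "rat_val q (x * y) = int (multiplicity (int q) (a * c)) - int (multiplicity (int q) (b * d))"
    using rat_val_frac[OF q, of "a * c" "b * d"] nz by simp
  moreover have "rat_val q x = int (multiplicity (int q) a) - int (multiplicity (int q) b)"
    "rat_val q y = int (multiplicity (int q) c) - int (multiplicity (int q) d)"
    using rat_val_frac[OF q] nz ab(2) cd(2) by simp_all
  ultimately show ?thesis using nz pe by (simp add: prime_elem_multiplicity_mult_distrib)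
qed

lemma rat_val_add:
  assumes q: "Factorial_Ring.prime q" and "x \<noteq> 0" "y \<noteq> 0" "x + y \<noteq> 0"
  shows "min (rat_val q x) (rat_val q y) \<le> rat_val q (x + y)"
proof -
  have pe: "prime_elem (int q)" using q by simp
  obtain a b where ab: "b > 0" "x = of_int a / of_int b" by (rule rat_int_frac)
  obtain c d where cd: "d > 0" "y = of_int c / of_int d" by (rule rat_int_frac)
  define m n D where "m = a * d" and "n = c * b" and "D = b * d"
  have nz: "m \<noteq> 0" "n \<noteq> 0" "D \<noteq> 0" using ab cd assms by (auto simp: m_def n_def D_def)
  have x: "x = of_int m / of_int D" and y: "y = of_int n / of_int D"
    using ab cd by (simp_all add: m_def n_def D_def)
  have xy: "x + y = of_int (m + n) / of_int D" unfolding x y by (simp add: add_divide_distrib)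
  then have mn: "m + n \<noteq> 0" using assms(4) by auto
  define k where "k = min (multiplicity (int q) m) (multiplicity (int q) n)"
  have "int q ^ k dvd m" "int q ^ k dvd n" by (auto simp: k_def intro: multiplicity_dvd')
  then have "int q ^ k dvd m + n" by simp
  then have "k \<le> multiplicity (int q) (m + n)"
    using mn prime_gt_1_nat[OF q] by (intro multiplicity_geI) simp_all
  then show ?thesis
    unfolding xy unfolding x y rat_val_frac[OF q nz(1,3)] rat_val_frac[OF q nz(2,3)] rat_val_frac[OF q mn nz(3)]
    by (simp add: k_def min_def split: if_splits)
qed

lemma rat_val_prime: "Factorial_Ring.prime q \<Longrightarrow> rat_val q (of_nat q) = 1"
  using rat_val_of_int[of q "int q"] by simp

lemma rat_val_one: "Factorial_Ring.prime q \<Longrightarrow> rat_val q 1 = 0"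
  using rat_val_mult[of q 1 1] by simp

lemma rat_val_power: "Factorial_Ring.prime q \<Longrightarrow> x \<noteq> 0 \<Longrightarrow> rat_val q (x ^ n) = int n * rat_val q x"
  by (induction n) (simp_all add: rat_val_mult rat_val_one algebra_simps)

lemma rat_val_inverse: "Factorial_Ring.prime q \<Longrightarrow> x \<noteq> 0 \<Longrightarrow> rat_val q (inverse x) = - rat_val q x"
  using rat_val_mult[of q x "inverse x"] rat_val_one[of q] by simp

lemma rat_field_valuation:
  assumes q: "Factorial_Ring.prime q" shows "field_valuation (UNIV :: rat set) (rat_val q)"
proof -
  interpret Q: type_subfield "UNIV :: rat set" by unfold_locales simp_all
  have q0: "(of_nat q :: rat) \<noteq> 0" using prime_gt_0_nat[OF q] by simp
  have "\<exists>x. x \<noteq> 0 \<and> rat_val q x = k" for k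
  proof (intro exI conjI)
    show "(of_nat q :: rat) powi k \<noteq> 0" using q0 by simp
    show "rat_val q (of_nat q powi k) = k"
      using q0 by (simp add: power_int_def rat_val_power[OF q] rat_val_inverse[OF q] rat_val_prime[OF q])
  qed
  then have "\<exists>x\<in>UNIV - {0}. k = rat_val q x" for k by (metis DiffI UNIV_I singletonD)
  then have "rat_val q ` (UNIV - {0}) = UNIV" by (auto simp: image_iff)
  then show ?thesis
    using rat_val_mult[OF q] rat_val_add[OF q]
    by unfold_locales (auto simp: discrete_valuation_def)
qed

section \<open>The quadratic field\<close>

locale real_quadratic =
  fixes p :: nat
  assumes prime_p: "Factorial_Ring.prime p" and p_mod: "p mod 8 = 1"
begin

abbreviation rt :: real where "rt \<equiv> sqrt (real p)"

definition quad :: "rat \<Rightarrow> rat \<Rightarrow> real" where "quad a b = of_rat a + of_rat b * rt"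

definition F :: "real set" where "F = {quad a b |a b. True}"

lemma p_pos: "p > 0" using prime_p prime_gt_0_nat by simp

lemma p_odd: "odd p" using p_mod by presburger

lemma rt_rt: "rt * rt = real p" by simp

lemma rat_sq_eq: assumes "(a::rat)\<^sup>2 = of_nat p * b\<^sup>2" shows "b = 0"
proof -
  obtain x y where xy: "y > 0" "a = of_int x / of_int y" by (rule rat_int_frac)
  obtain z w where zw: "w > 0" "b = of_int z / of_int w" by (rule rat_int_frac)
  have "of_int ((x * w)\<^sup>2) = (of_int (int p * (z * y)\<^sup>2) :: rat)"
    using assms xy zw by (simp add: field_simps power2_eq_square)
  then have "(x * w)\<^sup>2 = int p * (z * y)\<^sup>2" by (simp only: of_int_eq_iff)
  then have "z * y = 0" using sq_eq_prime_mult_sq[of "int p" "x * w" "z * y"] prime_p by simp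
  then show ?thesis using xy zw by simp
qed

lemma quad_eq_0_iff: "quad a b = 0 \<longleftrightarrow> a = 0 \<and> b = 0"
proof
  assume e: "quad a b = 0"
  then have "(of_rat a :: real) = - (of_rat b * rt)" by (simp add: quad_def)
  then have "(of_rat a :: real)\<^sup>2 = (of_rat b)\<^sup>2 * real p"
    by (simp add: power_mult_distrib)
  then have "(of_rat (a\<^sup>2) :: real) = of_rat (of_nat p * b\<^sup>2)" by (simp add: of_rat_power of_rat_mult)
  then have "a\<^sup>2 = of_nat p * b\<^sup>2" by (simp only: of_rat_eq_iff)
  then show "a = 0 \<and> b = 0" using rat_sq_eq[of a b] by simp
qed (simp add: quad_def)

lemma quad_add: "quad a b + quad c d = quad (a + c) (b + d)"
  by (simp add: quad_def of_rat_add algebra_simps)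

lemma quad_uminus: "- quad a b = quad (- a) (- b)"
  by (simp add: quad_def of_rat_minus)

lemma quad_mult: "quad a b * quad c d = quad (a * c + of_nat p * b * d) (a * d + b * c)"
proof -
  have "quad a b * quad c d = of_rat a * of_rat c + of_rat b * of_rat d * (rt * rt)
      + (of_rat a * of_rat d + of_rat b * of_rat c) * rt"
    unfolding quad_def by (simp only: algebra_simps)
  then show ?thesis unfolding rt_rt by (simp add: quad_def of_rat_add of_rat_mult algebra_simps)
qed

lemma quad_rat: "quad a 0 = of_rat a" by (simp add: quad_def)

lemma quad_inj: "quad a b = quad c d \<longleftrightarrow> a = c \<and> b = d"
proof -
  have "quad a b = quad c d \<longleftrightarrow> quad a b + - quad c d = 0" by auto
  also have "\<dots> \<longleftrightarrow> a = c \<and> b = d" by (simp add: quad_uminus quad_add quad_eq_0_iff)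
  finally show ?thesis .
qed

lemma norm_nonzero: assumes "a \<noteq> 0 \<or> b \<noteq> 0" shows "a\<^sup>2 - of_nat p * b\<^sup>2 \<noteq> (0::rat)"
  using rat_sq_eq[of a b] assms by auto

lemma quad_inverse:
  "inverse (quad a b) = quad (a / (a\<^sup>2 - of_nat p * b\<^sup>2)) (- b / (a\<^sup>2 - of_nat p * b\<^sup>2))"
proof (cases "a = 0 \<and> b = 0")
  case False
  define n where "n = a\<^sup>2 - of_nat p * b\<^sup>2"
  have n: "n \<noteq> 0" using norm_nonzero False by (simp add: n_def)
  have "a * (a / n) + of_nat p * b * (- b / n) = (a\<^sup>2 - of_nat p * b\<^sup>2) / n"
    by (simp add: diff_divide_distrib power2_eq_square)
  then have "quad a b * quad (a / n) (- b / n) = 1"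
    using n by (simp add: quad_mult n_def[symmetric]) (simp add: quad_def mult.commute)
  then show ?thesis unfolding n_def by (rule inverse_unique)
qed (simp add: quad_def)

lemma quad_mem [simp]: "quad a b \<in> F" by (auto simp: F_def)

lemma mem_F_E: assumes "x \<in> F" obtains a b where "x = quad a b" using assms by (auto simp: F_def)

sublocale type_subfield F
proof
  show "0 \<in> F" "1 \<in> F" using quad_mem[of 0 0] quad_mem[of 1 0] by (simp_all add: quad_def)
  fix x y assume "x \<in> F" "y \<in> F"
  then show "x + y \<in> F" "x * y \<in> F" by (auto elim!: mem_F_E simp: quad_add quad_mult)
next
  fix x assume "x \<in> F"
  then show "- x \<in> F" "inverse x \<in> F" by (auto elim!: mem_F_E simp: quad_uminus quad_inverse)
qed

lemma quadratic_field_eq: "quadratic_field p = K"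
  unfolding quadratic_field_def K_def by (simp only: F_def quad_def)

lemma of_rat_mem [simp]: "of_rat r \<in> F" using quad_mem[of r 0] by (simp add: quad_rat)

lemma rt_mem [simp]: "rt \<in> F" using quad_mem[of 0 1] by (simp add: quad_def)

definition qnorm :: "real \<Rightarrow> rat" where
  "qnorm x = (THE n. \<exists>a b. x = quad a b \<and> n = a\<^sup>2 - of_nat p * b\<^sup>2)"

definition qconj :: "real \<Rightarrow> real" where
  "qconj x = (THE y. \<exists>a b. x = quad a b \<and> y = quad a (- b))"

lemma qnorm_quad: "qnorm (quad a b) = a\<^sup>2 - of_nat p * b\<^sup>2"
  unfolding qnorm_def by (rule the_equality) (auto simp: quad_inj)

lemma qconj_quad: "qconj (quad a b) = quad a (- b)"
  unfolding qconj_def by (rule the_equality) (auto simp: quad_inj)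

lemma qnorm_mult: assumes "x \<in> F" "y \<in> F" shows "qnorm (x * y) = qnorm x * qnorm y"
  using assms by (auto elim!: mem_F_E simp: quad_mult qnorm_quad power2_eq_square algebra_simps)

lemma qnorm_nonzero: assumes "x \<in> F" "x \<noteq> 0" shows "qnorm x \<noteq> 0"
  using assms norm_nonzero by (auto elim!: mem_F_E simp: qnorm_quad quad_eq_0_iff)

lemma qnorm_of_rat: "qnorm (of_rat r) = r\<^sup>2" using qnorm_quad[of r 0] by (simp add: quad_rat)

lemma mult_qconj: assumes "x \<in> F" shows "x * qconj x = of_rat (qnorm x)"
  using assms by (auto elim!: mem_F_E simp: qconj_quad qnorm_quad quad_mult quad_rat[symmetric] power2_eq_square quad_inj)

lemma common_denominator:
  assumes "x \<in> F"
  obtains a b d :: int where "d \<noteq> 0" "x = (of_int a + of_int b * rt) / of_int d"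
proof -
  obtain r s where rs: "x = quad r s" using assms by (rule mem_F_E)
  obtain a b where ab: "b > 0" "r = of_int a / of_int b" by (rule rat_int_frac)
  obtain c d where cd: "d > 0" "s = of_int c / of_int d" by (rule rat_int_frac)
  have "x = (of_int (a * d) + of_int (c * b) * rt) / of_int (b * d)"
  proof -
    have "(of_rat r :: real) = of_int a / of_int b" "(of_rat s :: real) = of_int c / of_int d"
      using ab cd by (simp_all add: of_rat_divide)
    note q = this
    have "A / B + C / D * T = (A * D + C * B * T) / (B * D)" if "B \<noteq> 0" "D \<noteq> 0" for A B C D T :: real
      using that by (simp add: add_divide_distrib)
    from this[of "of_int b" "of_int d" "of_int a" "of_int c" rt]
    show ?thesis unfolding rs quad_def q using ab(1) cd(1) by simp
  qed
  then show thesis using that[of "b * d" "a * d" "c * b"] ab(1) cd(1) by simp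
qed

section \<open>The places above 2\<close>

text \<open>The 2-adic square roots of \<open>p\<close>: if \<open>x\<^sup>2 - p = 2\<^bsup>k + 3\<^esup> c\<close>, then \<open>x + 2\<^bsup>k + 2\<^esup> c\<close> is a root to one more digit,
  as \<open>x + 1\<close> is even.\<close>
lemma two_adic_roots:
  obtains r :: "nat \<Rightarrow> int" where "\<And>k. odd (r k)" "\<And>k. 2 ^ (k + 3) dvd (r k)\<^sup>2 - int p"
    "\<And>k. 2 ^ k dvd r (Suc k) - r k"
proof -
  have "\<exists>r. \<forall>k. (odd (r k) \<and> 2 ^ (k + 3) dvd (r k)\<^sup>2 - int p) \<and> 2 ^ k dvd r (Suc k) - r k"
  proof (rule dependent_nat_choice)
    have "8 dvd int p - 1" using p_mod by presburger
    then have "8 dvd 1 - int p" by (simp add: dvd_diff_commute)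
    then show "\<exists>x. odd x \<and> 2 ^ (0 + 3) dvd x\<^sup>2 - int p" by (intro exI[of _ 1]) simp
  next
    fix x :: int and k
    assume x: "odd x \<and> 2 ^ (k + 3) dvd x\<^sup>2 - int p"
    then obtain c where c: "x\<^sup>2 - int p = 2 ^ (k + 3) * c" by (elim conjE dvdE)
    define y where "y = x + 2 ^ (k + 2) * c"
    have "y\<^sup>2 - int p = (x\<^sup>2 - int p) + 2 ^ (k + 3) * (x * c) + 2 ^ (k + 4) * (2 ^ k * c\<^sup>2)"
      unfolding y_def by (simp add: power2_eq_square power_add algebra_simps)
    also have "\<dots> = 2 ^ (k + 3) * (c * (x + 1)) + 2 ^ (k + 4) * (2 ^ k * c\<^sup>2)"
      unfolding c by (simp add: algebra_simps)
    finally have e: "y\<^sup>2 - int p = 2 ^ (k + 3) * (c * (x + 1)) + 2 ^ (k + 4) * (2 ^ k * c\<^sup>2)" .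
    obtain t where t: "x + 1 = 2 * t" using x by (metis evenE odd_even_add odd_one)
    have "y\<^sup>2 - int p = 2 ^ (Suc k + 3) * (c * t + 2 ^ k * c\<^sup>2)"
      unfolding e t by (simp add: power_add algebra_simps)
    then have "2 ^ (Suc k + 3) dvd y\<^sup>2 - int p" by simp
    moreover have "odd y" using x by (simp add: y_def)
    moreover have "2 ^ k dvd y - x" by (simp add: y_def power_add)
    ultimately show "\<exists>y. (odd y \<and> 2 ^ (Suc k + 3) dvd y\<^sup>2 - int p) \<and> 2 ^ k dvd y - x" by blast
  qed
  then show thesis using that by blast
qed

text \<open>\<open>(\<surd>p - r) (\<surd>p + r)\<close> is highly divisible by 2, while the two factors differ by \<open>2 r\<close>, of valuation \<open>v 2\<close>.
  So one of them has almost all of the valuation, and which one it is decides between \<open>r\<close> and \<open>- r\<close>.\<close>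
lemma sqrt_approx:
  assumes "field_valuation F v" "v 2 > 0"
  obtains s :: int where "odd s" "2 ^ (k + 3) dvd s\<^sup>2 - int p" "field_valuation.vge F v (int k) (rt - of_int s)"
proof -
  interpret field_valuation F v by (rule assms)
  obtain r :: int where r: "odd r" "2 ^ (k + 3) dvd r\<^sup>2 - int p" using two_adic_roots by metis
  have AB: "rt - of_int r = quad (- of_int r) 1" "rt + of_int r = quad (of_int r) 1"
    by (simp_all add: quad_def of_rat_minus)
  have nz: "rt - of_int r \<noteq> 0" "rt + of_int r \<noteq> 0" unfolding AB quad_eq_0_iff by simp_all
  have mem: "rt - of_int r \<in> F" "rt + of_int r \<in> F" unfolding AB by simp_all
  obtain c where c: "r\<^sup>2 - int p = 2 ^ (k + 3) * c" using r(2) by (elim dvdE)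
  have "(rt - of_int r) * (rt + of_int r) = real p - (of_int r)\<^sup>2"
    by (simp add: algebra_simps power2_eq_square)
  also have "\<dots> = of_int (- (r\<^sup>2 - int p))" by simp
  also have "\<dots> = 2 ^ (k + 3) * of_int (- c)" unfolding c by simp
  finally have prod: "(rt - of_int r) * (rt + of_int r) = 2 ^ (k + 3) * of_int (- c)" .
  have "vge (int (k + 3) * v 2) (2 ^ (k + 3))" by (simp add: vge_def v_power)
  from vge_mult[OF this vge_of_int[of "- c"]]
  have "vge (int (k + 3) * v 2) ((rt - of_int r) * (rt + of_int r))" unfolding prod by simp
  then have sum: "v (rt - of_int r) + v (rt + of_int r) \<ge> int (k + 3) * v 2"
    using v_mult[OF mem(1) nz(1) mem(2) nz(2)] nz by (simp add: vge_def)
  have kv: "int (k + 2) \<le> int (k + 2) * v 2" using assms(2) by simp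
  have two: "v (2 * of_int r) = v 2" using r(1) v_odd_of_int[OF assms(2) r(1)] by (subst v_mult) auto
  have "\<not> (v (rt - of_int r) > v 2 \<and> v (rt + of_int r) > v 2)"
  proof
    assume "v (rt - of_int r) > v 2 \<and> v (rt + of_int r) > v 2"
    then have "vge (v 2 + 1) ((rt + of_int r) - (rt - of_int r))"
      using mem by (intro vge_diff[of "v 2 + 1" "rt + of_int r"]) (simp_all only: vge_def, simp_all)
    then have "vge (v 2 + 1) (2 * of_int r)" by simp
    then show False using two r(1) by (auto simp: vge_def)
  qed
  then consider "v (rt - of_int r) \<ge> int (k + 2)" | "v (rt + of_int r) \<ge> int (k + 2)"
    using sum kv by (fastforce simp: algebra_simps)
  then show thesis
  proof cases
    case 1
    then show thesis using that[of r] r mem by (simp add: vge_def)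
  next
    case 2
    then show thesis using that[of "- r"] r mem by (simp add: vge_def)
  qed
qed

lemma integral_approx:
  assumes v: "field_valuation F v" "v 2 > 0" and nz: "of_int a + of_int b * rt \<noteq> 0"
  obtains m :: int where "m \<noteq> 0" "v (of_int m) = v (of_int a + of_int b * rt)"
    "field_valuation.vge F v (v (of_int a + of_int b * rt) + 3) (of_int a + of_int b * rt - of_int m)"
proof -
  interpret field_valuation F v by (rule v)
  define y where "y = of_int a + of_int b * rt"
  have y: "y \<in> F" "y \<noteq> 0" using nz by (simp_all add: y_def)
  define k where "k = nat (v y + 3)"
  obtain s :: int where s: "vge (int k) (rt - of_int s)" using sqrt_approx[OF v] by blast
  define m where "m = a + b * s"
  have d: "y - of_int m = of_int b * (rt - of_int s)" by (simp add: y_def m_def algebra_simps)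
  have "vge (int k) (y - of_int m)" unfolding d using vge_mult[OF vge_of_int[of b] s] by simp
  then have c: "vge (v y + 3) (y - of_int m)" by (rule vge_mono) (simp add: k_def)
  then have "vge (v y + 1) (- (y - of_int m))" by (intro vge_uminus vge_mono[OF c]) simp
  from v_add_eq[OF y this] have "of_int m \<noteq> (0::real)" "v (of_int m) = v y" by simp_all
  then show thesis using that[of m] c by (simp add: y_def)
qed

text \<open>Every element is close to a rational number, so its valuation is a multiple of \<open>v 2\<close>; surjectivity of \<open>v\<close> then
  forces \<open>v 2 = 1\<close>.\<close>
lemma two_adic_place: assumes v: "field_valuation F v" "v 2 > 0" shows "two_adic_place F v"
proof -
  interpret field_valuation F v by (rule v)
  have main: "\<exists>m d :: int. m \<noteq> 0 \<and> d \<noteq> 0 \<and> v x = v (of_int m) - v (of_int d) \<and> vge (v x + 3) (x - of_int m / of_int d)"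
    if x: "x \<in> F" "x \<noteq> 0" for x
  proof -
    obtain a b d :: int where d: "d \<noteq> 0" "x = (of_int a + of_int b * rt) / of_int d"
      using common_denominator[OF x(1)] .
    define y where "y = of_int a + of_int b * rt"
    have y: "y \<in> F" "y \<noteq> 0" using d x by (auto simp: y_def)
    obtain m :: int where m: "m \<noteq> 0" "v (of_int m) = v y" "vge (v y + 3) (y - of_int m)"
      using integral_approx[OF v, of a b] y unfolding y_def by blast
    have vx: "v x = v y - v (of_int d)" using d y by (simp add: y_def[symmetric] v_divide)
    have "vge (- v (of_int d)) (inverse (of_int d))" using d by (simp add: vge_def v_inverse)
    moreover have "v y + 3 + (- v (of_int d)) = v x + 3" using vx by simp
    ultimately have "vge (v x + 3) ((y - of_int m) * inverse (of_int d))"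
      using vge_mult[OF m(3)] by metis
    moreover have "(y - of_int m) * inverse (of_int d) = x - of_int m / of_int d"
      using d by (simp add: y_def[symmetric] divide_inverse algebra_simps)
    ultimately show ?thesis using m d vx by (intro exI[of _ m] exI[of _ d]) simp
  qed
  obtain x where x: "x \<in> F" "x \<noteq> 0" "v x = 1" by (rule v_surj)
  obtain m d :: int where md: "m \<noteq> 0" "d \<noteq> 0" "v x = v (of_int m) - v (of_int d)" using main[OF x(1,2)] by blast
  have "v 2 * (int (multiplicity 2 m) - int (multiplicity 2 d)) = 1"
    using md x(3) v_of_int_eq[OF v(2)] by (simp add: algebra_simps)
  then have "v 2 dvd 1" by (metis dvd_triv_left)
  then have "v 2 = 1" using v(2) by simp
  then show ?thesis using main by unfold_locales blast+
qed

section \<open>Places over split primes\<close>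

lemma discrete_valuationI:
  assumes "\<And>x y. x \<in> F \<Longrightarrow> x \<noteq> 0 \<Longrightarrow> y \<in> F \<Longrightarrow> y \<noteq> 0 \<Longrightarrow> v (x * y) = v x + v y"
    and "\<And>x y. x \<in> F \<Longrightarrow> x \<noteq> 0 \<Longrightarrow> y \<in> F \<Longrightarrow> y \<noteq> 0 \<Longrightarrow> x + y \<noteq> 0 \<Longrightarrow> min (v x) (v y) \<le> v (x + y)"
    and "\<And>k. \<exists>x\<in>F. x \<noteq> 0 \<and> v x = k"
  shows "discrete_valuation K v"
proof -
  have "k \<in> v ` carrier (mult_of K)" for k using assms(3)[of k] by auto
  then have "v ` carrier (mult_of K) = UNIV" by blast
  then show ?thesis using assms(1,2) unfolding discrete_valuation_def by simp
qed

end

text \<open>A coherent sequence of square roots of \<open>p\<close> modulo the powers of \<open>q\<close>, that is, a \<open>q\<close>-adic square root of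
  \<open>p\<close>. Sending \<open>\<surd>p\<close> to it embeds the field into \<open>\<rat>\<^sub>q\<close>, and \<open>V\<close> below is the resulting valuation.\<close>
locale padic_root = real_quadratic +
  fixes q :: nat and r :: "nat \<Rightarrow> int"
  assumes prime_q: "Factorial_Ring.prime q"
    and root: "int q ^ k dvd (r k)\<^sup>2 - int p"
    and coherent: "int q ^ k dvd r (Suc k) - r k"
begin

sublocale Q: field_valuation "UNIV :: rat set" "rat_val q"
  by (rule rat_field_valuation[OF prime_q])

text \<open>The \<open>k\<close>-th approximation to the image of \<open>a + b \<surd>p\<close> in \<open>\<rat>\<^sub>q\<close>.\<close>
definition ev :: "rat \<Rightarrow> rat \<Rightarrow> nat \<Rightarrow> rat" where "ev a b k = a + b * of_int (r k)"

lemma vge_of_dvd: assumes "int q ^ k dvd m" shows "Q.vge (int k) (of_int m)"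
proof -
  obtain c where c: "m = int q ^ k * c" using assms by (elim dvdE)
  have "Q.vge (int k) (of_nat q ^ k)"
    using prime_gt_0_nat[OF prime_q] by (simp add: Q.vge_def Q.v_power rat_val_prime[OF prime_q])
  from Q.vge_mult[OF this Q.vge_of_int[of c]] show ?thesis using c by simp
qed

lemma vge_common: obtains \<mu> where "Q.vge \<mu> a" "Q.vge \<mu> b"
proof -
  have "Q.vge (min (rat_val q a) (rat_val q b)) a" "Q.vge (min (rat_val q a) (rat_val q b)) b"
    by (simp_all add: Q.vge_def)
  then show thesis by (rule that)
qed

text \<open>The product of the approximations at \<open>r\<close> and at \<open>- r\<close> tends to the norm, which is not 0; this bounds their
  valuations from above, whereas consecutive approximations become arbitrarily close.\<close>
lemma eventually_const_valuation:
  assumes "a \<noteq> 0 \<or> b \<noteq> 0"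
  obtains c where "\<forall>\<^sub>F k in sequentially. ev a b k \<noteq> 0 \<and> rat_val q (ev a b k) = c"
proof -
  define n where "n = a\<^sup>2 - of_nat p * b\<^sup>2"
  have n: "n \<noteq> 0" using norm_nonzero[OF assms] by (simp add: n_def)
  obtain \<mu> where \<mu>: "Q.vge \<mu> a" "Q.vge \<mu> b" by (rule vge_common)
  define M where "M = nat (rat_val q n + 1 - 2 * \<mu>)"
  have bd: "ev a b k \<noteq> 0 \<and> rat_val q (ev a b k) \<le> rat_val q n - \<mu>" if k: "k \<ge> M" for k
  proof -
    have "Q.vge (\<mu> + \<mu> + int k) (b * b * of_int ((r k)\<^sup>2 - int p))"
      by (intro Q.vge_mult \<mu> vge_of_dvd root)
    then have "Q.vge (rat_val q n + 1) (- (b * b * of_int ((r k)\<^sup>2 - int p)))"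
      using k by (intro Q.vge_uminus) (erule Q.vge_mono, simp add: M_def)
    from Q.v_add_eq[OF _ n this]
    have "n + - (b * b * of_int ((r k)\<^sup>2 - int p)) \<noteq> 0"
      "rat_val q (n + - (b * b * of_int ((r k)\<^sup>2 - int p))) = rat_val q n" by simp_all
    moreover have "n + - (b * b * of_int ((r k)\<^sup>2 - int p)) = ev a b k * ev a (- b) k"
      by (simp add: n_def ev_def power2_eq_square algebra_simps)
    ultimately have p: "ev a b k \<noteq> 0" "ev a (- b) k \<noteq> 0" "rat_val q (ev a b k * ev a (- b) k) = rat_val q n"
      by auto
    have "Q.vge (\<mu> + 0) (- b * of_int (r k))" by (intro Q.vge_mult Q.vge_uminus \<mu> Q.vge_of_int)
    then have "Q.vge \<mu> (ev a (- b) k)" unfolding ev_def using \<mu>(1) by (intro Q.vge_add) simp_all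
    then have "rat_val q (ev a (- b) k) \<ge> \<mu>" using p(2) by (simp add: Q.vge_def)
    then show ?thesis using p Q.v_mult[of "ev a b k" "ev a (- b) k"] by simp
  qed
  have step: "rat_val q (ev a b (Suc k)) = rat_val q (ev a b k)" if k: "k \<ge> M" for k
  proof -
    have "Q.vge (\<mu> + int k) (b * of_int (r (Suc k) - r k))"
      by (intro Q.vge_mult \<mu> vge_of_dvd coherent)
    then have "Q.vge (rat_val q (ev a b k) + 1) (b * of_int (r (Suc k) - r k))"
      by (rule Q.vge_mono) (use k bd[OF k] in \<open>unfold M_def nat_le_iff, linarith\<close>)
    from Q.v_add_eq(2)[OF _ _ this] have "rat_val q (ev a b k + b * of_int (r (Suc k) - r k)) = rat_val q (ev a b k)"
      using bd[OF k] by simp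
    then show ?thesis by (simp add: ev_def algebra_simps)
  qed
  have const: "rat_val q (ev a b k) = rat_val q (ev a b M)" if k: "M \<le> k" for k
    using k
  proof (induction k rule: dec_induct)
    case (step k)
    then show ?case using \<open>\<And>k. k \<ge> M \<Longrightarrow> rat_val q (ev a b (Suc k)) = rat_val q (ev a b k)\<close> by metis
  qed (rule refl)
  have "ev a b k \<noteq> 0 \<and> rat_val q (ev a b k) = rat_val q (ev a b M)" if "M \<le> k" for k
    using bd[OF that] const[OF that] by (intro conjI) (erule conjunct1)
  then have "\<forall>\<^sub>F k in sequentially. ev a b k \<noteq> 0 \<and> rat_val q (ev a b k) = rat_val q (ev a b M)"
    by (rule eventually_mono[OF eventually_ge_at_top[of M]])
  then show thesis by (rule that)
qed

definition V :: "real \<Rightarrow> int" where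
  "V x = (THE c. \<exists>a b. x = quad a b \<and> (\<forall>\<^sub>F k in sequentially. ev a b k \<noteq> 0 \<and> rat_val q (ev a b k) = c))"

lemma V_eqI:
  assumes "\<forall>\<^sub>F k in sequentially. ev a b k \<noteq> 0 \<and> rat_val q (ev a b k) = c"
  shows "V (quad a b) = c"
  unfolding V_def
proof (rule the_equality)
  show "\<exists>a' b'. quad a b = quad a' b' \<and> (\<forall>\<^sub>F k in sequentially. ev a' b' k \<noteq> 0 \<and> rat_val q (ev a' b' k) = c)"
    using assms by blast
next
  fix c' assume "\<exists>a' b'. quad a b = quad a' b' \<and> (\<forall>\<^sub>F k in sequentially. ev a' b' k \<noteq> 0 \<and> rat_val q (ev a' b' k) = c')"
  then have "\<forall>\<^sub>F k in sequentially. ev a b k \<noteq> 0 \<and> rat_val q (ev a b k) = c'" by (auto simp: quad_inj)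
  with assms have "\<forall>\<^sub>F k in sequentially. c' = c" by eventually_elim auto
  then show "c' = c" by simp
qed

lemma V_ev:
  assumes "a \<noteq> 0 \<or> b \<noteq> 0"
  shows "\<forall>\<^sub>F k in sequentially. ev a b k \<noteq> 0 \<and> rat_val q (ev a b k) = V (quad a b)"
  using eventually_const_valuation[OF assms] V_eqI by metis

lemma V_of_rat: assumes "a \<noteq> 0" shows "V (of_rat a) = rat_val q a"
  using V_eqI[of a 0 "rat_val q a"] assms by (simp add: ev_def quad_rat)

lemma V_mult:
  assumes "x \<in> F" "x \<noteq> 0" "y \<in> F" "y \<noteq> 0" shows "V (x * y) = V x + V y"
proof -
  obtain a b where x: "x = quad a b" using assms(1) by (rule mem_F_E)
  obtain c d where y: "y = quad c d" using assms(3) by (rule mem_F_E)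
  have ab: "a \<noteq> 0 \<or> b \<noteq> 0" and cd: "c \<noteq> 0 \<or> d \<noteq> 0" using assms x y by (auto simp: quad_eq_0_iff)
  define S where "S = V x + V y"
  define \<tau> where "\<tau> = rat_val q (b * d)"
  have \<tau>: "Q.vge \<tau> (b * d)" by (simp add: Q.vge_def \<tau>_def)
  have "\<forall>\<^sub>F k in sequentially. k \<ge> nat (S + 1 - \<tau>)" by (rule eventually_ge_at_top)
  with V_ev[OF ab] V_ev[OF cd]
  have "\<forall>\<^sub>F k in sequentially. ev (a * c + of_nat p * b * d) (a * d + b * c) k \<noteq> 0 \<and>
      rat_val q (ev (a * c + of_nat p * b * d) (a * d + b * c) k) = S"
  proof eventually_elim
    case (elim k)
    have "Q.vge (\<tau> + int k) (b * d * of_int ((r k)\<^sup>2 - int p))"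
      by (intro Q.vge_mult \<tau> vge_of_dvd root)
    then have e: "Q.vge (S + 1) (- (b * d * of_int ((r k)\<^sup>2 - int p)))"
      using elim(3) by (intro Q.vge_uminus) (erule Q.vge_mono, simp)
    have prod: "ev a b k * ev c d k \<noteq> 0" "rat_val q (ev a b k * ev c d k) = S"
      using elim(1,2) Q.v_mult[of "ev a b k" "ev c d k"] by (simp_all add: S_def x y)
    have "ev (a * c + of_nat p * b * d) (a * d + b * c) k
        = ev a b k * ev c d k + - (b * d * of_int ((r k)\<^sup>2 - int p))"
      by (simp add: ev_def power2_eq_square algebra_simps)
    then show ?case using Q.v_add_eq[OF UNIV_I prod(1) e[folded prod(2)]] prod(2) by metis
  qed
  then show ?thesis unfolding S_def x y quad_mult by (rule V_eqI)
qed

lemma V_add: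
  assumes "x \<in> F" "x \<noteq> 0" "y \<in> F" "y \<noteq> 0" "x + y \<noteq> 0" shows "min (V x) (V y) \<le> V (x + y)"
proof -
  obtain a b where x: "x = quad a b" using assms(1) by (rule mem_F_E)
  obtain c d where y: "y = quad c d" using assms(3) by (rule mem_F_E)
  have ab: "a \<noteq> 0 \<or> b \<noteq> 0" and cd: "c \<noteq> 0 \<or> d \<noteq> 0" and s: "a + c \<noteq> 0 \<or> b + d \<noteq> 0"
    using assms x y by (auto simp: quad_eq_0_iff quad_add)
  from V_ev[OF ab] V_ev[OF cd] V_ev[OF s]
  have "\<forall>\<^sub>F k in sequentially. min (V x) (V y) \<le> V (x + y)"
  proof eventually_elim
    case (elim k)
    have "ev (a + c) (b + d) k = ev a b k + ev c d k" by (simp add: ev_def algebra_simps)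
    then show ?case using elim Q.v_add[of "ev a b k" "ev c d k"] by (simp add: x y quad_add)
  qed
  then show ?thesis by simp
qed

lemma discrete_valuation_V: "discrete_valuation K V"
proof (rule discrete_valuationI[OF V_mult V_add])
  fix k
  obtain a where "a \<in> UNIV" "a \<noteq> 0" "rat_val q a = k" by (rule Q.v_surj)
  then show "\<exists>x\<in>F. x \<noteq> 0 \<and> V x = k" using V_of_rat by (intro bexI[of _ "of_rat a"]) simp_all
qed

lemma neg_root: "padic_root p q (\<lambda>k. - r k)"
proof unfold_locales
  show "int q ^ k dvd - r (Suc k) - - r k" for k
    using dvd_minus_iff[THEN iffD2, OF coherent[of k]] by simp
qed (use prime_q root in simp_all)

text \<open>The two square roots \<open>r\<close> and \<open>- r\<close> give the two places above \<open>q\<close>, and the norm is the product of the images.\<close>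
lemma V_qconj:
  assumes "x \<in> F" "x \<noteq> 0"
  shows "V x + padic_root.V p q (\<lambda>k. - r k) x = rat_val q (qnorm x)"
proof -
  interpret neg: padic_root p q "\<lambda>k. - r k" by (rule neg_root)
  obtain a b where x: "x = quad a b" using assms(1) by (rule mem_F_E)
  have ab: "a \<noteq> 0 \<or> b \<noteq> 0" using assms x by (auto simp: quad_eq_0_iff)
  define n where "n = a\<^sup>2 - of_nat p * b\<^sup>2"
  have n: "n \<noteq> 0" using norm_nonzero[OF ab] by (simp add: n_def)
  define \<tau> where "\<tau> = rat_val q (b * b)"
  have \<tau>: "Q.vge \<tau> (b * b)" by (simp add: Q.vge_def \<tau>_def)
  have "\<forall>\<^sub>F k in sequentially. k \<ge> nat (rat_val q n + 1 - \<tau>)" by (rule eventually_ge_at_top)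
  with V_ev[OF ab] neg.V_ev[OF ab]
  have "\<forall>\<^sub>F k in sequentially. V x + neg.V x = rat_val q (qnorm x)"
  proof eventually_elim
    case (elim k)
    have "Q.vge (\<tau> + int k) (b * b * of_int ((r k)\<^sup>2 - int p))"
      by (intro Q.vge_mult \<tau> vge_of_dvd root)
    then have e: "Q.vge (rat_val q n + 1) (- (b * b * of_int ((r k)\<^sup>2 - int p)))"
      using elim(3) by (intro Q.vge_uminus) (erule Q.vge_mono, simp)
    have "ev a b k * neg.ev a b k = n + - (b * b * of_int ((r k)\<^sup>2 - int p))"
      by (simp add: n_def ev_def neg.ev_def power2_eq_square algebra_simps)
    then have "rat_val q (ev a b k * neg.ev a b k) = rat_val q n"
      using Q.v_add_eq(2)[OF _ n e] by simp
    then show ?case using elim Q.v_mult[of "ev a b k" "neg.ev a b k"] by (simp add: x qnorm_quad n_def)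
  qed
  then show ?thesis by simp
qed

end

context real_quadratic
begin

lemma two_adic_place_exists:
  obtains v where "discrete_valuation K v" "v 2 = 1"
proof -
  obtain r :: "nat \<Rightarrow> int" where r: "\<And>k. 2 ^ (k + 3) dvd (r k)\<^sup>2 - int p" "\<And>k. 2 ^ k dvd r (Suc k) - r k"
    using two_adic_roots by metis
  interpret padic_root p 2 r
  proof unfold_locales
    show "int 2 ^ k dvd (r k)\<^sup>2 - int p" for k
      using r(1)[of k] by (simp add: power_add) (metis dvd_mult_left)
  qed (use r(2) in simp_all)
  have "V 2 = 1" using V_of_rat[of 2] rat_val_prime[of 2] by simp
  then show thesis using that discrete_valuation_V by blast
qed

text \<open>Hensel lifting; \<open>2 x\<close> is invertible modulo \<open>q\<close> because \<open>q\<close> divides neither 2 nor \<open>p\<close>.\<close>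
lemma odd_prime_roots:
  assumes q: "Factorial_Ring.prime q" "q \<noteq> 2" "q \<noteq> p" and s: "int q dvd s\<^sup>2 - int p"
  obtains r where "padic_root p q r"
proof -
  have qI: "Factorial_Ring.prime (int q)" using q by simp
  have nd: "\<not> int q dvd 2 * x" if "int q dvd x\<^sup>2 - int p" for x
  proof
    assume "int q dvd 2 * x"
    moreover have "\<not> int q dvd 2"
      using prime_ge_2_nat[OF q(1)] q(2) zdvd_not_zless[of 2 "int q"] by simp
    ultimately have "int q dvd x" using qI prime_dvd_mult_iff by blast
    then have "int q dvd x\<^sup>2" by (simp add: power2_eq_square)
    then have "int q dvd x\<^sup>2 - (x\<^sup>2 - int p)" using that by (rule dvd_diff)
    then have "int q dvd int p" by simp
    then show False using primes_dvd_imp_eq[OF q(1) prime_p] q(3) by simp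
  qed
  have "\<exists>r. \<forall>k. int q ^ (k + 1) dvd (r k)\<^sup>2 - int p \<and> int q ^ k dvd r (Suc k) - r k"
  proof (rule dependent_nat_choice)
    show "\<exists>x. int q ^ (0 + 1) dvd x\<^sup>2 - int p" using s by auto
  next
    fix x :: int and k
    assume x: "int q ^ (k + 1) dvd x\<^sup>2 - int p"
    then obtain c where c: "x\<^sup>2 - int p = int q ^ (k + 1) * c" by (elim dvdE)
    have "int q dvd x\<^sup>2 - int p" unfolding c by simp
    then have "\<not> int q dvd 2 * x" by (rule nd)
    then have "coprime (2 * x) (int q)" using qI by (metis prime_imp_coprime coprime_commute)
    then obtain h :: int where h: "[2 * x * h = 1] (mod int q)" by (metis cong_solve_coprime_int)
    define y where "y = x + int q ^ (k + 1) * (- c * h)"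
    have "y\<^sup>2 - int p = (x\<^sup>2 - int p) + int q ^ (k + 1) * (2 * x * (- c * h)) + int q ^ (k + 1) * int q ^ (k + 1) * (c * h)\<^sup>2"
      unfolding y_def by (simp add: power2_eq_square algebra_simps)
    also have "\<dots> = int q ^ (k + 1) * (c * - (2 * x * h - 1)) + int q ^ (k + 1) * int q * (int q ^ k * (c * h)\<^sup>2)"
      unfolding c by (simp add: algebra_simps)
    finally have e: "y\<^sup>2 - int p = int q ^ (k + 1) * (c * - (2 * x * h - 1)) + int q ^ (k + 1) * int q * (int q ^ k * (c * h)\<^sup>2)" .
    obtain t where t: "2 * x * h - 1 = int q * t" using h by (auto simp: cong_iff_dvd_diff)
    have "y\<^sup>2 - int p = int q ^ (Suc k + 1) * (c * - t + int q ^ k * (c * h)\<^sup>2)"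
      unfolding e t by (simp add: algebra_simps)
    then have "int q ^ (Suc k + 1) dvd y\<^sup>2 - int p" by simp
    moreover have "int q ^ k dvd y - x" by (simp add: y_def)
    ultimately show "\<exists>y. int q ^ (Suc k + 1) dvd y\<^sup>2 - int p \<and> int q ^ k dvd y - x" by blast
  qed
  then obtain r where r: "\<And>k. int q ^ (k + 1) dvd (r k)\<^sup>2 - int p" "\<And>k. int q ^ k dvd r (Suc k) - r k"
    by blast
  have "padic_root p q r"
  proof unfold_locales
    show "int q ^ k dvd (r k)\<^sup>2 - int p" for k
      using r(1)[of k] dvd_mult_right[of "int q" "int q ^ k"] by simp
  qed (use q(1) r(2) in simp_all)
  then show thesis by (rule that)
qed

section \<open>Places over inert and ramified primes\<close>

text \<open>When there is only one place above \<open>q\<close>, its valuation is proportional to that of the norm. For the ultrametric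
  inequality one divides by one of the two summands, and \<open>N(1 + z) = 1 + 2 a + N(z)\<close> for \<open>z = a + b \<surd>p\<close> is integral at
  \<open>q\<close> if \<open>N(z)\<close> is, provided that this entails the integrality of \<open>a\<close>.\<close>
lemma norm_valuation:
  assumes q: "Factorial_Ring.prime q"
    and H: "\<And>a b. field_valuation.vge UNIV (rat_val q) 0 (a\<^sup>2 - of_nat p * b\<^sup>2) \<Longrightarrow>
      field_valuation.vge UNIV (rat_val q) 0 a"
  shows "\<And>x y. x \<in> F \<Longrightarrow> x \<noteq> 0 \<Longrightarrow> y \<in> F \<Longrightarrow> y \<noteq> 0 \<Longrightarrow>
      rat_val q (qnorm (x * y)) = rat_val q (qnorm x) + rat_val q (qnorm y)"
    and "\<And>x y. x \<in> F \<Longrightarrow> x \<noteq> 0 \<Longrightarrow> y \<in> F \<Longrightarrow> y \<noteq> 0 \<Longrightarrow> x + y \<noteq> 0 \<Longrightarrow>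
      min (rat_val q (qnorm x)) (rat_val q (qnorm y)) \<le> rat_val q (qnorm (x + y))"
proof -
  interpret Q: field_valuation "UNIV :: rat set" "rat_val q" by (rule rat_field_valuation[OF q])
  show mult: "rat_val q (qnorm (x * y)) = rat_val q (qnorm x) + rat_val q (qnorm y)"
    if "x \<in> F" "x \<noteq> 0" "y \<in> F" "y \<noteq> 0" for x y
    using that qnorm_nonzero Q.v_mult by (simp add: qnorm_mult)
  have wlog: "rat_val q (qnorm x) \<le> rat_val q (qnorm (x + y))"
    if xy: "x \<in> F" "x \<noteq> 0" "y \<in> F" "y \<noteq> 0" "x + y \<noteq> 0" "rat_val q (qnorm x) \<le> rat_val q (qnorm y)" for x y
  proof -
    define z where "z = y / x"
    have zF: "z \<in> F" "z \<noteq> 0" using xy by (simp_all add: z_def)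
    have y: "y = x * z" using xy(2) by (simp add: z_def)
    have Wz: "rat_val q (qnorm z) \<ge> 0" using mult[of x z] xy zF by (simp add: y)
    obtain a b where z: "z = quad a b" using zF(1) by (rule mem_F_E)
    have n0: "Q.vge 0 (qnorm z)" using Wz by (simp add: Q.vge_def)
    then have "Q.vge 0 a" using H[of a b] by (simp add: z qnorm_quad)
    then have "Q.vge 0 (1 + of_int 2 * a + qnorm z)"
      using Q.vge_mult[OF Q.vge_of_int[of 2]] n0 Q.vge_of_int[of 1] by (intro Q.vge_add) force+
    moreover have z1: "1 + z = quad (1 + a) b" using quad_add[of 1 0 a b] by (simp add: z quad_def)
    have "qnorm (1 + z) = 1 + of_int 2 * a + qnorm z" unfolding z1 unfolding z qnorm_quad
      by (simp add: power2_eq_square algebra_simps)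
    ultimately have "Q.vge 0 (qnorm (1 + z))" by simp
    moreover have nz: "1 + z \<noteq> 0" using xy(5) y by (metis distrib_left mult.right_neutral mult_zero_right)
    then have "qnorm (1 + z) \<noteq> 0" using qnorm_nonzero zF by simp
    ultimately have "rat_val q (qnorm (1 + z)) \<ge> 0" by (simp add: Q.vge_def)
    moreover have "x + y = x * (1 + z)" unfolding y by (simp add: algebra_simps)
    ultimately show ?thesis using mult[of x "1 + z"] xy nz zF by simp
  qed
  show "min (rat_val q (qnorm x)) (rat_val q (qnorm y)) \<le> rat_val q (qnorm (x + y))"
    if "x \<in> F" "x \<noteq> 0" "y \<in> F" "y \<noteq> 0" "x + y \<noteq> 0" for x y
    using wlog[of x y] wlog[of y x] that by (simp add: add.commute min_def)
qed

text \<open>If \<open>p\<close> is not a square modulo \<open>q\<close>, then \<open>a\<^sup>2\<close> and \<open>p b\<^sup>2\<close> cannot cancel modulo \<open>q\<close>, even when \<open>a\<close> and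
  \<open>b\<close> have the same valuation.\<close>
lemma inert_norm:
  assumes q: "Factorial_Ring.prime q" "q \<noteq> p" and nr: "\<And>s. \<not> int q dvd s\<^sup>2 - int p"
    and ab: "a \<noteq> 0 \<or> b \<noteq> 0"
  obtains m where "rat_val q (a\<^sup>2 - of_nat p * b\<^sup>2) = 2 * m" "field_valuation.vge UNIV (rat_val q) m a"
proof -
  interpret Q: field_valuation "UNIV :: rat set" "rat_val q" by (rule rat_field_valuation[OF q(1)])
  have qI: "Factorial_Ring.prime (int q)" using q by simp
  have "\<not> int q dvd int p" using primes_dvd_imp_eq[OF q(1) prime_p] q(2) by auto
  then have vp: "rat_val q (of_nat p) = 0"
    using rat_val_of_int[OF q(1), of "int p"] p_pos by (simp add: not_dvd_imp_multiplicity_0)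
  have va: "rat_val q (a\<^sup>2) = 2 * rat_val q a" if "a \<noteq> 0"
    using that rat_val_power[OF q(1), of a 2] by simp
  have vb: "rat_val q (of_nat p * b\<^sup>2) = 2 * rat_val q b" if "b \<noteq> 0"
    using that rat_val_power[OF q(1), of b 2] rat_val_mult[OF q(1), of "of_nat p" "b\<^sup>2"] vp p_pos by simp
  consider "a = 0" | "b = 0" | "a \<noteq> 0" "b \<noteq> 0" "rat_val q a < rat_val q b"
    | "a \<noteq> 0" "b \<noteq> 0" "rat_val q b < rat_val q a" | "a \<noteq> 0" "b \<noteq> 0" "rat_val q a = rat_val q b"
    by linarith
  then show thesis
  proof cases
    case 1
    then have "rat_val q (a\<^sup>2 - of_nat p * b\<^sup>2) = 2 * rat_val q b"
      using vb ab Q.v_uminus[of "of_nat p * b\<^sup>2"] by simp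
    then show thesis using 1 by (intro that) simp_all
  next
    case 2
    then show thesis using va ab by (intro that[of "rat_val q a"]) (simp_all add: Q.vge_def)
  next
    case 3
    then have "Q.vge (rat_val q (a\<^sup>2) + 1) (- (of_nat p * b\<^sup>2))"
      using va vb by (intro Q.vge_uminus) (simp add: Q.vge_def)
    from Q.v_add_eq(2)[OF _ _ this] show thesis using 3 va by (intro that[of "rat_val q a"]) (simp_all add: Q.vge_def)
  next
    case 4
    then have "Q.vge (rat_val q (- (of_nat p * b\<^sup>2)) + 1) (a\<^sup>2)"
      using va vb Q.v_uminus[of "of_nat p * b\<^sup>2"] by (simp add: Q.vge_def)
    from Q.v_add_eq(2)[OF _ _ this] have "rat_val q (- (of_nat p * b\<^sup>2) + a\<^sup>2) = 2 * rat_val q b"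
      using 4 vb p_pos Q.v_uminus[of "of_nat p * b\<^sup>2"] by simp
    then show thesis using 4 by (intro that[of "rat_val q b"]) (simp_all add: Q.vge_def)
  next
    case 5
    define c where "c = a / b"
    have c: "c \<noteq> 0" "rat_val q c = 0" using 5 Q.v_divide[of a b] by (simp_all add: c_def)
    obtain x y where xy: "quotient_of c = (x, y)" by (cases "quotient_of c")
    have cx: "c = of_int x / of_int y" "y > 0" "coprime x y"
      using quotient_of_div[OF xy] quotient_of_denom_pos[OF xy] quotient_of_coprime[OF xy] by blast+
    have x0: "x \<noteq> 0" using c cx by auto
    have "multiplicity (int q) x = multiplicity (int q) y"
      using c(2) rat_val_frac[OF q(1) x0, of y] cx by simp
    then have "int q dvd x \<longleftrightarrow> int q dvd y"
      using x0 cx(2) qI by (metis less_irrefl multiplicity_eq_zero_iff not_prime_unit)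
    moreover have "\<not> (int q dvd x \<and> int q dvd y)"
      using cx(3) qI by (metis coprime_common_divisor not_prime_unit)
    ultimately have ny: "\<not> int q dvd y" by blast
    have "\<not> int q dvd x\<^sup>2 - int p * y\<^sup>2"
    proof
      assume d: "int q dvd x\<^sup>2 - int p * y\<^sup>2"
      have "coprime y (int q)" using ny qI by (metis prime_imp_coprime coprime_commute)
      then obtain h :: int where h: "[y * h = 1] (mod int q)" by (metis cong_solve_coprime_int)
      have "[int p * (y * h)\<^sup>2 = int p * 1\<^sup>2] (mod int q)" by (intro cong_scalar_left cong_pow h)
      moreover have "[x\<^sup>2 * h\<^sup>2 = int p * y\<^sup>2 * h\<^sup>2] (mod int q)"
        using d by (intro cong_scalar_right) (simp add: cong_iff_dvd_diff)
      ultimately have "[(x * h)\<^sup>2 = int p] (mod int q)"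
        by (simp add: power_mult_distrib mult.assoc) (metis cong_trans)
      then show False using nr by (simp add: cong_iff_dvd_diff)
    qed
    then have m0: "multiplicity (int q) (x\<^sup>2 - int p * y\<^sup>2) = 0" "x\<^sup>2 - int p * y\<^sup>2 \<noteq> 0"
      by (auto simp: not_dvd_imp_multiplicity_0)
    have my: "multiplicity (int q) (y\<^sup>2) = 0"
      using ny qI by (intro not_dvd_imp_multiplicity_0) (simp add: prime_dvd_power_iff)
    have "c\<^sup>2 - of_nat p = of_int (x\<^sup>2 - int p * y\<^sup>2) / of_int (y\<^sup>2)"
      using cx(2) by (simp add: cx(1) power_divide diff_divide_distrib)
    note cp = this
    have y2: "y\<^sup>2 \<noteq> 0" using cx(2) by simp
    have v0: "rat_val q (c\<^sup>2 - of_nat p) = 0"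
      unfolding cp rat_val_frac[OF q(1) m0(2) y2] m0(1) my by simp
    have v1: "c\<^sup>2 - of_nat p \<noteq> 0"
      unfolding cp divide_eq_0_iff of_int_eq_0_iff using m0(2) y2 by blast
    note v0 = v0 v1
    have "a\<^sup>2 - of_nat p * b\<^sup>2 = b\<^sup>2 * (c\<^sup>2 - of_nat p)"
      using 5(2) by (simp add: c_def power_divide algebra_simps)
    then have "rat_val q (a\<^sup>2 - of_nat p * b\<^sup>2) = 2 * rat_val q b"
      using rat_val_mult[OF q(1), of "b\<^sup>2" "c\<^sup>2 - of_nat p"] v0 5(2) rat_val_power[OF q(1), of b 2] by simp
    then show thesis using 5 by (intro that[of "rat_val q b"]) (simp_all add: Q.vge_def)
  qed
qed

text \<open>At \<open>q = p\<close> the valuations of \<open>a\<^sup>2\<close> and \<open>p b\<^sup>2\<close> have different parities, so there is no cancellation.\<close>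
lemma ramified_norm:
  assumes "field_valuation.vge UNIV (rat_val p) 0 (a\<^sup>2 - of_nat p * b\<^sup>2)"
  shows "field_valuation.vge UNIV (rat_val p) 0 a"
proof (rule ccontr)
  interpret Q: field_valuation "UNIV :: rat set" "rat_val p" by (rule rat_field_valuation[OF prime_p])
  assume "\<not> Q.vge 0 a"
  then have a: "a \<noteq> 0" "rat_val p a < 0" by (auto simp: Q.vge_def)
  have va: "rat_val p (a\<^sup>2) = 2 * rat_val p a" using a rat_val_power[OF prime_p, of a 2] by simp
  have "Q.vge (rat_val p (a\<^sup>2) + 1) (- (a\<^sup>2 - of_nat p * b\<^sup>2))"
    using va a by (intro Q.vge_uminus Q.vge_mono[OF assms]) simp
  from Q.v_add_eq[OF _ _ this] have b: "of_nat p * b\<^sup>2 \<noteq> 0" "rat_val p (of_nat p * b\<^sup>2) = 2 * rat_val p a"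
    using a va by simp_all
  then have "rat_val p (of_nat p * b\<^sup>2) = 1 + 2 * rat_val p b"
    using rat_val_mult[OF prime_p, of "of_nat p" "b\<^sup>2"] rat_val_prime[OF prime_p] rat_val_power[OF prime_p, of b 2] by simp
  then have "2 * rat_val p a = 1 + 2 * rat_val p b" using b(2) by simp
  then show False by presburger
qed

text \<open>The hypothesis concerns all places whose value at 2 is the one expected above \<open>q\<close>; this treats elements with even
  valuations everywhere and those with even valuations away from 2 alike. The second statement fails for
  \<open>q = p\<close>, because \<open>p\<close> is a square in the field.\<close>
theorem even_valuations:
  assumes q: "Factorial_Ring.prime q" and x: "x \<in> F" "x \<noteq> 0"
    and even: "\<And>v. discrete_valuation K v \<Longrightarrow> v 2 = rat_val q 2 \<Longrightarrow> even (v x)"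
  shows "even (rat_val q (qnorm x))" and "q \<noteq> p \<Longrightarrow> x = of_rat a \<Longrightarrow> even (rat_val q a)"
proof -
  have "even (rat_val q (qnorm x)) \<and> (q \<noteq> p \<longrightarrow> x = of_rat a \<longrightarrow> even (rat_val q a))"
  proof (cases "\<exists>r. padic_root p q r")
    case True
    then obtain r where "padic_root p q r" by blast
    then interpret P: padic_root p q r .
    interpret N: padic_root p q "\<lambda>k. - r k" by (rule P.neg_root)
    have 2: "P.V 2 = rat_val q 2" "N.V 2 = rat_val q 2" using P.V_of_rat[of 2] N.V_of_rat[of 2] by simp_all
    have "even (P.V x)" "even (N.V x)"
      using even P.discrete_valuation_V N.discrete_valuation_V 2 by blast+
    then show ?thesis using P.V_qconj[OF x] P.V_of_rat[of a] x by (metis even_add of_rat_0)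
  next
    case False
    interpret Q: field_valuation "UNIV :: rat set" "rat_val q" by (rule rat_field_valuation[OF q])
    have "padic_root p 2 r" if "\<And>k. 2 ^ (k + 3) dvd (r k)\<^sup>2 - int p" "\<And>k. 2 ^ k dvd r (Suc k) - r k" for r
    proof unfold_locales
      show "int 2 ^ k dvd (r k)\<^sup>2 - int p" for k
        using that(1)[of k] by (simp add: power_add) (metis dvd_mult_left)
    qed (use that(2) in simp_all)
    \<comment> \<open>2 splits, because \<open>p\<close> has a 2-adic square root.\<close>
    then have q2: "q \<noteq> 2" using two_adic_roots False by metis
    have v2: "rat_val q 2 = 0"
    proof -
      have "\<not> int q dvd 2" using prime_ge_2_nat[OF q] q2 zdvd_not_zless[of 2 "int q"] by simp
      then show ?thesis using rat_val_of_int[OF q, of 2] by (simp add: not_dvd_imp_multiplicity_0)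
    qed
    have n2: "qnorm 2 = 4" using qnorm_of_rat[of 2] by simp
    have v4: "rat_val q 4 = 0" using rat_val_mult[OF q, of 2 2] v2 by simp
    show ?thesis
    proof (cases "q = p")
      case True
      define W where "W y = rat_val q (qnorm y)" for y
      have H: "Q.vge 0 (a\<^sup>2 - of_nat p * b\<^sup>2) \<Longrightarrow> Q.vge 0 a" for a b
        using ramified_norm[of a b] unfolding True .
      have Wm: "W (y * z) = W y + W z" if "y \<in> F" "y \<noteq> 0" "z \<in> F" "z \<noteq> 0" for y z
        unfolding W_def by (rule norm_valuation(1)[OF q _ that]) (rule H)
      have "discrete_valuation K W"
      proof (rule discrete_valuationI)
        fix k
        have "rt = quad 0 1" by (simp add: quad_def)
        then have "qnorm rt = - of_nat p" by (simp add: qnorm_quad)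
        then have W1: "W rt = 1" using rat_val_prime[OF q] Q.v_uminus[of "of_nat p"] True by (simp add: W_def)
        have rt0: "rt \<noteq> 0" using p_pos by simp
        have "W (rt ^ n) = int n" for n
        proof (induction n)
          case 0
          show ?case using qnorm_of_rat[of 1] rat_val_one[OF q] by (simp add: W_def)
        next
          case (Suc n)
          have "rt ^ n \<in> F" by (induction n) simp_all
          then show ?case using Wm[of rt "rt ^ n"] Suc W1 rt0 by simp
        qed
        moreover have "W (inverse y) = - W y" if "y \<in> F" "y \<noteq> 0" for y
          using Wm[of y "inverse y"] that qnorm_of_rat[of 1] rat_val_one[OF q] by (simp add: W_def)
        moreover have "rt ^ n \<in> F" for n by (induction n) simp_all
        ultimately have "W (rt powi k) = k" "rt powi k \<in> F" using rt0
          by (simp_all add: power_int_def power_inverse)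
        then show "\<exists>x\<in>F. x \<noteq> 0 \<and> W x = k" using rt0 by (intro bexI[of _ "rt powi k"]) simp_all
      qed (use norm_valuation[OF q H] in \<open>simp_all add: W_def\<close>)
      moreover have "W 2 = rat_val q 2" using v2 v4 n2 by (simp add: W_def)
      ultimately have "even (W x)" by (rule even)
      then show ?thesis using True by (simp add: W_def)
    next
      case np: False
      have nr: "\<not> int q dvd s\<^sup>2 - int p" for s using odd_prime_roots[OF q q2 np] False by metis
      have half: "\<exists>m. rat_val q (qnorm y) = 2 * m" if y: "y \<in> F" "y \<noteq> 0" for y
      proof -
        obtain a b where ab: "y = quad a b" using y(1) by (rule mem_F_E)
        then have "a \<noteq> 0 \<or> b \<noteq> 0" using y(2) by (auto simp: quad_eq_0_iff)
        then show ?thesis using inert_norm[OF q np nr, of a b] unfolding ab qnorm_quad by metis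
      qed
      have H: "Q.vge 0 a" if n: "Q.vge 0 (a\<^sup>2 - of_nat p * b\<^sup>2)" for a b
      proof (cases "a = 0")
        case False
        then obtain m where m: "rat_val q (a\<^sup>2 - of_nat p * b\<^sup>2) = 2 * m" "Q.vge m a"
          using inert_norm[OF q np nr, of a b] by blast
        have "m \<ge> 0" using n m(1) norm_nonzero[of a b] False by (simp add: Q.vge_def)
        then show ?thesis by (rule Q.vge_mono[OF m(2)])
      qed simp
      define V where "V y = rat_val q (qnorm y) div 2" for y
      have V2: "2 * V y = rat_val q (qnorm y)" if "y \<in> F" "y \<noteq> 0" for y
        using half[OF that] by (auto simp: V_def)
      have Vr: "V (of_rat c) = rat_val q c" if "c \<noteq> 0" for c
        using that rat_val_power[OF q, of c 2] by (simp add: V_def qnorm_of_rat)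
      have "discrete_valuation K V"
      proof (rule discrete_valuationI)
        fix k
        obtain c where "c \<in> UNIV" "c \<noteq> 0" "rat_val q c = k" by (rule Q.v_surj)
        then show "\<exists>x\<in>F. x \<noteq> 0 \<and> V x = k" using Vr by (intro bexI[of _ "of_rat c"]) simp_all
      next
        fix y z assume yz: "y \<in> F" "y \<noteq> 0" "z \<in> F" "z \<noteq> 0"
        have "2 * V (y * z) = 2 * V y + 2 * V z"
          using norm_valuation(1)[OF q H yz] V2 yz by simp
        then show "V (y * z) = V y + V z" by simp
        assume "y + z \<noteq> 0"
        then have "min (2 * V y) (2 * V z) \<le> 2 * V (y + z)"
          using norm_valuation(2)[OF q H yz] V2 yz by simp
        then show "min (V y) (V z) \<le> V (y + z)" by (simp add: min_def split: if_splits)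
      qed
      moreover have "V 2 = rat_val q 2" using Vr[of 2] by simp
      ultimately have "even (V x)" by (rule even)
      then show ?thesis using V2[OF x] Vr[of a] x by auto (metis dvd_triv_left)
    qed
  qed
  then show "even (rat_val q (qnorm x))" "q \<noteq> p \<Longrightarrow> x = of_rat a \<Longrightarrow> even (rat_val q a)" by blast+
qed

end

section \<open>Elements with even valuations\<close>

text \<open>A rational number is, up to squares, a sign times the product of the primes at which its valuation is odd.\<close>
lemma rat_square_class:
  assumes r: "r \<noteq> 0" and T: "\<And>q. Factorial_Ring.prime q \<Longrightarrow> odd (rat_val q r) \<Longrightarrow> q \<in> T"
  obtains D \<epsilon> c where "D \<subseteq> T" "\<epsilon> \<in> {1, -1 :: int}" "c \<noteq> 0" "r = of_int (\<epsilon> * int (\<Prod>D)) * c\<^sup>2"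
proof -
  obtain a b where ab: "b > 0" "r = of_int a / of_int b" by (rule rat_int_frac)
  define n where "n = a * b"
  define s where "s = squarefree_part n"
  define t where "t = square_part n"
  have a0: "a \<noteq> 0" using ab r by auto
  have n0: "n \<noteq> 0" using a0 ab(1) by (simp add: n_def)
  have n: "n = s * t\<^sup>2" unfolding s_def t_def by (rule squarefree_decompose)
  then have t0: "t \<noteq> 0" and s0: "s \<noteq> 0" using n0 by auto
  have rs: "r = of_int s * (of_int t / of_int b)\<^sup>2"
  proof -
    have "r = of_int n / (of_int b)\<^sup>2" using ab by (simp add: n_def power2_eq_square)
    then show ?thesis unfolding n by (simp add: power_divide)
  qed
  define D where "D = nat ` prime_factors s"
  have D: "q \<in> T" and mult1: "multiplicity (int q) s = 1" if q: "int q \<in> prime_factors s" for q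
  proof -
    have pq: "Factorial_Ring.prime (int q)" by (rule in_prime_factors_imp_prime[OF q])
    have "multiplicity (int q) s > 0"
      using q s0 by (auto simp: prime_factors_multiplicity)
    moreover have m: "multiplicity (int q) s = multiplicity (int q) n mod 2"
      unfolding s_def by (rule prime_multiplicity_squarefree_part[OF pq])
    ultimately show "multiplicity (int q) s = 1" by linarith
    then have "odd (multiplicity (int q) n)" using m by presburger
    then have "odd (multiplicity (int q) a + multiplicity (int q) b)"
      using pq a0 ab(1) by (simp add: n_def prime_elem_multiplicity_mult_distrib)
    then have "odd (rat_val q r)" using rat_val_frac[of q a b] pq a0 ab by simp
    then show "q \<in> T" using T pq by simp
  qed
  have pos: "int (nat x) = x" if "x \<in> prime_factors s" for x
    using that prime_gt_0_int[of x] by auto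
  have DT: "D \<subseteq> T" using D pos by (auto simp: D_def)
  have "\<bar>s\<bar> = (\<Prod>x\<in>prime_factors s. x ^ multiplicity x s)"
    using prod_prime_factors[OF s0] by simp
  also have "\<dots> = (\<Prod>x\<in>prime_factors s. int (nat x))"
    using mult1 pos by (intro prod.cong refl) (metis power_one_right)
  also have "\<dots> = int (\<Prod>D)"
  proof -
    have inj: "inj_on nat (prime_factors s)" by (rule inj_onI) (metis pos)
    show ?thesis unfolding D_def of_nat_prod prod.reindex[OF inj] by simp
  qed
  finally have "s = 1 * int (\<Prod>D) \<or> s = (-1) * int (\<Prod>D)" by auto
  then obtain \<epsilon> :: int where "\<epsilon> \<in> {1, -1}" "s = \<epsilon> * int (\<Prod>D)" by blast
  then show thesis using that[OF DT, of \<epsilon> "of_int t / of_int b"] rs t0 ab(1) by simp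
qed

context real_quadratic
begin

definition sq_equiv :: "real \<Rightarrow> real \<Rightarrow> bool" where
  "sq_equiv x y \<longleftrightarrow> (\<exists>z\<in>F. z \<noteq> 0 \<and> y = z * z * x)"

lemma sq_equiv_refl: "sq_equiv x x" unfolding sq_equiv_def by (intro bexI[of _ 1]) simp_all

lemma sq_equiv_trans: assumes "sq_equiv x y" "sq_equiv y t" shows "sq_equiv x t"
proof -
  obtain z1 z2 where z: "z1 \<in> F" "z1 \<noteq> 0" "y = z1 * z1 * x" "z2 \<in> F" "z2 \<noteq> 0" "t = z2 * z2 * y"
    using assms by (auto simp: sq_equiv_def)
  then have "t = (z2 * z1) * (z2 * z1) * x" by simp
  then show ?thesis unfolding sq_equiv_def using z by (intro bexI[of _ "z2 * z1"]) simp_all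
qed

lemma sq_equiv_sym: assumes "sq_equiv x y" shows "sq_equiv y x"
proof -
  obtain z where z: "z \<in> F" "z \<noteq> 0" "y = z * z * x" using assms by (auto simp: sq_equiv_def)
  then have "x = inverse z * inverse z * y" by (simp add: field_simps)
  then show ?thesis unfolding sq_equiv_def using z by (intro bexI[of _ "inverse z"]) simp_all
qed

lemma sq_equiv_mult_right: assumes "sq_equiv x y" shows "sq_equiv (x * t) (y * t)"
  using assms unfolding sq_equiv_def by (metis mult.assoc)

lemma sq_equiv_square: assumes "z \<in> F" "z \<noteq> 0" shows "sq_equiv x (z * z * x)"
  using assms unfolding sq_equiv_def by blast

lemma of_int_mem_F [simp]: "of_int k \<in> F" using of_rat_mem[of "of_int k"] by simp

lemma numeral_mem_F [simp]: "numeral k \<in> F" using of_int_mem_F[of "numeral k"] by simp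

lemma sq_class_eq_sq_equiv:
  assumes "x \<in> F" "x \<noteq> 0" "y \<in> F" "y \<noteq> 0"
  shows "sq_class K x = sq_class K y \<longleftrightarrow> sq_equiv x y"
proof -
  interpret K: plain_field K by (rule plain_field_K)
  show ?thesis using K.sq_class_eq_iff[of x y] assms by (auto simp: sq_equiv_def)
qed

lemma field_valuationI: "discrete_valuation K v \<Longrightarrow> field_valuation F v"
  by unfold_locales

text \<open>Even valuation at all finite places not above 2, the property defining the ambient group \<open>K(S)\<close>.\<close>
definition unram :: "real \<Rightarrow> bool" where
  "unram x \<longleftrightarrow> (\<forall>v. discrete_valuation K v \<longrightarrow> \<not> v 2 > 0 \<longrightarrow> even (v x))"

definition even_everywhere :: "real \<Rightarrow> bool" where
  "even_everywhere x \<longleftrightarrow> (\<forall>v. discrete_valuation K v \<longrightarrow> even (v x))"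

lemma even_v_sq_equiv:
  assumes "sq_equiv x y" "x \<in> F" "x \<noteq> 0" "discrete_valuation K v" shows "even (v y) \<longleftrightarrow> even (v x)"
proof -
  interpret field_valuation F v by (rule field_valuationI[OF assms(4)])
  obtain z where z: "z \<in> F" "z \<noteq> 0" "y = z * z * x" using assms(1) by (auto simp: sq_equiv_def)
  then have "v y = 2 * v z + v x" using assms by (simp add: v_mult)
  then show ?thesis by simp
qed

lemma unram_sq_equiv: "sq_equiv x y \<Longrightarrow> x \<in> F \<Longrightarrow> x \<noteq> 0 \<Longrightarrow> unram y \<longleftrightarrow> unram x"
  unfolding unram_def using even_v_sq_equiv by blast

lemma even_everywhere_sq_equiv: "sq_equiv x y \<Longrightarrow> x \<in> F \<Longrightarrow> x \<noteq> 0 \<Longrightarrow> even_everywhere y \<longleftrightarrow> even_everywhere x"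
  unfolding even_everywhere_def using even_v_sq_equiv by blast

lemma unram_mult:
  assumes "x \<in> F" "x \<noteq> 0" "y \<in> F" "y \<noteq> 0" "unram x" "unram y" shows "unram (x * y)"
  unfolding unram_def
proof (intro allI impI)
  fix v assume v: "discrete_valuation K v" "\<not> v 2 > 0"
  interpret field_valuation F v by (rule field_valuationI[OF v(1)])
  show "even (v (x * y))" using assms v by (simp add: unram_def v_mult)
qed

lemma even_everywhere_mult:
  assumes "x \<in> F" "x \<noteq> 0" "y \<in> F" "y \<noteq> 0" "even_everywhere x" "even_everywhere y"
  shows "even_everywhere (x * y)"
  unfolding even_everywhere_def
proof (intro allI impI)
  fix v assume v: "discrete_valuation K v"
  interpret field_valuation F v by (rule field_valuationI[OF v(1)])
  show "even (v (x * y))" using assms v by (simp add: even_everywhere_def v_mult)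
qed

lemma rat_val_two_odd_prime:
  assumes "Factorial_Ring.prime q" "q \<noteq> 2" shows "rat_val q 2 = 0"
proof -
  have "\<not> int q dvd 2" using prime_ge_2_nat[OF assms(1)] assms(2) zdvd_not_zless[of 2 "int q"] by simp
  then show ?thesis using rat_val_of_int[OF assms(1), of 2] by (simp add: not_dvd_imp_multiplicity_0)
qed

lemma unram_rat_val:
  assumes "x \<in> F" "x \<noteq> 0" "unram x" "Factorial_Ring.prime q" "q \<noteq> 2"
  shows "even (rat_val q (qnorm x))" "q \<noteq> p \<Longrightarrow> x = of_rat a \<Longrightarrow> even (rat_val q a)"
  using even_valuations[OF assms(4,1,2)] assms(3) rat_val_two_odd_prime[OF assms(4,5)]
  unfolding unram_def by fastforce+

lemma even_everywhere_rat_val: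
  assumes "x \<in> F" "x \<noteq> 0" "even_everywhere x" "Factorial_Ring.prime q"
  shows "even (rat_val q (qnorm x))" "q \<noteq> p \<Longrightarrow> x = of_rat a \<Longrightarrow> even (rat_val q a)"
  using even_valuations[OF assms(4,1,2)] assms(3)
  unfolding even_everywhere_def by blast+

lemma unram_qnorm:
  assumes "x \<in> F" "x \<noteq> 0" "unram x"
  obtains s c where "s \<in> {1, -1, 2, -2}" "c \<noteq> 0" "qnorm x = s * c\<^sup>2"
proof -
  obtain D \<epsilon> c where D: "D \<subseteq> {2}" "\<epsilon> \<in> {1, -1 :: int}" "c \<noteq> 0" "qnorm x = of_int (\<epsilon> * int (\<Prod>D)) * c\<^sup>2"
    using rat_square_class[OF qnorm_nonzero[OF assms(1,2)], of "{2}"] unram_rat_val(1)[OF assms] by blast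
  have "D = {} \<or> D = {2}" using D(1) by blast
  then have "of_int (\<epsilon> * int (\<Prod>D)) \<in> {1, -1, 2, -2 :: rat}" using D(2) by auto
  then show thesis using that D(3,4) by blast
qed

lemma even_everywhere_qnorm:
  assumes "x \<in> F" "x \<noteq> 0" "even_everywhere x"
  obtains s c where "s \<in> {1, -1}" "c \<noteq> 0" "qnorm x = s * c\<^sup>2"
proof -
  obtain D \<epsilon> c where D: "D \<subseteq> {}" "\<epsilon> \<in> {1, -1 :: int}" "c \<noteq> 0" "qnorm x = of_int (\<epsilon> * int (\<Prod>D)) * c\<^sup>2"
    using rat_square_class[OF qnorm_nonzero[OF assms(1,2)], of "{}"] even_everywhere_rat_val(1)[OF assms] by blast
  have "of_int (\<epsilon> * int (\<Prod>D)) \<in> {1, -1 :: rat}" using D(1,2) by auto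
  then show thesis using that D(3,4) by blast
qed

text \<open>Hilbert 90 for \<open>x / c\<close>, which has norm 1, in explicit form: \<open>N(x) = c\<^sup>2\<close> implies
  \<open>(x + c)\<^sup>2 = x (Tr(x) + 2 c)\<close>.\<close>
lemma square_norm_rational:
  assumes x: "x \<in> F" "x \<noteq> 0" and c: "qnorm x = c\<^sup>2"
  obtains r where "r \<noteq> 0" "sq_equiv (of_rat r) x"
proof (cases "x = - of_rat c")
  case True
  then have "x = of_rat (- c)" by (simp add: of_rat_minus)
  then show thesis using that[of "- c"] x(2) sq_equiv_refl by auto
next
  case False
  obtain a b where ab: "x = quad a b" using x(1) by (rule mem_F_E)
  define t where "t = 2 * a + 2 * c"
  define y where "y = x + of_rat c"
  have y: "y \<in> F" "y \<noteq> 0" using x False by (simp_all add: y_def add_eq_0_iff2)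
  have yy: "y * y = x * of_rat t"
  proof -
    have ye: "y = quad (a + c) b" by (simp add: y_def ab quad_def of_rat_add)
    have "c\<^sup>2 = a\<^sup>2 - of_nat p * b\<^sup>2" using c by (simp add: ab qnorm_quad)
    then show ?thesis unfolding ye ab quad_rat[symmetric] quad_mult quad_inj
      by (simp add: t_def power2_eq_square algebra_simps)
  qed
  have t0: "t \<noteq> 0" using yy y(2) by auto
  define z where "z = y / of_rat t"
  have "x = z * z * of_rat t" using yy t0 by (simp add: z_def field_simps)
  moreover have "z \<in> F" "z \<noteq> 0" using y t0 by (simp_all add: z_def)
  ultimately have "sq_equiv (of_rat t) x" using sq_equiv_square by metis
  then show thesis using that t0 by blast
qed

lemma of_rat_sq_equiv:
  assumes "r = of_int s * c\<^sup>2" "c \<noteq> 0" shows "sq_equiv (of_int s) (of_rat r)"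
proof -
  have "(of_rat r :: real) = of_rat c * of_rat c * of_int s"
    using assms(1) by (simp add: of_rat_mult of_rat_power power2_eq_square mult.commute)
  then show ?thesis using sq_equiv_square[of "of_rat c" "of_int s"] assms(2) by simp
qed

lemma sq_equiv_p: "sq_equiv s (s * of_nat p)"
  using sq_equiv_square[of rt s] p_pos by (simp add: mult.commute)

lemma unram_of_rat:
  assumes "r \<noteq> 0" "unram (of_rat r)"
  obtains s where "s \<in> {1, -1, 2, -2}" "sq_equiv s (of_rat r)"
proof -
  have "q \<in> {2, p}" if "Factorial_Ring.prime q" "odd (rat_val q r)" for q
    using unram_rat_val(2)[of "of_rat r" q r] assms that by auto
  then obtain D \<epsilon> c where D: "D \<subseteq> {2, p}" "\<epsilon> \<in> {1, -1 :: int}" "c \<noteq> 0" "r = of_int (\<epsilon> * int (\<Prod>D)) * c\<^sup>2"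
    using rat_square_class[OF assms(1), of "{2, p}"] by blast
  have s: "sq_equiv (of_int (\<epsilon> * int (\<Prod>D))) (of_rat r)" by (rule of_rat_sq_equiv[OF D(4,3)])
  have "2 \<noteq> p" using p_odd by auto
  moreover have "D = {} \<or> D = {2} \<or> D = {p} \<or> D = {2, p}" using D(1) by blast
  ultimately have "\<exists>t\<in>{1, 2 :: real}. of_nat (\<Prod>D) = t \<or> of_nat (\<Prod>D) = t * of_nat p"
    by (elim disjE) simp_all
  then obtain t :: real where t: "t \<in> {1, 2}" "of_nat (\<Prod>D) = t \<or> of_nat (\<Prod>D) = t * of_nat p" by blast
  have "sq_equiv (of_int \<epsilon> * t) (of_int (\<epsilon> * int (\<Prod>D)))"
    using t(2) sq_equiv_refl sq_equiv_p[of "of_int \<epsilon> * t"] by (auto simp: mult.assoc)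
  then have "sq_equiv (of_int \<epsilon> * t) (of_rat r)" using s sq_equiv_trans by blast
  moreover have "of_int \<epsilon> * t \<in> {1, -1, 2, -2}" using t(1) D(2) by auto
  ultimately show thesis using that by blast
qed

lemma even_everywhere_of_rat:
  assumes "r \<noteq> 0" "even_everywhere (of_rat r)"
  obtains s where "s \<in> {1, -1}" "sq_equiv s (of_rat r)"
proof -
  have "q \<in> {p}" if "Factorial_Ring.prime q" "odd (rat_val q r)" for q
    using even_everywhere_rat_val(2)[of "of_rat r" q r] assms that by auto
  then obtain D \<epsilon> c where D: "D \<subseteq> {p}" "\<epsilon> \<in> {1, -1 :: int}" "c \<noteq> 0" "r = of_int (\<epsilon> * int (\<Prod>D)) * c\<^sup>2"
    using rat_square_class[OF assms(1), of "{p}"] by blast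
  have s: "sq_equiv (of_int (\<epsilon> * int (\<Prod>D))) (of_rat r)" by (rule of_rat_sq_equiv[OF D(4,3)])
  have "D = {} \<or> D = {p}" using D(1) by blast
  then have "(of_int (\<epsilon> * int (\<Prod>D)) :: real) = of_int \<epsilon> \<or> (of_int (\<epsilon> * int (\<Prod>D)) :: real) = of_int \<epsilon> * of_nat p"
    by auto
  then have "sq_equiv (of_int \<epsilon>) (of_int (\<epsilon> * int (\<Prod>D)))"
    using sq_equiv_refl sq_equiv_p[of "of_int \<epsilon>"] by metis
  then have "sq_equiv (of_int \<epsilon>) (of_rat r)" using s sq_equiv_trans by blast
  then show thesis using that[of "of_int \<epsilon>"] D(2) by auto
qed

lemma unram_square_norm:
  assumes "x \<in> F" "x \<noteq> 0" "unram x" "qnorm x = c\<^sup>2"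
  obtains s where "s \<in> {1, -1, 2, -2}" "sq_equiv s x"
proof -
  obtain r where r: "r \<noteq> 0" "sq_equiv (of_rat r) x" using square_norm_rational[OF assms(1,2,4)] .
  then have "unram (of_rat r)" using unram_sq_equiv[OF r(2)] assms(3) by simp
  then obtain s where "s \<in> {1, -1, 2, -2}" "sq_equiv s (of_rat r)" using unram_of_rat r(1) by blast
  then show thesis using that sq_equiv_trans r(2) by blast
qed

lemma even_everywhere_square_norm:
  assumes "x \<in> F" "x \<noteq> 0" "even_everywhere x" "qnorm x = c\<^sup>2"
  obtains s where "s \<in> {1, -1}" "sq_equiv s x"
proof -
  obtain r where r: "r \<noteq> 0" "sq_equiv (of_rat r) x" using square_norm_rational[OF assms(1,2,4)] .
  then have "even_everywhere (of_rat r)" using even_everywhere_sq_equiv[OF r(2)] assms(3) by simp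
  then obtain s where "s \<in> {1, -1}" "sq_equiv s (of_rat r)" using even_everywhere_of_rat r(1) by blast
  then show thesis using that sq_equiv_trans r(2) by blast
qed

text \<open>Away from 2 the factors \<open>a + \<surd>p\<close> and \<open>a - \<surd>p\<close> of \<open>d b\<^sup>2\<close> are coprime: a common divisor divides \<open>2 a\<close> and \<open>d b\<^sup>2\<close>.
  So at each place one of them is a unit and the other carries the even valuation of \<open>b\<^sup>2\<close>.\<close>
lemma unram_int_plus_sqrt:
  assumes e: "a\<^sup>2 - int p = d * b\<^sup>2" and "d \<noteq> 0" "b \<noteq> 0" "coprime a b"
    and d: "\<And>v. discrete_valuation K v \<Longrightarrow> \<not> v 2 > 0 \<Longrightarrow> v (of_int d) = 0"
  shows "unram (of_int a + rt)"
  unfolding unram_def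
proof (intro allI impI)
  fix v assume v: "discrete_valuation K v" "\<not> v 2 > 0"
  interpret field_valuation F v by (rule field_valuationI[OF v(1)])
  have v2: "v 2 = 0" using vge_of_int[of 2] v(2) by (simp add: vge_def)
  define x y where "x = of_int a + rt" and "y = of_int a - rt"
  have x: "x = quad (of_int a) 1" and y: "y = quad (of_int a) (-1)" by (simp_all add: x_def y_def quad_def of_rat_minus)
  have xF: "x \<in> F" "x \<noteq> 0" and yF: "y \<in> F" "y \<noteq> 0" unfolding x y by (simp_all add: quad_eq_0_iff)
  have rt0: "rt \<noteq> 0" using p_pos by simp
  have "2 * v rt = v (of_int (int p))" using v_mult[of rt rt] rt0 by simp
  then have "v rt \<ge> 0" using vge_of_int[of "int p"] p_pos by (simp add: vge_def)
  then have vrt: "vge 0 rt" by (simp add: vge_def)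
  have "vge 0 x" "vge 0 y" unfolding x_def y_def using vge_add[OF vge_of_int vrt] vge_diff[OF vge_of_int vrt] by blast+
  then have nn: "v x \<ge> 0" "v y \<ge> 0" using xF yF by (simp_all add: vge_def)
  have "x * y = of_int (a\<^sup>2 - int p)" by (simp add: x_def y_def algebra_simps power2_eq_square)
  also have "\<dots> = of_int d * (of_int b * of_int b)" unfolding e by (simp add: power2_eq_square)
  finally have "v x + v y = v (of_int d * (of_int b * of_int b))" using v_mult[of x y] xF yF by simp
  also have "\<dots> = 2 * v (of_int b)"
    using assms(2,3) d[OF v] v_mult[of "of_int d" "of_int b * of_int b"] v_mult[of "of_int b" "of_int b"] by simp
  finally have sum: "v x + v y = 2 * v (of_int b)" .
  have "\<not> (v x > 0 \<and> v y > 0)"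
  proof
    assume p: "v x > 0 \<and> v y > 0"
    then have "vge 1 (x + y)" using xF yF by (intro vge_add) (simp_all add: vge_def)
    moreover have "x + y = 2 * of_int a" by (simp add: x_def y_def)
    ultimately have "vge 1 (2 * of_int a)" by simp
    then have a: "vge 1 (of_int a)" using v_mult[of 2 "of_int a"] v2 by (cases "a = 0") (simp_all add: vge_def)
    have b: "vge 1 (of_int b)" using sum p assms(3) by (simp add: vge_def)
    obtain s t where st: "s * a + t * b = 1" using assms(4) bezout_int[of a b] by auto
    have "vge (0 + 1) (of_int s * of_int a)" "vge (0 + 1) (of_int t * of_int b)"
      using vge_mult[OF vge_of_int a] vge_mult[OF vge_of_int b] by blast+
    then have "vge (0 + 1) (of_int s * of_int a + of_int t * of_int b)" by (rule vge_add)
    moreover have "of_int s * of_int a + of_int t * of_int b = (of_int (s * a + t * b) :: real)" by simp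
    ultimately show False unfolding st by (simp add: vge_def)
  qed
  then have "v x = 0 \<or> v y = 0" using nn by linarith
  then show "even (v x)" using sum by (metis add_cancel_left_left add_cancel_right_right dvd_0_right dvd_triv_left)
qed

section \<open>The Selmer group as a product\<close>

text \<open>The elements that occur as first and as second entries of Selmer triples, respectively.\<close>
definition first_adm :: "real \<Rightarrow> bool" where
  "first_adm x \<longleftrightarrow> x \<in> F \<and> x \<noteq> 0 \<and> unram x \<and>
     (\<forall>v. discrete_valuation K v \<longrightarrow> v 2 > 0 \<longrightarrow> two_adic_place.first_cond F v x) \<and>
     (\<forall>\<sigma>. real_embedding K \<sigma> \<longrightarrow> \<sigma> x > 0)"

definition second_adm :: "real \<Rightarrow> bool" where
  "second_adm x \<longleftrightarrow> x \<in> F \<and> x \<noteq> 0 \<and> unram x \<and>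
     (\<forall>v. discrete_valuation K v \<longrightarrow> v 2 > 0 \<longrightarrow> two_adic_place.second_cond F v x)"

lemma two_adicI: "discrete_valuation K v \<Longrightarrow> v 2 > 0 \<Longrightarrow> two_adic_place F v"
  by (rule two_adic_place[OF field_valuationI])

lemma real_placeI: "real_embedding K \<sigma> \<Longrightarrow> real_place F \<sigma>"
  by unfold_locales

lemma first_adm_mult: assumes "first_adm x" "first_adm y" shows "first_adm (x * y)"
proof -
  have "two_adic_place.first_cond F v (x * y)" if "discrete_valuation K v" "v 2 > 0" for v
    using two_adic_place.first_cond_mult[OF two_adicI[OF that]] assms that by (simp add: first_adm_def)
  moreover have "\<sigma> (x * y) > 0" if "real_embedding K \<sigma>" for \<sigma>
    using real_place.sig_mult[OF real_placeI[OF that]] assms that by (simp add: first_adm_def)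
  moreover have "unram (x * y)" using assms by (intro unram_mult) (simp_all add: first_adm_def)
  ultimately show ?thesis using assms by (simp add: first_adm_def)
qed

lemma second_adm_mult: assumes "second_adm x" "second_adm y" shows "second_adm (x * y)"
proof -
  have "two_adic_place.second_cond F v (x * y)" if "discrete_valuation K v" "v 2 > 0" for v
    using two_adic_place.second_cond_mult[OF two_adicI[OF that]] assms that by (simp add: second_adm_def)
  moreover have "unram (x * y)" using assms by (intro unram_mult) (simp_all add: second_adm_def)
  ultimately show ?thesis using assms by (simp add: second_adm_def)
qed

lemma bad_places_eq:
  "bad_places K = {Finite_Place v |v. discrete_valuation K v \<and> v 2 > 0} \<union> {Real_Place \<sigma> |\<sigma>. real_embedding K \<sigma>}"
  by (simp add: bad_places_def two_of_def)

lemma unramified_class_iff: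
  assumes "x \<in> F" "x \<noteq> 0" shows "sq_class K x \<in> unramified_classes K \<longleftrightarrow> unram x"
proof -
  interpret K: plain_field K by (rule plain_field_K)
  have "sq_class K x \<in> carrier (sq_group K)" unfolding K.carrier_sq_group using assms by simp
  then have "sq_class K x \<in> unramified_classes K \<longleftrightarrow>
      (\<forall>v. discrete_valuation K v \<and> Finite_Place v \<notin> bad_places K \<longrightarrow> (\<forall>y\<in>sq_class K x. even (v y)))"
    by (simp only: unramified_classes_def mem_Collect_eq simp_thms)
  moreover have "Finite_Place v \<notin> bad_places K \<longleftrightarrow> \<not> v 2 > 0" if "discrete_valuation K v" for v
    using that by (simp add: bad_places_eq)
  moreover have "(\<forall>y\<in>sq_class K x. even (v y)) \<longleftrightarrow> even (v x)" if v: "discrete_valuation K v" for v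
  proof -
    have "y \<in> sq_class K x \<longleftrightarrow> sq_equiv x y" for y
      unfolding K.mem_sq_class_iff sq_equiv_def by auto
    then show ?thesis using even_v_sq_equiv[OF _ assms v] sq_equiv_refl[of x] by blast
  qed
  ultimately show ?thesis unfolding unram_def by metis
qed

lemma selmer_set_eq:
  "selmer_set K = {plain_field.class_triple K x y |x y. x \<in> Collect first_adm \<and> y \<in> Collect second_adm}"
proof -
  interpret K: plain_field K by (rule plain_field_K)
  have tr: "K.class_triple x y = (sq_class K x, sq_class K y, sq_class K (x * y))" for x y
    by (simp add: K.class_triple_def)
  have loc: "(\<forall>v\<in>bad_places K. local_triple K v (K.class_triple x y) \<in> kummer (completion K v) ` curve_points (completion K v))
     \<longleftrightarrow> (\<forall>v. discrete_valuation K v \<longrightarrow> v 2 > 0 \<longrightarrow> two_adic_place.first_cond F v x \<and> two_adic_place.second_cond F v y) \<and>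
         (\<forall>\<sigma>. real_embedding K \<sigma> \<longrightarrow> \<sigma> x > 0)"
    if "x \<in> F" "x \<noteq> 0" "y \<in> F" "y \<noteq> 0" for x y
    unfolding bad_places_eq tr
    using two_adic_place.local_image_two_adic[OF two_adicI that] real_place.local_image_real[OF real_placeI that]
    by blast
  have amb: "K.class_triple x y \<in> selmer_ambient K \<longleftrightarrow> unram x \<and> unram y"
    if xy: "x \<in> F" "x \<noteq> 0" "y \<in> F" "y \<noteq> 0" for x y
  proof -
    have "K.class_triple x y \<in> carrier (prod_one_triples K)"
      unfolding K.carrier_prod_one_triples using xy by auto
    then show ?thesis unfolding selmer_ambient_def tr using xy unram_mult[OF xy]
      by (auto simp: unramified_class_iff)
  qed
  show ?thesis
  proof (intro equalityI subsetI)
    fix c assume c: "c \<in> selmer_set K"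
    then have "c \<in> carrier (prod_one_triples K)" by (auto simp: selmer_set_def selmer_ambient_def)
    then obtain x y where xy: "x \<in> F" "x \<noteq> 0" "y \<in> F" "y \<noteq> 0" "c = K.class_triple x y"
      unfolding K.carrier_prod_one_triples by auto
    then have "first_adm x \<and> second_adm y"
      using c loc[OF xy(1-4)] amb[OF xy(1-4)] unfolding selmer_set_def first_adm_def second_adm_def by blast
    then show "c \<in> {K.class_triple x y |x y. x \<in> Collect first_adm \<and> y \<in> Collect second_adm}" using xy(5) by blast
  next
    fix c assume "c \<in> {K.class_triple x y |x y. x \<in> Collect first_adm \<and> y \<in> Collect second_adm}"
    then obtain x y where xy: "first_adm x" "second_adm y" "c = K.class_triple x y" by blast
    have f: "x \<in> F" "x \<noteq> 0" "y \<in> F" "y \<noteq> 0" using xy by (simp_all add: first_adm_def second_adm_def)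
    show "c \<in> selmer_set K"
      using loc[OF f] amb[OF f] xy unfolding selmer_set_def first_adm_def second_adm_def by blast
  qed
qed

lemma unram_one: "unram 1"
proof -
  have "v 1 = 0" if "discrete_valuation K v" for v
    using field_valuation.v_one[OF field_valuationI[OF that]] .
  then show ?thesis unfolding unram_def by (metis even_zero)
qed

text \<open>These are entries of the Kummer values at the points of order 2 and at infinity.\<close>
lemma conds_of_known_values: assumes "discrete_valuation K v" "v 2 > 0"
  shows "two_adic_place.first_cond F v 1" "two_adic_place.second_cond F v 1"
    "two_adic_place.second_cond F v (-1)" "two_adic_place.first_cond F v 2"
proof -
  interpret two_adic_place F v by (rule two_adicI[OF assms])
  have "(1, 1, 1) \<in> kummer_values" "(1, -1, -1) \<in> kummer_values" "(2, 1, 2) \<in> kummer_values"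
    by (simp_all add: kummer_values_def)
  then show "first_cond 1" "second_cond 1" "second_cond (-1)" "first_cond 2"
    using kummer_values_conds by blast+
qed

lemma adm_one: "first_adm 1" "second_adm 1"
proof -
  have "\<sigma> 1 > 0" if "real_embedding K \<sigma>" for \<sigma>
    using real_place.sig_one[OF real_placeI[OF that]] by simp
  then show "first_adm 1" "second_adm 1" using conds_of_known_values unram_one unfolding first_adm_def second_adm_def by simp_all
qed

text \<open>The Selmer group has exponent 2, so its dimension is the binary logarithm of its order.\<close>
theorem selmer_space_dim:
  assumes "card (sq_class K ` Collect first_adm) * card (sq_class K ` Collect second_adm) = 2 ^ d"
  shows "vectorspace (residue_ring 2) (selmer_space K) \<and>
    vectorspace.fin_dim (residue_ring 2) (selmer_space K) \<and>
    vectorspace.dim (residue_ring 2) (selmer_space K) = d"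
proof -
  interpret K: plain_field K by (rule plain_field_K)
  have A: "Collect first_adm \<subseteq> carrier (mult_of K)" "Collect second_adm \<subseteq> carrier (mult_of K)"
    by (auto simp: first_adm_def second_adm_def)
  have G: "selmer_group K = (prod_one_triples K)\<lparr>carrier := {K.class_triple x y |x y. x \<in> Collect first_adm \<and> y \<in> Collect second_adm}\<rparr>"
    unfolding selmer_group_def selmer_set_eq ..
  have cg: "comm_group (selmer_group K)"
    unfolding G by (rule K.comm_group_class_triples) (use A first_adm_mult second_adm_mult adm_one in auto)
  have sq: "c \<otimes>\<^bsub>selmer_group K\<^esub> c = \<one>\<^bsub>selmer_group K\<^esub>" if "c \<in> carrier (selmer_group K)" for c
    using that unfolding G by (rule K.comm_group_class_triples(2)[rotated -1]) (use A first_adm_mult second_adm_mult adm_one in auto)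
  have "card (carrier (selmer_group K)) = 2 ^ d"
    unfolding G using K.card_class_triples[OF A] assms by simp
  then show ?thesis unfolding selmer_space_def using F2_module_vectorspace[OF cg sq] by blast
qed

end

section \<open>Generators of the two factors\<close>

lemma coprime_if_prime_value:
  fixes a b P :: int
  assumes "Factorial_Ring.prime P" "P = a\<^sup>2 + d * b\<^sup>2" shows "coprime a b"
proof (rule coprimeI)
  fix g assume "g dvd a" "g dvd b"
  then have "g\<^sup>2 dvd a\<^sup>2" "g\<^sup>2 dvd d * b\<^sup>2" by (auto intro: dvd_mult)
  then have "g\<^sup>2 dvd P" using assms(2) by simp
  then show "g dvd 1" using squarefree_prime[OF assms(1)] squarefreeD by blast
qed

context two_adic_place
begin

lemma square_conds: assumes "z \<in> F" "z \<noteq> 0" shows "first_cond (z * z)" "second_cond (z * z)"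
proof -
  obtain n where n: "dyad z (v z) n" using dyad_exists[OF assms] .
  have "dyad (z * z) (2 * v z) (n * n)" using dyad_mult[OF n n] by simp
  moreover have "n * n mod 8 = 1"
    using odd_mod_8_int[OF dyadD(4)[OF n]] mod_mult_eq[of n 8 n, symmetric] by (elim disjE) simp_all
  ultimately have "local_square (z * z)" using local_square_iff_dyad by blast
  then show "first_cond (z * z)" "second_cond (z * z)" by (rule local_square_conds)+
qed

end

text \<open>The elements \<open>eps\<close> and \<open>eta\<close>, of norms \<open>- n\<^sup>2\<close> and \<open>2 w\<^sup>2\<close>, generate together with \<open>-1\<close> and 2 the classes
  with even valuations away from 2.\<close>
locale norm_data = real_quadratic +
  fixes m n u w :: int
  assumes mn: "int p = m\<^sup>2 + n\<^sup>2" "4 dvd m" "odd n" "n > 0"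
    and uw: "int p = u\<^sup>2 - 2 * w\<^sup>2" "odd u" "u > 0" "even w" "w \<noteq> 0"
begin

definition eps :: real where "eps = of_int m + rt"
definition eta :: real where "eta = of_int u + rt"

lemma eps_quad: "eps = quad (of_int m) 1" by (simp add: eps_def quad_def)
lemma eta_quad: "eta = quad (of_int u) 1" by (simp add: eta_def quad_def)

lemma eps_mem [simp]: "eps \<in> F" "eps \<noteq> 0" unfolding eps_quad by (simp_all add: quad_eq_0_iff)
lemma eta_mem [simp]: "eta \<in> F" "eta \<noteq> 0" unfolding eta_quad by (simp_all add: quad_eq_0_iff)

lemma qnorm_eps: "qnorm eps = - ((of_int n)\<^sup>2)"
proof -
  have "(of_nat p :: rat) = of_int (int p)" by simp
  then have "(of_nat p :: rat) = (of_int m)\<^sup>2 + (of_int n)\<^sup>2" unfolding mn(1) by simp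
  then show ?thesis by (simp add: eps_quad qnorm_quad)
qed

lemma qnorm_eta: "qnorm eta = 2 * (of_int w)\<^sup>2"
proof -
  have "(of_nat p :: rat) = of_int (int p)" by simp
  then have "(of_nat p :: rat) = (of_int u)\<^sup>2 - 2 * (of_int w)\<^sup>2" unfolding uw(1) by simp
  then show ?thesis by (simp add: eta_quad qnorm_quad)
qed

lemma unram_eps: "unram eps"
  unfolding eps_def
proof (rule unram_int_plus_sqrt[of m "-1" n])
  have "Factorial_Ring.prime (int p)" using prime_p by simp
  then show "coprime m n" by (rule coprime_if_prime_value[of _ _ 1]) (use mn(1) in simp)
  fix v assume "discrete_valuation K v"
  then show "v (of_int (-1)) = 0" using field_valuation.v_minus_one[OF field_valuationI] by simp
qed (use mn in auto)

lemma unram_two: "unram 2"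
  unfolding unram_def
proof (intro allI impI)
  fix v assume v: "discrete_valuation K v" "\<not> v 2 > 0"
  interpret field_valuation F v by (rule field_valuationI[OF v(1)])
  have "v 2 = 0" using vge_of_int[of 2] v(2) by (simp add: vge_def)
  then show "even (v 2)" by simp
qed

lemma unram_eta: "unram eta"
  unfolding eta_def
proof (rule unram_int_plus_sqrt[of u 2 w])
  have "Factorial_Ring.prime (int p)" using prime_p by simp
  then show "coprime u w" by (rule coprime_if_prime_value[of _ _ "-2"]) (use uw(1) in simp)
  fix v assume v: "discrete_valuation K v" "\<not> v 2 > 0"
  interpret field_valuation F v by (rule field_valuationI[OF v(1)])
  show "v (of_int 2) = 0" using vge_of_int[of 2] v(2) by (simp add: vge_def)
qed (use uw in auto)

text \<open>The integer \<open>s\<close> plays the role of the 2-adic number \<open>\<surd>p\<close>. As \<open>s\<^sup>2 \<equiv> p \<equiv> n\<^sup>2 (mod 16)\<close>, it is congruent to \<open>\<plusminus>n\<close>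
  modulo 8, and adding \<open>m\<close>, a multiple of 4, treats both signs alike.\<close>
lemma eps_residue:
  assumes s: "odd s" "16 dvd s\<^sup>2 - int p"
  shows "(m + s) mod 8 = 1 \<or> (m + s) mod 8 = 7 \<longleftrightarrow> (m + n) mod 8 = 1 \<or> (m + n) mod 8 = 7"
proof -
  obtain a where a: "m = 4 * a" using mn(2) by (elim dvdE)
  have "s\<^sup>2 - n\<^sup>2 = (s\<^sup>2 - int p) + 16 * a\<^sup>2" using mn(1) a by (simp add: power2_eq_square)
  then have "16 dvd s\<^sup>2 - n\<^sup>2" using s(2) by (metis dvd_add dvd_triv_left)
  then have "s\<^sup>2 mod 16 = n\<^sup>2 mod 16" by (simp add: mod_eq_dvd_iff)
  then have sn: "(s mod 8 = 1 \<or> s mod 8 = 7) \<longleftrightarrow> (n mod 8 = 1 \<or> n mod 8 = 7)"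
    unfolding odd_square_mod_16[OF s(1)] odd_square_mod_16[OF mn(3)] by (simp split: if_splits)
  have res: "x mod 8 = 1 \<or> x mod 8 = 3 \<or> x mod 8 = 5 \<or> x mod 8 = 7" if "odd x" for x :: int
    using that by presburger
  show ?thesis
  proof (cases "even a")
    case True
    then obtain b where "a = 2 * b" by (elim evenE)
    then have m8: "m = 8 * b" using a by simp
    show ?thesis unfolding m8 using sn by simp
  next
    case False
    then obtain b where "a = 2 * b + 1" by (elim oddE)
    then have m8: "m = 8 * b + 4" using a by simp
    have e: "(m + x) mod 8 = (4 + x mod 8) mod 8" for x
    proof -
      have "(m + x) - (4 + x) = 8 * b" using m8 by simp
      then have "(m + x) mod 8 = (4 + x) mod 8" by (simp add: mod_eq_dvd_iff)
      then show ?thesis by (simp add: mod_add_right_eq)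
    qed
    show ?thesis unfolding e using sn res[OF s(1)] res[OF mn(3)] by (elim disjE) simp_all
  qed
qed

text \<open>Here \<open>u + s = 2 (s + 2 k)\<close>, so \<open>s + 2 k\<close> is the odd part of the image of \<open>eta\<close> when \<open>s\<close> replaces \<open>\<surd>p\<close>. The equation
  \<open>p = u\<^sup>2 - 2 w\<^sup>2\<close> modulo 16 shows that \<open>k\<close> and \<open>w / 2\<close> have the same parity.\<close>
lemma eta_residue:
  assumes s: "odd s" "16 dvd s\<^sup>2 - int p" and k: "u = s + 4 * k"
  shows "4 dvd (s + 2 * k) - (u + w)"
proof -
  obtain w' where w': "w = 2 * w'" using uw(4) by (elim evenE)
  have "8 * (s * k - w'\<^sup>2) = - (s\<^sup>2 - int p) - 16 * k\<^sup>2"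
    unfolding uw(1) k w' by (simp add: power2_eq_square algebra_simps)
  moreover have "16 dvd - (s\<^sup>2 - int p) - 16 * k\<^sup>2" using s(2) by (intro dvd_diff) (simp_all only: dvd_minus_iff dvd_triv_left)
  ultimately have "8 * 2 dvd 8 * (s * k - w'\<^sup>2)" by simp
  then have "2 dvd s * k - w'\<^sup>2" by (simp only: dvd_mult_cancel_left) simp
  then have "even k \<longleftrightarrow> even w'" using s(1) by simp
  then have "even (k + w')" by simp
  then obtain t where "k + w' = 2 * t" by (elim evenE)
  then have "(s + 2 * k) - (u + w) = 4 * (- t)" using k w' by simp
  then show ?thesis by simp
qed

lemma eps_second_cond:
  assumes v: "discrete_valuation K v" "v 2 > 0"
  shows "two_adic_place.second_cond F v eps \<longleftrightarrow> (m + n) mod 8 = 1 \<or> (m + n) mod 8 = 7"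
    and "v eps = 0"
proof -
  interpret two_adic_place F v by (rule two_adicI[OF v])
  obtain s :: int where s: "odd s" "2 ^ (5 + 3) dvd s\<^sup>2 - int p" "vge (int 5) (rt - of_int s)"
    using sqrt_approx[OF field_valuationI[OF v(1)] v(2), of 5] .
  have "16 dvd (2::int) ^ (5 + 3)" by simp
  then have s16: "16 dvd s\<^sup>2 - int p" using s(2) by (rule dvd_trans)
  have "odd (m + s)" using mn(2) s(1) by auto
  moreover have "eps = 2 powi 0 * (of_int (m + s) + (rt - of_int s))" by (simp add: eps_def)
  moreover have "vge 3 (rt - of_int s)" using vge_mono[OF s(3)] by simp
  ultimately have d: "dyad eps 0 (m + s)" unfolding dyad_def by blast
  then show "v eps = 0" by (rule dyadD(3))
  have "second_cond eps \<longleftrightarrow> (m + s) mod 8 = 1 \<or> (m + s) mod 8 = 7"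
  proof
    assume "second_cond eps"
    then obtain k q where "dyad eps (2 * k) q" "q mod 8 = 1 \<or> q mod 8 = 7" unfolding second_cond_def by blast
    then show "(m + s) mod 8 = 1 \<or> (m + s) mod 8 = 7" using dyad_unique(2)[OF d] by (simp add: cong_def)
  next
    assume "(m + s) mod 8 = 1 \<or> (m + s) mod 8 = 7"
    then show "second_cond eps" unfolding second_cond_def using d by (metis mult_zero_right)
  qed
  then show "second_cond eps \<longleftrightarrow> (m + n) mod 8 = 1 \<or> (m + n) mod 8 = 7"
    using eps_residue[OF s(1) s16] by simp
qed

text \<open>If \<open>\<surd>p \<equiv> u (mod 4)\<close> at the place \<open>v\<close>, then \<open>eta\<close> is twice a unit, computed in \<open>eta_residue\<close>. Otherwise this
  applies to the conjugate \<open>u - \<surd>p\<close>, and \<open>eta\<close> times its conjugate is \<open>2 w\<^sup>2\<close>, which satisfies the condition.\<close>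
lemma eta_first_cond:
  assumes v: "discrete_valuation K v" "v 2 > 0"
  shows "two_adic_place.first_cond F v eta \<longleftrightarrow> (u + w) mod 4 = 1"
proof -
  interpret two_adic_place F v by (rule two_adicI[OF v])
  obtain s :: int where s: "odd s" "2 ^ (5 + 3) dvd s\<^sup>2 - int p" "vge (int 5) (rt - of_int s)"
    using sqrt_approx[OF field_valuationI[OF v(1)] v(2), of 5] .
  have "16 dvd (2::int) ^ (5 + 3)" by simp
  then have s16: "16 dvd s\<^sup>2 - int p" using s(2) by (rule dvd_trans)
  \<comment> \<open>to be applied to \<open>s\<close>, \<open>\<surd>p\<close> and to \<open>- s\<close>, \<open>- \<surd>p\<close>\<close>
  have main: "first_cond (of_int u + t) \<longleftrightarrow> (u + w) mod 4 = 1"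
    if s': "odd s'" "16 dvd s'\<^sup>2 - int p" "4 dvd u - s'" "vge 5 (t - of_int s')" for s' t
  proof -
    obtain k where "u - s' = 4 * k" using s'(3) by (elim dvdE)
    then have k: "u = s' + 4 * k" by simp
    define h where "h = s' + 2 * k"
    have "odd h" using s'(1) by (simp add: h_def)
    have "vge (- 1) (inverse 2)" unfolding vge_def using v_inverse[of 2] v_two by simp
    from vge_mult[OF s'(4) this] have "vge 4 ((t - of_int s') * inverse 2)" by simp
    then have "vge 3 ((t - of_int s') * inverse 2)" by (rule vge_mono) simp
    moreover have "of_int u + t = 2 powi 1 * (of_int h + (t - of_int s') * inverse 2)"
      by (simp add: k h_def algebra_simps)
    ultimately have d: "dyad (of_int u + t) 1 h" unfolding dyad_def using \<open>odd h\<close> by blast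
    have "h mod 4 = (u + w) mod 4"
      using eta_residue[OF s'(1,2) k] by (simp add: h_def mod_eq_dvd_iff)
    moreover have "first_cond (of_int u + t) \<longleftrightarrow> h mod 4 = 1"
    proof
      assume "first_cond (of_int u + t)"
      then obtain l q where lq: "dyad (of_int u + t) l q" "q mod 4 = 1" unfolding first_cond_def by blast
      have "[h = q] (mod 4)" using dyad_unique(2)[OF d lq(1)] by (rule cong_dvd_modulus) simp
      then show "h mod 4 = 1" using lq(2) by (simp add: cong_def)
    qed (use d first_cond_def in blast)
    ultimately show ?thesis by simp
  qed
  have "4 dvd u - s \<or> 4 dvd u - (- s)"
  proof -
    obtain i j where ij: "u = 2 * i + 1" "s = 2 * j + 1" using uw(2) s(1) by (elim oddE)
    show ?thesis
    proof (cases "even (i - j)")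
      case True
      then obtain t where "i - j = 2 * t" by (elim evenE)
      then have "u - s = 4 * t" using ij by simp
      then show ?thesis by simp
    next
      case False
      then have "even (i + j + 1)" by simp
      then obtain t where "i + j + 1 = 2 * t" by (elim evenE)
      then have "u - (- s) = 4 * t" using ij by simp
      then show ?thesis by (metis dvd_triv_left)
    qed
  qed
  then show ?thesis
  proof
    assume "4 dvd u - s"
    then show ?thesis using main[of s rt] s(1,3) s16 by (simp add: eta_def)
  next
    assume d: "4 dvd u - (- s)"
    have "vge 5 (- rt - of_int (- s))" using vge_uminus[OF s(3)] by simp
    then have m: "first_cond (of_int u + - rt) \<longleftrightarrow> (u + w) mod 4 = 1"
      using main[of "- s" "- rt"] s(1) s16 d by simp
    have cF: "of_int u + - rt \<in> F" "of_int u + - rt \<noteq> 0"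
    proof -
      have "of_int u + - rt = quad (of_int u) (-1)" by (simp add: quad_def of_rat_minus)
      then show "of_int u + - rt \<in> F" "of_int u + - rt \<noteq> 0" by (simp_all only: quad_mem quad_eq_0_iff) simp
    qed
    have "eta * (of_int u + - rt) = 2 * (of_int w * of_int w)"
    proof -
      have "eta * (of_int u + - rt) = of_int (u\<^sup>2 - int p)"
        by (simp add: eta_def algebra_simps power2_eq_square)
      also have "u\<^sup>2 - int p = 2 * (w * w)" using uw(1) by (simp add: power2_eq_square)
      finally show ?thesis by simp
    qed
    moreover have "first_cond (2 * (of_int w * of_int w))"
      using first_cond_mult[OF conds_of_known_values(4)[OF v] square_conds(1)[of "of_int w"]] uw(5) by simp
    ultimately have pr: "first_cond (eta * (of_int u + - rt))" by simp
    then have "first_cond eta \<longleftrightarrow> first_cond (of_int u + - rt)"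
      using first_cond_cancel[OF pr _ cF] first_cond_cancel[of "of_int u + - rt" eta] by (auto simp: mult.commute)
    then show ?thesis using m by simp
  qed
qed

text \<open>At the places above 2 the element \<open>eps\<close> is a unit, being the sum of an even number and of a square root of \<open>p\<close>.\<close>
lemma even_everywhere_eps: "even_everywhere eps"
  unfolding even_everywhere_def using eps_second_cond(2) unram_eps unfolding unram_def
  by (metis even_zero)

lemma emb_id: "real_embedding K (\<lambda>x. x)"
  by (auto simp: real_embedding_def ring_hom_def ring_of_type_algebra_def)

lemma emb_qconj: "real_embedding K qconj"
  unfolding real_embedding_def ring_hom_def
  by (auto simp: ring_of_type_algebra_def qconj_quad quad_mult quad_add quad_inj elim!: mem_F_E)
    (use qconj_quad[of 1 0] in \<open>simp add: quad_def\<close>)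

text \<open>Both conjugates \<open>u + \<surd>p\<close> and \<open>u - \<surd>p\<close> are positive, because \<open>u\<^sup>2 = p + 2 w\<^sup>2 > p\<close>.\<close>
lemma eta_positive: assumes "real_embedding K \<sigma>" shows "\<sigma> eta > 0"
proof -
  interpret real_place F \<sigma> by (rule real_placeI[OF assms])
  have "\<sigma> rt * \<sigma> rt = real p" using sig_mult[of rt rt] sig_of_nat[of p] by simp
  then have r2: "(\<sigma> rt)\<^sup>2 = of_int (int p)" by (simp add: power2_eq_square)
  have "w\<^sup>2 > 0" using uw(5) by simp
  then have "int p < u\<^sup>2" using uw(1) by linarith
  then have "(of_int (int p) :: real) < of_int (u\<^sup>2)" by (simp only: of_int_less_iff)
  then have "\<bar>\<sigma> rt\<bar>\<^sup>2 < (of_int u)\<^sup>2" using r2 by simp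
  then have "\<bar>\<sigma> rt\<bar> < of_int u" by (rule power2_less_imp_less) (use uw(3) in simp)
  then show ?thesis using sig_of_int[of u] by (simp add: eta_def sig_add)
qed

lemma first_adm_two: "first_adm 2"
proof -
  have "\<sigma> 2 > 0" if "real_embedding K \<sigma>" for \<sigma>
    using real_place.sig_of_nat[OF real_placeI[OF that], of 2] by simp
  then show ?thesis using unram_two conds_of_known_values(4) unfolding first_adm_def by simp
qed

lemma first_adm_eta: "first_adm eta \<longleftrightarrow> (u + w) mod 4 = 1"
proof
  assume "first_adm eta"
  moreover obtain v where "discrete_valuation K v" "v 2 = 1" by (rule two_adic_place_exists)
  ultimately show "(u + w) mod 4 = 1" using eta_first_cond by (simp add: first_adm_def)
qed (use eta_first_cond eta_positive unram_eta in \<open>simp add: first_adm_def\<close>)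

lemma qnorm_positive: assumes "first_adm x" shows "qnorm x > 0"
proof -
  have x: "x \<in> F" "x > 0" "qconj x > 0" using assms emb_id emb_qconj unfolding first_adm_def by auto
  then have "of_rat (qnorm x) > (0::real)" using mult_qconj[OF x(1)] by (metis mult_pos_pos)
  then show ?thesis by simp
qed

lemma sq_equiv_positive: assumes "sq_equiv s x" shows "x > 0 \<longleftrightarrow> s > 0"
proof -
  obtain z where "z \<noteq> 0" "x = z * z * s" using assms by (auto simp: sq_equiv_def)
  moreover from this have "z * z > 0" by (simp add: zero_less_mult_iff linorder_neq_iff disj_commute)
  ultimately show ?thesis by (simp add: zero_less_mult_iff)
qed

lemma sq_equiv_shift: assumes "t \<in> F" "t \<noteq> 0" "sq_equiv s (x * t)" shows "sq_equiv (s * t) x"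
proof -
  have "sq_equiv (s * t) (x * t * t)" by (rule sq_equiv_mult_right[OF assms(3)])
  moreover have "sq_equiv x (x * t * t)" using sq_equiv_square[OF assms(1,2), of x] by (simp add: mult_ac)
  ultimately show ?thesis using sq_equiv_trans sq_equiv_sym by blast
qed

text \<open>Total positivity leaves the norms 1 and 2, and multiplication by \<open>eta\<close> reduces the second to a square norm. The rational
  class so obtained is positive, hence 1 or 2.\<close>
lemma first_adm_classes:
  assumes x: "first_adm x"
  shows "(\<exists>s\<in>{1, 2}. sq_equiv s x) \<or> (\<exists>s\<in>{1, 2}. sq_equiv (s * eta) x)"
proof -
  have xF: "x \<in> F" "x \<noteq> 0" "unram x" and xp: "x > 0"
    using x emb_id unfolding first_adm_def by auto
  obtain s c where s: "s \<in> {1, -1, 2, -2}" "c \<noteq> 0" "qnorm x = s * c\<^sup>2" using unram_qnorm[OF xF] .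
  have "s > 0" using qnorm_positive[OF x] s(2,3) by (simp add: zero_less_mult_iff)
  then have "s = 1 \<or> s = 2" using s(1) by auto
  then show ?thesis
  proof
    assume "s = 1"
    then have "qnorm x = c\<^sup>2" using s(3) by simp
    then obtain t where "t \<in> {1, -1, 2, -2}" "sq_equiv t x" using unram_square_norm[OF xF] by blast
    then show ?thesis using sq_equiv_positive[of t x] xp by auto
  next
    assume "s = 2"
    then have "qnorm (x * eta) = (2 * c * of_int w)\<^sup>2"
      using s(3) xF by (simp add: qnorm_mult qnorm_eta power_mult_distrib)
    moreover have "x * eta \<in> F" "x * eta \<noteq> 0" "unram (x * eta)"
      using xF unram_mult[OF xF(1,2) eta_mem xF(3) unram_eta] by simp_all
    ultimately obtain t where t: "t \<in> {1, -1, 2, -2}" "sq_equiv t (x * eta)" using unram_square_norm by blast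
    have "x * eta > 0" using xp eta_positive[OF emb_id] by simp
    then have "t \<in> {1, 2}" using sq_equiv_positive[OF t(2)] t(1) by auto
    then show ?thesis using sq_equiv_shift[OF eta_mem t(2)] by blast
  qed
qed

lemma first_adm_eta_if: assumes x: "first_adm x" "sq_equiv (s * eta) x" "s \<in> {1, 2}" shows "first_adm eta"
proof -
  have "two_adic_place.first_cond F v eta" if v: "discrete_valuation K v" "v 2 > 0" for v
  proof -
    interpret two_adic_place F v by (rule two_adicI[OF v])
    obtain z where z: "z \<in> F" "z \<noteq> 0" "x = z * z * (s * eta)" using x(2) by (auto simp: sq_equiv_def)
    have "first_cond s" using x(3) conds_of_known_values[OF v] by auto
    then have "first_cond (z * z * s)" using first_cond_mult square_conds(1)[OF z(1,2)] by blast
    moreover have "first_cond (z * z * s * eta)"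
      using x(1) v z(3) unfolding first_adm_def by (simp add: mult.assoc)
    ultimately show ?thesis using first_cond_cancel eta_mem by blast
  qed
  then show ?thesis using eta_positive unram_eta by (simp add: first_adm_def)
qed

lemma second_adm_even_everywhere: assumes "second_adm x" shows "even_everywhere x"
  unfolding even_everywhere_def
proof (intro allI impI)
  fix v assume v: "discrete_valuation K v"
  show "even (v x)"
  proof (cases "v 2 > 0")
    case True
    interpret two_adic_place F v by (rule two_adicI[OF v True])
    have "second_cond x" using assms v True by (simp add: second_adm_def)
    then obtain k q where "dyad x (2 * k) q" unfolding second_cond_def by blast
    then have "v x = 2 * k" by (rule dyadD(3))
    then show ?thesis by simp
  qed (use assms v in \<open>simp add: second_adm_def unram_def\<close>)
qed

text \<open>The valuations above 2 are even as well, which leaves the norms 1 and \<open>-1\<close>; multiplication by \<open>eps\<close> reduces the second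
  to a square norm.\<close>
lemma second_adm_classes:
  assumes x: "second_adm x"
  shows "(\<exists>s\<in>{1, -1}. sq_equiv s x) \<or> (\<exists>s\<in>{1, -1}. sq_equiv (s * eps) x)"
proof -
  have xF: "x \<in> F" "x \<noteq> 0" "even_everywhere x"
    using x second_adm_even_everywhere unfolding second_adm_def by auto
  obtain s c where s: "s \<in> {1, -1}" "c \<noteq> 0" "qnorm x = s * c\<^sup>2" using even_everywhere_qnorm[OF xF] .
  then have "s = 1 \<or> s = -1" by simp
  then show ?thesis
  proof
    assume "s = 1"
    then have "qnorm x = c\<^sup>2" using s(3) by simp
    then show ?thesis using even_everywhere_square_norm[OF xF] by blast
  next
    assume "s = -1"
    then have "qnorm (x * eps) = (c * of_int n)\<^sup>2"
      using s(3) xF by (simp add: qnorm_mult qnorm_eps power_mult_distrib)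
    moreover have "x * eps \<in> F" "x * eps \<noteq> 0" "even_everywhere (x * eps)"
      using xF even_everywhere_mult[OF xF(1,2) eps_mem xF(3) even_everywhere_eps] by simp_all
    ultimately obtain t where t: "t \<in> {1, -1}" "sq_equiv t (x * eps)" using even_everywhere_square_norm by blast
    then show ?thesis using sq_equiv_shift[OF eps_mem t(2)] by blast
  qed
qed

lemma unram_minus_one: "unram (-1)"
proof -
  have "v (-1) = 0" if "discrete_valuation K v" for v
    using field_valuation.v_minus_one[OF field_valuationI[OF that]] .
  then show ?thesis unfolding unram_def by (metis even_zero)
qed

lemma second_adm_minus_one: "second_adm (-1)"
  using conds_of_known_values(3) unram_minus_one unfolding second_adm_def by simp

lemma second_adm_eps: "second_adm eps \<longleftrightarrow> (m + n) mod 8 = 1 \<or> (m + n) mod 8 = 7"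
proof
  assume "second_adm eps"
  moreover obtain v where "discrete_valuation K v" "v 2 = 1" by (rule two_adic_place_exists)
  ultimately show "(m + n) mod 8 = 1 \<or> (m + n) mod 8 = 7" using eps_second_cond(1) by (simp add: second_adm_def)
qed (use eps_second_cond(1) unram_eps in \<open>simp add: second_adm_def\<close>)

lemma second_adm_eps_if: assumes x: "second_adm x" "sq_equiv (s * eps) x" "s \<in> {1, -1}" shows "second_adm eps"
proof -
  have "two_adic_place.second_cond F v eps" if v: "discrete_valuation K v" "v 2 > 0" for v
  proof -
    interpret two_adic_place F v by (rule two_adicI[OF v])
    obtain z where z: "z \<in> F" "z \<noteq> 0" "x = z * z * (s * eps)" using x(2) by (auto simp: sq_equiv_def)
    have "second_cond s" using x(3) conds_of_known_values[OF v] by auto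
    then have "second_cond (z * z * s)" using second_cond_mult square_conds(2)[OF z(1,2)] by blast
    moreover have "second_cond (z * z * s * eps)"
      using x(1) v z(3) unfolding second_adm_def by (simp add: mult.assoc)
    ultimately show ?thesis using second_cond_cancel eps_mem by blast
  qed
  then show ?thesis using unram_eps by (simp add: second_adm_def)
qed

section \<open>The orders of the two factors\<close>

lemma qnorm_sq_equiv: assumes "sq_equiv x y" "x \<in> F" "x \<noteq> 0"
  obtains c where "c \<noteq> 0" "qnorm y = c\<^sup>2 * qnorm x"
proof -
  obtain z where z: "z \<in> F" "z \<noteq> 0" "y = z * z * x" using assms(1) by (auto simp: sq_equiv_def)
  then have "qnorm y = (qnorm z)\<^sup>2 * qnorm x" using assms by (simp add: qnorm_mult power2_eq_square)
  then show thesis using that qnorm_nonzero[OF z(1,2)] by blast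
qed

lemma not_sq_equiv_double: assumes "x \<in> F" "x \<noteq> 0" shows "\<not> sq_equiv x (2 * x)"
proof
  assume s: "sq_equiv x (2 * x)"
  obtain v where v: "discrete_valuation K v" "v 2 = 1" by (rule two_adic_place_exists)
  interpret field_valuation F v by (rule field_valuationI[OF v(1)])
  have "v (2 * x) = 1 + v x" using assms v(2) by (simp add: v_mult)
  then show False using even_v_sq_equiv[OF s assms v(1)] by simp
qed

lemma not_sq_equiv_eta: assumes "s \<in> {1, 2}" "t \<in> {1, 2}" shows "\<not> sq_equiv s (t * eta)"
proof
  assume sq_equiv: "sq_equiv s (t * eta)"
  have sF: "s \<in> F" "s \<noteq> 0" using assms by auto
  obtain c where c: "c \<noteq> 0" "qnorm (t * eta) = c\<^sup>2 * qnorm s" by (rule qnorm_sq_equiv[OF sq_equiv sF])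
  have n12: "qnorm 1 = 1" "qnorm 2 = 2\<^sup>2" using qnorm_of_rat[of 1] qnorm_of_rat[of 2] by simp_all
  obtain a where a: "a \<noteq> 0" "qnorm s = a\<^sup>2" using assms(1) n12 by (metis insertE one_power2 singletonD zero_neq_numeral zero_neq_one)
  obtain b where b: "b \<noteq> 0" "qnorm t = b\<^sup>2" using assms(2) n12 by (metis insertE one_power2 singletonD zero_neq_numeral zero_neq_one)
  have tF: "t \<in> F" using assms by auto
  define d where "d = b * of_int w"
  define e where "e = c * a"
  have eq: "2 * d\<^sup>2 = e\<^sup>2" using c(2) a(2) b(2) qnorm_mult[OF tF eta_mem(1)] qnorm_eta
    by (simp add: d_def e_def power_mult_distrib)
  have de: "d \<noteq> 0" "e \<noteq> 0" using a(1) b(1) c(1) uw(5) by (simp_all add: d_def e_def)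
  have p2: "Factorial_Ring.prime (2::nat)" by simp
  have "rat_val 2 (2 * d\<^sup>2) = 1 + 2 * rat_val 2 d"
    using rat_val_mult[OF p2, of 2 "d\<^sup>2"] rat_val_prime[OF p2] rat_val_power[OF p2 de(1), of 2] de(1) by simp
  moreover have "rat_val 2 (e\<^sup>2) = 2 * rat_val 2 e" using rat_val_power[OF p2 de(2), of 2] by simp
  ultimately have "1 + 2 * rat_val 2 d = 2 * rat_val 2 e" using eq by simp
  then show False by presburger
qed

lemma not_sq_equiv_minus: assumes "x \<noteq> 0" shows "\<not> sq_equiv x (- x)"
  using sq_equiv_positive[of x "- x"] assms by (metis linorder_neqE_linordered_idom neg_0_less_iff_less not_less_iff_gr_or_eq)

lemma not_sq_equiv_eps: assumes "s \<in> {1, -1}" "t \<in> {1, -1}" shows "\<not> sq_equiv s (t * eps)"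
proof
  assume sq_equiv: "sq_equiv s (t * eps)"
  have sF: "s \<in> F" "s \<noteq> 0" using assms by auto
  obtain c where c: "c \<noteq> 0" "qnorm (t * eps) = c\<^sup>2 * qnorm s" by (rule qnorm_sq_equiv[OF sq_equiv sF])
  have "qnorm 1 = 1" "qnorm (-1) = 1" using qnorm_of_rat[of 1] qnorm_of_rat[of "-1"] by simp_all
  then have "qnorm s = 1" "qnorm t = 1" using assms by auto
  moreover have "qnorm (t * eps) = qnorm t * qnorm eps" using assms(2) by (intro qnorm_mult) auto
  ultimately have "- ((of_int n)\<^sup>2) = c\<^sup>2" using c(2) qnorm_eps by simp
  moreover have "c\<^sup>2 > 0" "(of_int n :: rat)\<^sup>2 \<ge> 0" using c(1) by simp_all
  ultimately show False by linarith
qed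

text \<open>A set of representatives of the classes of the elements with a property.\<close>
lemma classes_image:
  assumes "T \<subseteq> Collect P" "\<And>x. P x \<Longrightarrow> \<exists>t\<in>T. sq_equiv t x" "\<And>x. P x \<Longrightarrow> x \<in> F \<and> x \<noteq> 0"
  shows "sq_class K ` Collect P = sq_class K ` T"
proof
  show "sq_class K ` T \<subseteq> sq_class K ` Collect P" using assms(1) by blast
  show "sq_class K ` Collect P \<subseteq> sq_class K ` T"
  proof
    fix C assume "C \<in> sq_class K ` Collect P"
    then obtain x where x: "P x" "C = sq_class K x" by blast
    obtain t where t: "t \<in> T" "sq_equiv t x" using assms(2)[OF x(1)] by blast
    have "t \<in> F" "t \<noteq> 0" "x \<in> F" "x \<noteq> 0" using assms(1,3) t(1) x(1) by blast+
    then have "sq_class K t = sq_class K x" using sq_class_eq_sq_equiv t(2) by blast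
    then show "C \<in> sq_class K ` T" using t(1) x(2) by blast
  qed
qed

lemma card_first_adm: "card (sq_class K ` Collect first_adm) = (if (u + w) mod 4 = 1 then 4 else 2)"
proof -
  have mem: "1 \<in> F" "2 \<in> F" "2 * eta \<in> F" "2 * eta \<noteq> 0" "eta \<in> F" by simp_all
  have F: "first_adm x \<Longrightarrow> x \<in> F \<and> x \<noteq> 0" for x by (simp add: first_adm_def)
  have ns: "\<not> sq_equiv 1 2" "\<not> sq_equiv 1 eta" "\<not> sq_equiv 1 (2 * eta)" "\<not> sq_equiv 2 eta" "\<not> sq_equiv 2 (2 * eta)" "\<not> sq_equiv eta (2 * eta)"
    using not_sq_equiv_double[of 1] not_sq_equiv_double[of eta] not_sq_equiv_eta[of 1 1] not_sq_equiv_eta[of 1 2]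
      not_sq_equiv_eta[of 2 1] not_sq_equiv_eta[of 2 2] by simp_all
  show ?thesis
  proof (cases "(u + w) mod 4 = 1")
    case True
    then have "first_adm eta" using first_adm_eta by simp
    then have "{1, 2, eta, 2 * eta} \<subseteq> Collect first_adm"
      using adm_one(1) first_adm_two first_adm_mult[OF first_adm_two] by simp
    then have "sq_class K ` Collect first_adm = sq_class K ` {1, 2, eta, 2 * eta}"
      by (rule classes_image[OF _ _ F]) (use first_adm_classes in fastforce)
    then show ?thesis using True ns by (simp add: sq_class_eq_sq_equiv)
  next
    case False
    have "{1, 2} \<subseteq> Collect first_adm" using adm_one(1) first_adm_two by simp
    then have "sq_class K ` Collect first_adm = sq_class K ` {1, 2}"
      by (rule classes_image[OF _ _ F]) (use first_adm_classes first_adm_eta_if first_adm_eta False in blast)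
    then show ?thesis using False ns by (simp add: sq_class_eq_sq_equiv)
  qed
qed

lemma card_second_adm: "card (sq_class K ` Collect second_adm) = (if (m + n) mod 8 = 1 \<or> (m + n) mod 8 = 7 then 4 else 2)"
proof -
  have F: "second_adm x \<Longrightarrow> x \<in> F \<and> x \<noteq> 0" for x by (simp add: second_adm_def)
  have ns: "\<not> sq_equiv 1 (-1)" "\<not> sq_equiv 1 eps" "\<not> sq_equiv 1 (- eps)" "\<not> sq_equiv (-1) eps" "\<not> sq_equiv (-1) (- eps)" "\<not> sq_equiv eps (- eps)"
    using not_sq_equiv_minus[of 1] not_sq_equiv_minus[of eps] not_sq_equiv_eps[of 1 1] not_sq_equiv_eps[of 1 "-1"]
      not_sq_equiv_eps[of "-1" 1] not_sq_equiv_eps[of "-1" "-1"] by simp_all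
  show ?thesis
  proof (cases "(m + n) mod 8 = 1 \<or> (m + n) mod 8 = 7")
    case True
    then have "second_adm eps" using second_adm_eps by simp
    then have "{1, -1, eps, - eps} \<subseteq> Collect second_adm"
      using adm_one(2) second_adm_minus_one second_adm_mult[OF second_adm_minus_one] by fastforce
    then have "sq_class K ` Collect second_adm = sq_class K ` {1, -1, eps, - eps}"
      by (rule classes_image[OF _ _ F]) (use second_adm_classes in fastforce)
    then show ?thesis using True ns by (simp add: sq_class_eq_sq_equiv)
  next
    case False
    have "{1, -1} \<subseteq> Collect second_adm" using adm_one(2) second_adm_minus_one by simp
    then have "sq_class K ` Collect second_adm = sq_class K ` {1, -1}"
      by (rule classes_image[OF _ _ F]) (use second_adm_classes second_adm_eps_if second_adm_eps False in blast)
    then show ?thesis using False ns by (simp add: sq_class_eq_sq_equiv)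
  qed
qed

end

theorem proposition2p5:
  fixes p :: nat and j :: int
  assumes "Factorial_Ring.prime p" and "[p = 1] (mod 8)" and "[j\<^sup>2 = -1] (mod int p)"
  shows "vectorspace (residue_ring 2) (selmer_space (quadratic_field p)) \<and>
    vectorspace.fin_dim (residue_ring 2) (selmer_space (quadratic_field p)) \<and>
    (Legendre (1 + j) (int p) = 1 \<longrightarrow>
       vectorspace.dim (residue_ring 2) (selmer_space (quadratic_field p)) = 4) \<and>
    (Legendre (1 + j) (int p) = -1 \<longrightarrow>
       vectorspace.dim (residue_ring 2) (selmer_space (quadratic_field p)) = 2)"
proof -
  have p8: "p mod 8 = 1" using assms(2) by (simp add: cong_def)
  obtain m n :: int where mn: "int p = m\<^sup>2 + n\<^sup>2" "4 dvd m" "odd n" "n > 0"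
    by (rule sum_of_two_squares_prime[OF assms(1) p8 assms(3)])
  obtain u w :: int where uw: "int p = u\<^sup>2 - 2 * w\<^sup>2" "odd u" "u > 0" "even w" "w \<noteq> 0"
    by (rule prime_eq_sq_minus_2_sq[OF assms(1) p8])
  interpret norm_data p m n u w using assms(1) p8 mn uw by unfold_locales
  have L1: "Legendre (1 + j) p = (if (m + n) mod 8 = 1 \<or> (m + n) mod 8 = 7 then 1 else -1)"
    using Legendre_one_plus_sqrt_minus_one_by_sum_of_squares[OF assms(1) p8 assms(3) mn] by simp
  have L2: "Legendre (1 + j) p = (if (u + w) mod 4 = 1 then 1 else -1)"
    by (rule Legendre_one_plus_sqrt_minus_one_by_sq_minus_2_sq[OF assms(1) p8 assms(3) uw])
  show ?thesis
  proof (cases "Legendre (1 + j) p = 1")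
    case True
    then have "card (sq_class K ` Collect first_adm) * card (sq_class K ` Collect second_adm) = 2 ^ 4"
      using L1 L2 by (simp add: card_first_adm card_second_adm split: if_splits)
    from selmer_space_dim[OF this] show ?thesis using True by (simp add: quadratic_field_eq)
  next
    case False
    then have "card (sq_class K ` Collect first_adm) * card (sq_class K ` Collect second_adm) = 2 ^ 2"
      using L1 L2 by (simp add: card_first_adm card_second_adm split: if_splits)
    from selmer_space_dim[OF this] show ?thesis using False by (simp add: quadratic_field_eq)
  qed
qed

end
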